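(* The categories $\mathbf{ThMV}$, $\mathbf{ThDMV'}$ and $\mathbf{ThRMV'}$ are equivalent.
   Context: An MV-algebra is a structure $(A,\oplus,{}^*,0)$ with $(A,\oplus,0)$ an Abelian monoid, $x^{**}=x$, $(x^*\oplus y)^*\oplus y=(y^*\oplus x)^*\oplus x$, $0^*\oplus x=0^*$; $1=0^*$, $x\odot y=(x^*\oplus y^* )^*$; order: $x\le y$ iff $x^*\oplus y=1$. A Riesz MV-algebra (resp. DMV-algebra) is an MV-algebra with unary operations $x\mapsto rx$, $r\in S$, with $S=[0,1]$ (resp. $S=[0,1]\cap\mathbb Q$), satisfying $r(x\odot y^* )=(rx)\odot(ry)^*$, $(r\odot q^* )x=(rx)\odot(qx)^*$, $r(qx)=(rq)x$, $1x=x$ (where $r\odot q^*=\max(0,r-q)$ for numbers). An ideal of an MV-algebra is a nonempty downward closed subset closed under $\oplus$; ideals of a DMV-algebra or Riesz MV-algebra are the ideals of its MV-reduct. For a set $X$, $MV_X$, $DMV_X$, $RMV_X$ denote the free MV-algebra, free DMV-algebra and free Riesz MV-algebra over $X$ (the corresponding Lindenbaum–Tarski algebras over the variables $X$). $MV_X$ is identified with an MV-subalgebra of $DMV_X$ and of $RMV_X$, and $DMV_X$ with a DMV-subalgebra of $RMV_X$, via the maps that are the identity on $X$. $\mathbf{ThMV}$: objects are pairs $(X,I)$ with $X$ a set and $I$ a finitely generated ideal of $MV_X$; arrows $\sigma:(X,I)\to(Y,J)$ are MV-homomorphisms $\sigma:MV_X\to MV_Y$ with $\sigma(I)\subseteq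 J$. $\mathbf{ThDMV'}$: objects are pairs $(X,I)$ with $X$ a set and $I$ a finitely generated ideal of $DMV_X$; arrows $\sigma:(X,I)\to(Y,J)$ are DMV-homomorphisms $\sigma:DMV_X\to DMV_Y$ with $\sigma(I)\subseteq J$ and $\sigma(X)\subseteq MV_Y$. $\mathbf{ThRMV'}$: objects are pairs $(X,I)$ with $X$ a set and $I\subseteq RMV_X$ an ideal generated by a single element $f\in DMV_X$; arrows $\tau:(X,I)\to(Y,J)$ are Riesz MV-homomorphisms $\tau:RMV_X\to RMV_Y$ with $\tau(I)\subseteq J$ and $\tau(X)\subseteq MV_Y$. *)

theory Defs
  imports Complex_Main "HOL-Algebra.Group" "HOL-Library.FuncSet"
begin

section \<open>MV-algebras, DMV-algebras and Riesz MV-algebras\<close>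

text \<open>
  One record and one locale serve all three kinds of algebras; they differ in the set \<open>S\<close> of
  scalars only. For plain MV-algebras \<open>S\<close> is empty, and the operation \<open>mv_scal\<close> is then
  unconstrained and irrelevant.
\<close>

record 'a mv_alg = "'a partial_object" +
  mv_plus :: "'a \<Rightarrow> 'a \<Rightarrow> 'a" (infixl "\<oplus>\<index>" 65)
  mv_neg :: "'a \<Rightarrow> 'a" ("\<sim>\<index> _" [81] 80)
  mv_zero :: 'a ("\<zero>\<index>")
  mv_scal :: "real \<Rightarrow> 'a \<Rightarrow> 'a" (infixr "\<cdot>\<index>" 75)

definition mv_one :: "('a, 'm) mv_alg_scheme \<Rightarrow> 'a"
  where "mv_one A = \<sim>\<^bsub>A\<^esub> \<zero>\<^bsub>A\<^esub>"

definition mv_odot :: "('a, 'm) mv_alg_scheme \<Rightarrow> 'a \<Rightarrow> 'a \<Rightarrow> 'a" (infixl "\<odot>\<index>" 70)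
  where "mv_odot A x y = \<sim>\<^bsub>A\<^esub> (\<sim>\<^bsub>A\<^esub> x \<oplus>\<^bsub>A\<^esub> \<sim>\<^bsub>A\<^esub> y)"

definition mv_le :: "('a, 'm) mv_alg_scheme \<Rightarrow> 'a \<Rightarrow> 'a \<Rightarrow> bool" (infix "\<sqsubseteq>\<index>" 50)
  where "mv_le A x y \<longleftrightarrow> \<sim>\<^bsub>A\<^esub> x \<oplus>\<^bsub>A\<^esub> y = mv_one A"

locale mv_algebra =
  fixes A :: "('a, 'm) mv_alg_scheme" (structure)
  assumes plus_monoid: "comm_monoid \<lparr>carrier = carrier A, mult = mv_plus A, one = mv_zero A\<rparr>"
    and neg_closed: "x \<in> carrier A \<Longrightarrow> \<sim> x \<in> carrier A"
    and neg_neg: "x \<in> carrier A \<Longrightarrow> \<sim> (\<sim> x) = x"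
    and lukasiewicz: "\<lbrakk>x \<in> carrier A; y \<in> carrier A\<rbrakk>
          \<Longrightarrow> \<sim> (\<sim> x \<oplus> y) \<oplus> y = \<sim> (\<sim> y \<oplus> x) \<oplus> x"
    and one_absorb: "x \<in> carrier A \<Longrightarrow> \<sim> \<zero> \<oplus> x = \<sim> \<zero>"

locale scalar_mv_algebra = mv_algebra A for S :: "real set" and A (structure) +
  assumes scal_closed: "\<lbrakk>r \<in> S; x \<in> carrier A\<rbrakk> \<Longrightarrow> r \<cdot> x \<in> carrier A"
    and scal_odot: "\<lbrakk>r \<in> S; x \<in> carrier A; y \<in> carrier A\<rbrakk>
          \<Longrightarrow> r \<cdot> (x \<odot> \<sim> y) = (r \<cdot> x) \<odot> \<sim> (r \<cdot> y)"
    and scal_diff: "\<lbrakk>r \<in> S; q \<in> S; x \<in> carrier A\<rbrakk>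
          \<Longrightarrow> max 0 (r - q) \<cdot> x = (r \<cdot> x) \<odot> \<sim> (q \<cdot> x)"
    and scal_scal: "\<lbrakk>r \<in> S; q \<in> S; x \<in> carrier A\<rbrakk> \<Longrightarrow> r \<cdot> (q \<cdot> x) = (r * q) \<cdot> x"
    and scal_one: "\<lbrakk>1 \<in> S; x \<in> carrier A\<rbrakk> \<Longrightarrow> 1 \<cdot> x = x"

abbreviation mv_scalars :: "real set" where "mv_scalars \<equiv> {}"
abbreviation dmv_scalars :: "real set" where "dmv_scalars \<equiv> {0..1} \<inter> \<rat>"
abbreviation rmv_scalars :: "real set" where "rmv_scalars \<equiv> {0..1}"

text \<open>Homomorphisms are extensional functions, so that equality of arrows is equality on the carrier.\<close>

definition mv_hom ::
    "real set \<Rightarrow> ('a, 'm) mv_alg_scheme \<Rightarrow> ('b, 'n) mv_alg_scheme \<Rightarrow> ('a \<Rightarrow> 'b) set"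
  where "mv_hom S A B = {h \<in> carrier A \<rightarrow>\<^sub>E carrier B.
      (\<forall>x\<in>carrier A. \<forall>y\<in>carrier A. h (x \<oplus>\<^bsub>A\<^esub> y) = h x \<oplus>\<^bsub>B\<^esub> h y) \<and>
      (\<forall>x\<in>carrier A. h (\<sim>\<^bsub>A\<^esub> x) = \<sim>\<^bsub>B\<^esub> (h x)) \<and>
      h \<zero>\<^bsub>A\<^esub> = \<zero>\<^bsub>B\<^esub> \<and>
      (\<forall>r\<in>S. \<forall>x\<in>carrier A. h (r \<cdot>\<^bsub>A\<^esub> x) = r \<cdot>\<^bsub>B\<^esub> h x)}"

text \<open>Ideals only refer to the MV-reduct.\<close>

definition mv_ideal :: "('a, 'm) mv_alg_scheme \<Rightarrow> 'a set \<Rightarrow> bool"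
  where "mv_ideal A I \<longleftrightarrow> I \<subseteq> carrier A \<and> I \<noteq> {} \<and>
      (\<forall>x\<in>carrier A. \<forall>y\<in>I. x \<sqsubseteq>\<^bsub>A\<^esub> y \<longrightarrow> x \<in> I) \<and>
      (\<forall>x\<in>I. \<forall>y\<in>I. x \<oplus>\<^bsub>A\<^esub> y \<in> I)"

definition mv_ideal_gen :: "('a, 'm) mv_alg_scheme \<Rightarrow> 'a set \<Rightarrow> 'a set"
  where "mv_ideal_gen A G = \<Inter>{I. mv_ideal A I \<and> G \<subseteq> I}"

definition fin_gen_ideal :: "('a, 'm) mv_alg_scheme \<Rightarrow> 'a set \<Rightarrow> bool"
  where "fin_gen_ideal A I \<longleftrightarrow> (\<exists>G. finite G \<and> G \<subseteq> carrier A \<and> I = mv_ideal_gen A G)"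


section \<open>Free algebras\<close>

datatype 'x mv_term =
    Var 'x
  | Zero
  | Neg "'x mv_term"
  | Plus "'x mv_term" "'x mv_term"
  | Scal real "'x mv_term"

abbreviation Odot :: "'x mv_term \<Rightarrow> 'x mv_term \<Rightarrow> 'x mv_term"
  where "Odot t u \<equiv> Neg (Plus (Neg t) (Neg u))"

inductive_set terms :: "real set \<Rightarrow> 'x set \<Rightarrow> 'x mv_term set"
  for S :: "real set" and X :: "'x set"
  where
    Var: "x \<in> X \<Longrightarrow> Var x \<in> terms S X"
  | Zero: "Zero \<in> terms S X"
  | Neg: "t \<in> terms S X \<Longrightarrow> Neg t \<in> terms S X"
  | Plus: "\<lbrakk>t \<in> terms S X; u \<in> terms S X\<rbrakk> \<Longrightarrow> Plus t u \<in> terms S X"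
  | Scal: "\<lbrakk>r \<in> S; t \<in> terms S X\<rbrakk> \<Longrightarrow> Scal r t \<in> terms S X"

text \<open>Equational provability from the axioms, between terms over \<open>X\<close> with scalars in \<open>S\<close>.\<close>

inductive_set term_eq :: "real set \<Rightarrow> 'x set \<Rightarrow> ('x mv_term \<times> 'x mv_term) set"
  for S :: "real set" and X :: "'x set"
  where
    refl: "t \<in> terms S X \<Longrightarrow> (t, t) \<in> term_eq S X"
  | sym: "(t, u) \<in> term_eq S X \<Longrightarrow> (u, t) \<in> term_eq S X"
  | trans: "\<lbrakk>(t, u) \<in> term_eq S X; (u, v) \<in> term_eq S X\<rbrakk> \<Longrightarrow> (t, v) \<in> term_eq S X"
  | cong_Neg: "(t, u) \<in> term_eq S X \<Longrightarrow> (Neg t, Neg u) \<in> term_eq S X"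
  | cong_Plus: "\<lbrakk>(t, u) \<in> term_eq S X; (t', u') \<in> term_eq S X\<rbrakk>
      \<Longrightarrow> (Plus t t', Plus u u') \<in> term_eq S X"
  | cong_Scal: "\<lbrakk>r \<in> S; (t, u) \<in> term_eq S X\<rbrakk> \<Longrightarrow> (Scal r t, Scal r u) \<in> term_eq S X"
  | assoc: "\<lbrakk>t \<in> terms S X; u \<in> terms S X; v \<in> terms S X\<rbrakk>
      \<Longrightarrow> (Plus (Plus t u) v, Plus t (Plus u v)) \<in> term_eq S X"
  | comm: "\<lbrakk>t \<in> terms S X; u \<in> terms S X\<rbrakk> \<Longrightarrow> (Plus t u, Plus u t) \<in> term_eq S X"
  | unit: "t \<in> terms S X \<Longrightarrow> (Plus t Zero, t) \<in> term_eq S X"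
  | neg_neg: "t \<in> terms S X \<Longrightarrow> (Neg (Neg t), t) \<in> term_eq S X"
  | lukasiewicz: "\<lbrakk>t \<in> terms S X; u \<in> terms S X\<rbrakk>
      \<Longrightarrow> (Plus (Neg (Plus (Neg t) u)) u, Plus (Neg (Plus (Neg u) t)) t) \<in> term_eq S X"
  | one_absorb: "t \<in> terms S X \<Longrightarrow> (Plus (Neg Zero) t, Neg Zero) \<in> term_eq S X"
  | scal_odot: "\<lbrakk>r \<in> S; t \<in> terms S X; u \<in> terms S X\<rbrakk>
      \<Longrightarrow> (Scal r (Odot t (Neg u)), Odot (Scal r t) (Neg (Scal r u))) \<in> term_eq S X"
  | scal_diff: "\<lbrakk>r \<in> S; q \<in> S; t \<in> terms S X\<rbrakk>
      \<Longrightarrow> (Scal (max 0 (r - q)) t, Odot (Scal r t) (Neg (Scal q t))) \<in> term_eq S X"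
  | scal_scal: "\<lbrakk>r \<in> S; q \<in> S; t \<in> terms S X\<rbrakk>
      \<Longrightarrow> (Scal r (Scal q t), Scal (r * q) t) \<in> term_eq S X"
  | scal_one: "\<lbrakk>1 \<in> S; t \<in> terms S X\<rbrakk> \<Longrightarrow> (Scal 1 t, t) \<in> term_eq S X"

definition term_class :: "real set \<Rightarrow> 'x set \<Rightarrow> 'x mv_term \<Rightarrow> 'x mv_term set"
  where "term_class S X t = term_eq S X `` {t}"

definition free_alg :: "real set \<Rightarrow> 'x set \<Rightarrow> 'x mv_term set mv_alg"
  where "free_alg S X = \<lparr>
    carrier = terms S X // term_eq S X,
    mv_plus = (\<lambda>a b. term_eq S X `` {Plus t u |t u. t \<in> a \<and> u \<in> b}),
    mv_neg = (\<lambda>a. term_eq S X `` (Neg ` a)),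
    mv_zero = term_class S X Zero,
    mv_scal = (\<lambda>r a. term_eq S X `` (Scal r ` a))\<rparr>"

definition free_gen :: "real set \<Rightarrow> 'x set \<Rightarrow> 'x \<Rightarrow> 'x mv_term set"
  where "free_gen S X x = term_class S X (Var x)"

abbreviation MV :: "'x set \<Rightarrow> 'x mv_term set mv_alg" where "MV \<equiv> free_alg mv_scalars"
abbreviation DMV :: "'x set \<Rightarrow> 'x mv_term set mv_alg" where "DMV \<equiv> free_alg dmv_scalars"
abbreviation RMV :: "'x set \<Rightarrow> 'x mv_term set mv_alg" where "RMV \<equiv> free_alg rmv_scalars"

text \<open>
  For \<open>S \<subseteq> S'\<close>, the canonical map from \<open>free_alg S X\<close> to \<open>free_alg S' X\<close> that is the identity on
  \<open>X\<close>: it takes the \<open>S\<close>-class of a term to its \<open>S'\<close>-class. The smaller free algebra is identified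
  with the image \<open>free_sub S S' X\<close> of this map.
\<close>

definition free_incl :: "real set \<Rightarrow> 'x set \<Rightarrow> 'x mv_term set \<Rightarrow> 'x mv_term set"
  where "free_incl S' X a = term_eq S' X `` a"

definition free_sub :: "real set \<Rightarrow> real set \<Rightarrow> 'x set \<Rightarrow> 'x mv_term set set"
  where "free_sub S S' X = free_incl S' X ` carrier (free_alg S X)"

subsection \<open>Freeness\<close>

locale scalar_set =
  fixes S :: "real set"
  assumes diff_in: "\<lbrakk>r \<in> S; q \<in> S\<rbrakk> \<Longrightarrow> max 0 (r - q) \<in> S"
    and mult_in: "\<lbrakk>r \<in> S; q \<in> S\<rbrakk> \<Longrightarrow> r * q \<in> S"

lemma scalar_sets: "scalar_set mv_scalars" "scalar_set dmv_scalars" "scalar_set rmv_scalars"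
  by unfold_locales (auto simp: max_def mult_le_one)

context scalar_set
begin

lemma term_eq_terms: "(t, u) \<in> term_eq S X \<Longrightarrow> t \<in> terms S X \<and> u \<in> terms S X"
  by (induction rule: term_eq.induct) (auto intro!: terms.intros diff_in mult_in)

lemma equiv_term_eq: "equiv (terms S X) (term_eq S X)"
  using term_eq_terms[of _ _ X]
  by (intro equivI) (auto intro!: refl_onI symI transI intro: term_eq.refl term_eq.sym term_eq.trans)

lemma class_eq_iff: "\<lbrakk>t \<in> terms S X; u \<in> terms S X\<rbrakk> \<Longrightarrow> term_class S X t = term_class S X u \<longleftrightarrow> (t, u) \<in> term_eq S X"
  unfolding term_class_def using eq_equiv_class_iff[OF equiv_term_eq] by blast

lemma class_eqI: "(t, u) \<in> term_eq S X \<Longrightarrow> term_class S X t = term_class S X u"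
  unfolding term_class_def using equiv_class_eq[OF equiv_term_eq] by blast

lemma class_in: "t \<in> terms S X \<Longrightarrow> term_class S X t \<in> carrier (free_alg S X)"
  by (simp add: free_alg_def term_class_def quotientI)

lemma carrier_free: "carrier (free_alg S X) = term_class S X ` terms S X"
  by (auto simp: free_alg_def term_class_def quotient_def)

lemma free_ops:
  shows "mv_zero (free_alg S X) = term_class S X Zero"
    and "t \<in> terms S X \<Longrightarrow> mv_neg (free_alg S X) (term_class S X t) = term_class S X (Neg t)"
    and "\<lbrakk>t \<in> terms S X; u \<in> terms S X\<rbrakk>
      \<Longrightarrow> mv_plus (free_alg S X) (term_class S X t) (term_class S X u) = term_class S X (Plus t u)"
    and "\<lbrakk>r \<in> S; t \<in> terms S X\<rbrakk> \<Longrightarrow> mv_scal (free_alg S X) r (term_class S X t) = term_class S X (Scal r t)"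
proof -
  show "mv_zero (free_alg S X) = term_class S X Zero" by (simp add: free_alg_def)
  show "mv_neg (free_alg S X) (term_class S X t) = term_class S X (Neg t)" if "t \<in> terms S X"
    using that unfolding free_alg_def term_class_def
    by (auto intro: term_eq.refl) (meson term_eq.cong_Neg term_eq.sym term_eq.trans term_eq.refl)+
  show "mv_plus (free_alg S X) (term_class S X t) (term_class S X u) = term_class S X (Plus t u)"
    if "t \<in> terms S X" "u \<in> terms S X"
    using that unfolding free_alg_def term_class_def
    by (auto intro: term_eq.refl) (meson term_eq.cong_Plus term_eq.sym term_eq.trans term_eq.refl)+
  show "mv_scal (free_alg S X) r (term_class S X t) = term_class S X (Scal r t)" if "r \<in> S" "t \<in> terms S X"
    using that unfolding free_alg_def term_class_def
    by (auto intro: term_eq.refl) (meson term_eq.cong_Scal term_eq.sym term_eq.trans term_eq.refl)+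
qed

lemma term_eq_unit_left: "t \<in> terms S X \<Longrightarrow> (Plus Zero t, t) \<in> term_eq S X"
  by (meson term_eq.comm term_eq.trans term_eq.unit terms.Zero)

theorem free_alg_is_algebra: "scalar_mv_algebra S (free_alg S X)"
  by unfold_locales
    (auto simp: carrier_free mv_odot_def free_ops terms.intros diff_in mult_in
      intro!: class_eqI del: equalityI intro: terms.intros term_eq.intros term_eq_unit_left)

end

primrec eval_term :: "('a, 'm) mv_alg_scheme \<Rightarrow> ('x \<Rightarrow> 'a) \<Rightarrow> 'x mv_term \<Rightarrow> 'a"
  where
    "eval_term A f (Var x) = f x"
  | "eval_term A f Zero = mv_zero A"
  | "eval_term A f (Neg t) = mv_neg A (eval_term A f t)"
  | "eval_term A f (Plus t u) = mv_plus A (eval_term A f t) (eval_term A f u)"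
  | "eval_term A f (Scal r t) = mv_scal A r (eval_term A f t)"

context scalar_mv_algebra
begin

lemma plus_closed: "\<lbrakk>x \<in> carrier A; y \<in> carrier A\<rbrakk> \<Longrightarrow> x \<oplus> y \<in> carrier A"
  using monoid.m_closed[OF comm_monoid.axioms(1)[OF plus_monoid]] by simp

lemma zero_closed: "\<zero> \<in> carrier A"
  using monoid.one_closed[OF comm_monoid.axioms(1)[OF plus_monoid]] by simp

lemma eval_closed:
  "\<lbrakk>f ` X \<subseteq> carrier A; t \<in> terms S X\<rbrakk> \<Longrightarrow> eval_term A f t \<in> carrier A"
  by (rotate_tac, induction t rule: terms.induct)
    (auto intro: plus_closed zero_closed neg_closed scal_closed)

lemmas mv_scal_odot = scal_odot and mv_scal_diff = scal_diff

lemma eval_sound: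
  assumes "scalar_set S" and f: "f ` X \<subseteq> carrier A"
  shows "(t, u) \<in> term_eq S X \<Longrightarrow> eval_term A f t = eval_term A f u"
proof (induction rule: term_eq.induct)
  case (assoc t u v)
  then show ?case
    using monoid.m_assoc[OF comm_monoid.axioms(1)[OF plus_monoid]] eval_closed[OF f] by simp
next
  case (comm t u)
  then show ?case using comm_monoid.m_comm[OF plus_monoid] eval_closed[OF f] by simp
next
  case (unit t)
  then show ?case
    using monoid.r_one[OF comm_monoid.axioms(1)[OF plus_monoid]] eval_closed[OF f] by simp
next
  case (scal_odot r t u)
  then show ?case
    using mv_scal_odot[of r "eval_term A f t" "eval_term A f u"] eval_closed[OF f]
    by (simp add: mv_odot_def)
next
  case (scal_diff r q t)
  then show ?case
    using mv_scal_diff[of r q "eval_term A f t"] eval_closed[OF f]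
    by (simp add: mv_odot_def)
qed (use eval_closed[OF f] in \<open>auto simp: neg_neg one_absorb scal_scal scal_one intro: lukasiewicz\<close>)

theorem free_alg_universal:
  assumes S: "scalar_set S" and f: "f ` X \<subseteq> carrier A"
  shows "\<exists>!h. h \<in> mv_hom S (free_alg S X) A \<and> (\<forall>x\<in>X. h (free_gen S X x) = f x)"
proof -
  interpret S: scalar_set S by fact
  define h where "h = (\<lambda>a\<in>carrier (free_alg S X). the_elem (eval_term A f ` a))"
  have h: "h (term_class S X t) = eval_term A f t" if "t \<in> terms S X" for t
  proof -
    have "eval_term A f ` term_class S X t = {eval_term A f t}"
      using eval_sound[OF S f] that term_eq.refl unfolding term_class_def by fastforce
    then show ?thesis using S.class_in[OF that] by (simp add: h_def)
  qed
  have hext: "h \<in> extensional (carrier (free_alg S X))" by (simp add: h_def)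
  then have "h \<in> mv_hom S (free_alg S X) A"
    unfolding mv_hom_def PiE_def
    by (auto simp: S.carrier_free S.free_ops h terms.intros eval_closed[OF f])
  moreover have "\<forall>x\<in>X. h (free_gen S X x) = f x"
    by (simp add: free_gen_def h terms.intros)
  moreover have "g = h"
    if g: "g \<in> mv_hom S (free_alg S X) A" "\<forall>x\<in>X. g (free_gen S X x) = f x" for g
  proof -
    have "g (term_class S X t) = eval_term A f t" if "t \<in> terms S X" for t
      using that
    proof induction
      case (Var x) then show ?case using g(2) by (simp add: free_gen_def)
    next
      case Zero then show ?case using g(1) by (simp add: mv_hom_def S.free_ops)
    next
      case (Neg t)
      then have "g (mv_neg (free_alg S X) (term_class S X t)) = mv_neg A (g (term_class S X t))"
        using g(1) S.class_in[of _ X] unfolding mv_hom_def by blast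
      with Neg show ?case by (simp add: S.free_ops)
    next
      case (Plus t u)
      then have "g (mv_plus (free_alg S X) (term_class S X t) (term_class S X u))
          = mv_plus A (g (term_class S X t)) (g (term_class S X u))"
        using g(1) S.class_in[of _ X] unfolding mv_hom_def by blast
      with Plus show ?case by (simp add: S.free_ops)
    next
      case (Scal r t)
      then have "g (mv_scal (free_alg S X) r (term_class S X t)) = mv_scal A r (g (term_class S X t))"
        using g(1) S.class_in[of _ X] unfolding mv_hom_def by blast
      with Scal show ?case by (simp add: S.free_ops)
    qed
    then have "g a = h a" if "a \<in> carrier (free_alg S X)" for a
      using that h by (auto simp: S.carrier_free)
    moreover have "g \<in> extensional (carrier (free_alg S X))"
      using g(1) by (auto simp: mv_hom_def PiE_def)
    ultimately show "g = h" using hext extensionalityI by blast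
  qed
  ultimately show ?thesis by blast
qed

end

lemma terms_mono: "S \<subseteq> S' \<Longrightarrow> t \<in> terms S X \<Longrightarrow> t \<in> terms S' X"
  by (rotate_tac, induction rule: terms.induct) (auto intro: terms.intros)

lemma term_eq_mono: "S \<subseteq> S' \<Longrightarrow> (t, u) \<in> term_eq S X \<Longrightarrow> (t, u) \<in> term_eq S' X"
  by (rotate_tac, induction rule: term_eq.induct)
    (auto intro: term_eq.intros terms_mono dest: subsetD)

theorem free_incl_hom:
  assumes "scalar_set S" "scalar_set S'" and sub: "S \<subseteq> S'"
  shows "restrict (free_incl S' X) (carrier (free_alg S X))
      \<in> mv_hom S (free_alg S X) (free_alg S' X)"
    and "x \<in> X \<Longrightarrow> free_incl S' X (free_gen S X x) = free_gen S' X x"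
proof -
  interpret S: scalar_set S by fact
  interpret S': scalar_set S' by fact
  have incl: "free_incl S' X (term_class S X t) = term_class S' X t" if "t \<in> terms S X" for t
    using that term_eq_mono[OF sub] term_eq.refl[of t S X]
    by (auto simp: free_incl_def term_class_def intro: term_eq.trans)
  then show "x \<in> X \<Longrightarrow> free_incl S' X (free_gen S X x) = free_gen S' X x"
    by (simp add: free_gen_def terms.intros)
  show "restrict (free_incl S' X) (carrier (free_alg S X))
      \<in> mv_hom S (free_alg S X) (free_alg S' X)"
    unfolding mv_hom_def PiE_def
    using sub
    by (auto simp: S.carrier_free S'.carrier_free S.free_ops S'.free_ops incl terms.intros
        terms_mono[OF sub] subsetD)
qed


section \<open>Categories and equivalence of categories\<close>

text \<open>
  Categories are given by hom-sets, which need not be disjoint; composition and the action of a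
  functor on arrows therefore take the objects as arguments. \<open>Comp C A B D g f\<close> is the composite
  of \<open>f : A \<rightarrow> B\<close> with \<open>g : B \<rightarrow> D\<close>.
\<close>

record ('o, 'm) category =
  Obj :: "'o set"
  Hom :: "'o \<Rightarrow> 'o \<Rightarrow> 'm set"
  Idt :: "'o \<Rightarrow> 'm"
  Comp :: "'o \<Rightarrow> 'o \<Rightarrow> 'o \<Rightarrow> 'm \<Rightarrow> 'm \<Rightarrow> 'm"

locale category =
  fixes C :: "('o, 'm) category"
  assumes Idt_in: "A \<in> Obj C \<Longrightarrow> Idt C A \<in> Hom C A A"
    and Comp_in: "\<lbrakk>A \<in> Obj C; B \<in> Obj C; D \<in> Obj C; f \<in> Hom C A B; g \<in> Hom C B D\<rbrakk>
          \<Longrightarrow> Comp C A B D g f \<in> Hom C A D"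
    and Comp_Idt: "\<lbrakk>A \<in> Obj C; B \<in> Obj C; f \<in> Hom C A B\<rbrakk> \<Longrightarrow> Comp C A A B f (Idt C A) = f"
    and Idt_Comp: "\<lbrakk>A \<in> Obj C; B \<in> Obj C; f \<in> Hom C A B\<rbrakk> \<Longrightarrow> Comp C A B B (Idt C B) f = f"
    and Comp_assoc: "\<lbrakk>A \<in> Obj C; B \<in> Obj C; D \<in> Obj C; E \<in> Obj C;
            f \<in> Hom C A B; g \<in> Hom C B D; k \<in> Hom C D E\<rbrakk>
          \<Longrightarrow> Comp C A D E k (Comp C A B D g f) = Comp C A B E (Comp C B D E k g) f"

record ('o, 'm, 'p, 'n) func =
  on_obj :: "'o \<Rightarrow> 'p"
  on_arr :: "'o \<Rightarrow> 'o \<Rightarrow> 'm \<Rightarrow> 'n"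

definition is_functor :: "('o, 'm) category \<Rightarrow> ('p, 'n) category \<Rightarrow> ('o, 'm, 'p, 'n) func \<Rightarrow> bool"
  where "is_functor C D F \<longleftrightarrow>
    (\<forall>A\<in>Obj C. on_obj F A \<in> Obj D) \<and>
    (\<forall>A\<in>Obj C. \<forall>B\<in>Obj C. \<forall>f\<in>Hom C A B. on_arr F A B f \<in> Hom D (on_obj F A) (on_obj F B)) \<and>
    (\<forall>A\<in>Obj C. on_arr F A A (Idt C A) = Idt D (on_obj F A)) \<and>
    (\<forall>A\<in>Obj C. \<forall>B\<in>Obj C. \<forall>E\<in>Obj C. \<forall>f\<in>Hom C A B. \<forall>g\<in>Hom C B E.
      on_arr F A E (Comp C A B E g f)
        = Comp D (on_obj F A) (on_obj F B) (on_obj F E) (on_arr F B E g) (on_arr F A B f))"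

definition id_func :: "('o, 'm, 'o, 'm) func"
  where "id_func = \<lparr>on_obj = (\<lambda>A. A), on_arr = (\<lambda>A B f. f)\<rparr>"

definition comp_func :: "('p, 'n, 'q, 'k) func \<Rightarrow> ('o, 'm, 'p, 'n) func \<Rightarrow> ('o, 'm, 'q, 'k) func"
  where "comp_func G F = \<lparr>on_obj = (\<lambda>A. on_obj G (on_obj F A)),
    on_arr = (\<lambda>A B f. on_arr G (on_obj F A) (on_obj F B) (on_arr F A B f))\<rparr>"

definition is_iso :: "('o, 'm) category \<Rightarrow> 'o \<Rightarrow> 'o \<Rightarrow> 'm \<Rightarrow> bool"
  where "is_iso C A B f \<longleftrightarrow> f \<in> Hom C A B \<and>
    (\<exists>g\<in>Hom C B A. Comp C A B A g f = Idt C A \<and> Comp C B A B f g = Idt C B)"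

definition naturally_isomorphic ::
    "('o, 'm) category \<Rightarrow> ('p, 'n) category \<Rightarrow> ('o, 'm, 'p, 'n) func \<Rightarrow> ('o, 'm, 'p, 'n) func \<Rightarrow> bool"
  where "naturally_isomorphic C D F G \<longleftrightarrow> (\<exists>\<eta>.
    (\<forall>A\<in>Obj C. is_iso D (on_obj F A) (on_obj G A) (\<eta> A)) \<and>
    (\<forall>A\<in>Obj C. \<forall>B\<in>Obj C. \<forall>f\<in>Hom C A B.
      Comp D (on_obj F A) (on_obj F B) (on_obj G B) (\<eta> B) (on_arr F A B f)
        = Comp D (on_obj F A) (on_obj G A) (on_obj G B) (on_arr G A B f) (\<eta> A)))"

definition equivalent_categories :: "('o, 'm) category \<Rightarrow> ('p, 'n) category \<Rightarrow> bool"
  where "equivalent_categories C D \<longleftrightarrow> category C \<and> category D \<and>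
    (\<exists>F G. is_functor C D F \<and> is_functor D C G \<and>
      naturally_isomorphic C C id_func (comp_func G F) \<and>
      naturally_isomorphic D D (comp_func F G) id_func)"


section \<open>The categories of theories\<close>

text \<open>
  The sets \<open>X\<close> range over all sets of elements of an arbitrary type \<open>'x\<close>.
\<close>

type_synonym 'x theory_obj = "'x set \<times> 'x mv_term set set"
type_synonym 'x theory_arr = "'x mv_term set \<Rightarrow> 'x mv_term set"
type_synonym 'x theory_cat = "('x theory_obj, 'x theory_arr) category"

definition ThMV :: "'x theory_cat"
  where "ThMV = \<lparr>
    Obj = {(X, I). fin_gen_ideal (MV X) I},
    Hom = (\<lambda>(X, I) (Y, J). {\<sigma> \<in> mv_hom mv_scalars (MV X) (MV Y). \<sigma> ` I \<subseteq> J}),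
    Idt = (\<lambda>(X, I). \<lambda>a\<in>carrier (MV X). a),
    Comp = (\<lambda>(X, I) _ _ g f. compose (carrier (MV X)) g f)\<rparr>"

definition ThDMV' :: "'x theory_cat"
  where "ThDMV' = \<lparr>
    Obj = {(X, I). fin_gen_ideal (DMV X) I},
    Hom = (\<lambda>(X, I) (Y, J). {\<sigma> \<in> mv_hom dmv_scalars (DMV X) (DMV Y). \<sigma> ` I \<subseteq> J \<and>
      \<sigma> ` free_gen dmv_scalars X ` X \<subseteq> free_sub mv_scalars dmv_scalars Y}),
    Idt = (\<lambda>(X, I). \<lambda>a\<in>carrier (DMV X). a),
    Comp = (\<lambda>(X, I) _ _ g f. compose (carrier (DMV X)) g f)\<rparr>"

definition ThRMV' :: "'x theory_cat"
  where "ThRMV' = \<lparr>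
    Obj = {(X, I). \<exists>f \<in> free_sub dmv_scalars rmv_scalars X. I = mv_ideal_gen (RMV X) {f}},
    Hom = (\<lambda>(X, I) (Y, J). {\<tau> \<in> mv_hom rmv_scalars (RMV X) (RMV Y). \<tau> ` I \<subseteq> J \<and>
      \<tau> ` free_gen rmv_scalars X ` X \<subseteq> free_sub mv_scalars rmv_scalars Y}),
    Idt = (\<lambda>(X, I). \<lambda>a\<in>carrier (RMV X). a),
    Comp = (\<lambda>(X, I) _ _ g f. compose (carrier (RMV X)) g f)\<rparr>"

end

theory Submission
  imports Defs "HOL-Algebra.FiniteProduct"
begin

text \<open>
  Up to equality of records, all three categories are instances of one construction, in which
  objects are ideals generated by a single MV-term and an arrow is given by a substitution of
  MV-terms for the variables. Two facts make this independent of the scalars. First, an equation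
  between MV-terms that holds in the larger algebra already follows from the MV-axioms. This is
  Chang's completeness theorem: an underivable equation fails in a linearly ordered quotient of the
  free algebra; the quotient embeds into an ordered group \<open>\<int> \<times> C\<close> with carry, and
  Fourier--Motzkin elimination transfers the finitely many sign conditions involved from this
  group to the reals. Second, every DMV-term \<open>t\<close> generates the same ideal as some MV-term:
  clearing denominators, the truncation of a suitable multiple \<open>N t\<close> to \<open>[0,1]\<close> is the value of
  an MV-term, and completeness for rational scalars turns \<open>t \<le> min 1 (N t) \<le> N t\<close> into derivable
  inequalities.
\<close>

section \<open>Arithmetic of MV-algebras\<close>

text \<open>The interval [0,1] mediates between the scalars: it is a model for every set of scalars
  contained in it, so whatever real scalars prove about MV-terms holds in [0,1], and completeness
  without scalars derives it again from the MV-axioms. Hence inclusion of ideals and equality of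
  arrows are reduced to equations between MV-terms.

  The restrictions on objects and arrows make this possible. For irrational r the truncated
  difference of x and r vanishes exactly on [0,r], while zero sets of MV-terms in one variable have
  rational endpoints, so no MV-term generates its ideal; and x can be sent to half of x only with
  scalars.

  The obstacle in completeness is that a chain may contain infinitesimals and then does not embed
  into [0,1]. But two given terms have finitely many subterms, whose values obey finitely many sign
  conditions; real numbers can satisfy these too, and the strict ones keep different values apart.

  Ideals and arrows do not determine the terms behind them. The passage between categories is
  therefore given by relations; these turn out one-to-one, so the functors are mutually
  inverse.\<close>

no_notation gorder.le (infixl "\<sqsubseteq>\<index>" 50)

context mv_algebra
begin

lemma plus_in [simp]: "\<lbrakk>x \<in> carrier A; y \<in> carrier A\<rbrakk> \<Longrightarrow> x \<oplus> y \<in> carrier A"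
  using monoid.m_closed[OF comm_monoid.axioms(1)[OF plus_monoid]] by simp

lemma zero_in [simp]: "\<zero> \<in> carrier A"
  using monoid.one_closed[OF comm_monoid.axioms(1)[OF plus_monoid]] by simp

lemmas neg_in [simp] = neg_closed

lemma one_in [simp]: "mv_one A \<in> carrier A"
  by (simp add: mv_one_def)

lemma odot_in [simp]: "\<lbrakk>x \<in> carrier A; y \<in> carrier A\<rbrakk> \<Longrightarrow> x \<odot> y \<in> carrier A"
  by (simp add: mv_odot_def)

lemma plus_assoc:
  "\<lbrakk>x \<in> carrier A; y \<in> carrier A; z \<in> carrier A\<rbrakk> \<Longrightarrow> (x \<oplus> y) \<oplus> z = x \<oplus> (y \<oplus> z)"
  using monoid.m_assoc[OF comm_monoid.axioms(1)[OF plus_monoid]] by simp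

lemma plus_comm: "\<lbrakk>x \<in> carrier A; y \<in> carrier A\<rbrakk> \<Longrightarrow> x \<oplus> y = y \<oplus> x"
  using comm_monoid.m_comm[OF plus_monoid] by simp

lemma plus_left_comm:
  "\<lbrakk>x \<in> carrier A; y \<in> carrier A; z \<in> carrier A\<rbrakk> \<Longrightarrow> x \<oplus> (y \<oplus> z) = y \<oplus> (x \<oplus> z)"
  by (metis plus_assoc plus_comm)

lemmas plus_ac = plus_assoc plus_comm plus_left_comm

lemma plus_zero [simp]: "x \<in> carrier A \<Longrightarrow> x \<oplus> \<zero> = x"
  using monoid.r_one[OF comm_monoid.axioms(1)[OF plus_monoid]] by simp

lemma zero_plus [simp]: "x \<in> carrier A \<Longrightarrow> \<zero> \<oplus> x = x"
  using monoid.l_one[OF comm_monoid.axioms(1)[OF plus_monoid]] by simp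

declare neg_neg [simp]

lemma neg_zero [simp]: "\<sim> \<zero> = mv_one A"
  by (simp add: mv_one_def)

lemma neg_one [simp]: "\<sim> (mv_one A) = \<zero>"
  unfolding mv_one_def by (rule neg_neg) simp

lemma one_plus [simp]: "x \<in> carrier A \<Longrightarrow> mv_one A \<oplus> x = mv_one A"
  using one_absorb by simp

lemma plus_one [simp]: "x \<in> carrier A \<Longrightarrow> x \<oplus> mv_one A = mv_one A"
  by (metis one_plus one_in plus_comm)

lemma neg_plus_self [simp]: "x \<in> carrier A \<Longrightarrow> \<sim> x \<oplus> x = mv_one A"
  using lukasiewicz[of "mv_one A" x] by simp

lemma plus_neg_self [simp]: "x \<in> carrier A \<Longrightarrow> x \<oplus> \<sim> x = mv_one A"
  by (metis neg_plus_self neg_in plus_comm)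

lemma neg_inject: "\<lbrakk>x \<in> carrier A; y \<in> carrier A\<rbrakk> \<Longrightarrow> \<sim> x = \<sim> y \<longleftrightarrow> x = y"
  by (metis neg_neg)

lemma neg_plus: "\<lbrakk>x \<in> carrier A; y \<in> carrier A\<rbrakk> \<Longrightarrow> \<sim> (x \<oplus> y) = \<sim> x \<odot> \<sim> y"
  by (simp add: mv_odot_def)

lemma neg_odot: "\<lbrakk>x \<in> carrier A; y \<in> carrier A\<rbrakk> \<Longrightarrow> \<sim> (x \<odot> y) = \<sim> x \<oplus> \<sim> y"
  by (simp add: mv_odot_def)

lemma odot_comm: "\<lbrakk>x \<in> carrier A; y \<in> carrier A\<rbrakk> \<Longrightarrow> x \<odot> y = y \<odot> x"
  by (simp add: mv_odot_def plus_comm)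

lemma odot_assoc:
  "\<lbrakk>x \<in> carrier A; y \<in> carrier A; z \<in> carrier A\<rbrakk> \<Longrightarrow> (x \<odot> y) \<odot> z = x \<odot> (y \<odot> z)"
  by (simp add: mv_odot_def plus_assoc)

lemma odot_left_comm:
  "\<lbrakk>x \<in> carrier A; y \<in> carrier A; z \<in> carrier A\<rbrakk> \<Longrightarrow> x \<odot> (y \<odot> z) = y \<odot> (x \<odot> z)"
  by (metis odot_assoc odot_comm)

lemmas odot_ac = odot_assoc odot_comm odot_left_comm

lemma odot_neg_self [simp]: "x \<in> carrier A \<Longrightarrow> x \<odot> \<sim> x = \<zero>"
  by (simp add: mv_odot_def)

lemma odot_zero [simp]: "x \<in> carrier A \<Longrightarrow> x \<odot> \<zero> = \<zero>"
  by (simp add: mv_odot_def)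

lemma odot_one [simp]: "x \<in> carrier A \<Longrightarrow> x \<odot> mv_one A = x"
  by (simp add: mv_odot_def)

lemma one_odot [simp]: "x \<in> carrier A \<Longrightarrow> mv_one A \<odot> x = x"
  by (simp add: mv_odot_def)

lemma zero_odot [simp]: "x \<in> carrier A \<Longrightarrow> \<zero> \<odot> x = \<zero>"
  by (simp add: mv_odot_def)

text \<open>The Lukasiewicz axiom says that the join is symmetric; negating it for
  \<open>\<sim> x\<close> and \<open>\<sim> y\<close> gives the same for the meet, which both sides
  denote.\<close>

lemma meet_commute:
  assumes "x \<in> carrier A" "y \<in> carrier A"
  shows "x \<odot> (\<sim> x \<oplus> y) = y \<odot> (\<sim> y \<oplus> x)"
proof -
  have "\<sim> (\<sim> (x \<oplus> \<sim> y) \<oplus> \<sim> y) = \<sim> (\<sim> (y \<oplus> \<sim> x) \<oplus> \<sim> x)"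
    using lukasiewicz[of "\<sim> x" "\<sim> y"] assms by simp
  then show ?thesis using assms by (simp add: neg_plus neg_odot plus_comm odot_comm)
qed

lemma le_refl [simp]: "x \<in> carrier A \<Longrightarrow> x \<sqsubseteq> x"
  by (simp add: mv_le_def)

lemma le_antisym: "\<lbrakk>x \<sqsubseteq> y; y \<sqsubseteq> x; x \<in> carrier A; y \<in> carrier A\<rbrakk> \<Longrightarrow> x = y"
  using lukasiewicz[of x y] by (simp add: mv_le_def)

text \<open>The axiom equates two formulas for the join, and \<open>x \<sqsubseteq> y\<close>
  collapses one of them to \<open>y\<close>. With \<open>le_plusI\<close> this makes the order
  algebraic: going up means adding something, from which transitivity and monotonicity
  follow.\<close>

lemma join_eq:
  assumes "x \<sqsubseteq> y" "x \<in> carrier A" "y \<in> carrier A"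
  shows "x \<oplus> (y \<odot> \<sim> x) = y"
  using lukasiewicz[of x y] assms by (simp add: mv_le_def mv_odot_def plus_comm)

lemma le_plusI [simp]: "\<lbrakk>x \<in> carrier A; y \<in> carrier A\<rbrakk> \<Longrightarrow> x \<sqsubseteq> x \<oplus> y"
  by (simp add: mv_le_def flip: plus_assoc)

lemma le_plusI2 [simp]: "\<lbrakk>x \<in> carrier A; y \<in> carrier A\<rbrakk> \<Longrightarrow> x \<sqsubseteq> y \<oplus> x"
  by (metis le_plusI plus_comm)

lemma le_trans:
  assumes "x \<sqsubseteq> y" "y \<sqsubseteq> z" "x \<in> carrier A" "y \<in> carrier A" "z \<in> carrier A"
  shows "x \<sqsubseteq> z"
proof -
  have "z = x \<oplus> ((y \<odot> \<sim> x) \<oplus> (z \<odot> \<sim> y))"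
    using join_eq[OF assms(1)] join_eq[OF assms(2)] assms(3-) by (simp flip: plus_assoc)
  then show ?thesis using assms(3-) by (metis le_plusI plus_in odot_in neg_in)
qed

lemma plus_mono:
  assumes "x \<sqsubseteq> y" "x' \<sqsubseteq> y'"
    "x \<in> carrier A" "y \<in> carrier A" "x' \<in> carrier A" "y' \<in> carrier A"
  shows "x \<oplus> x' \<sqsubseteq> y \<oplus> y'"
proof -
  have "y \<oplus> y' = (x \<oplus> (y \<odot> \<sim> x)) \<oplus> (x' \<oplus> (y' \<odot> \<sim> x'))"
    using join_eq assms by simp
  also have "\<dots> = (x \<oplus> x') \<oplus> ((y \<odot> \<sim> x) \<oplus> (y' \<odot> \<sim> x'))"
    using assms by (simp add: plus_ac)
  finally show ?thesis using assms by (metis le_plusI plus_in odot_in neg_in)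
qed

lemma le_neg_iff: "\<lbrakk>x \<in> carrier A; y \<in> carrier A\<rbrakk> \<Longrightarrow> \<sim> x \<sqsubseteq> \<sim> y \<longleftrightarrow> y \<sqsubseteq> x"
  by (simp add: mv_le_def plus_comm)

lemma zero_le [simp]: "x \<in> carrier A \<Longrightarrow> \<zero> \<sqsubseteq> x"
  by (simp add: mv_le_def)

lemma le_one [simp]: "x \<in> carrier A \<Longrightarrow> x \<sqsubseteq> mv_one A"
  by (simp add: mv_le_def)

lemma le_zero_iff: "x \<in> carrier A \<Longrightarrow> x \<sqsubseteq> \<zero> \<longleftrightarrow> x = \<zero>"
  by (metis le_antisym le_refl zero_in zero_le)

lemma le_iff_minus: "\<lbrakk>x \<in> carrier A; y \<in> carrier A\<rbrakk> \<Longrightarrow> x \<sqsubseteq> y \<longleftrightarrow> x \<odot> \<sim> y = \<zero>"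
  unfolding mv_le_def mv_odot_def by (metis neg_in neg_neg neg_one neg_zero plus_in)

lemma odot_zero_iff: "\<lbrakk>x \<in> carrier A; y \<in> carrier A\<rbrakk> \<Longrightarrow> x \<odot> y = \<zero> \<longleftrightarrow> x \<sqsubseteq> \<sim> y"
  by (simp add: le_iff_minus)

lemma plus_one_iff: "\<lbrakk>x \<in> carrier A; y \<in> carrier A\<rbrakk> \<Longrightarrow> x \<oplus> y = mv_one A \<longleftrightarrow> \<sim> y \<sqsubseteq> x"
  by (simp add: mv_le_def plus_comm)

lemma minus_le_iff:
  "\<lbrakk>x \<in> carrier A; y \<in> carrier A; z \<in> carrier A\<rbrakk> \<Longrightarrow> x \<odot> \<sim> y \<sqsubseteq> z \<longleftrightarrow> x \<sqsubseteq> y \<oplus> z"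
  by (simp add: mv_le_def mv_odot_def plus_assoc)

lemma le_plus_minus: "\<lbrakk>x \<in> carrier A; y \<in> carrier A\<rbrakk> \<Longrightarrow> x \<sqsubseteq> y \<oplus> (x \<odot> \<sim> y)"
  by (simp flip: minus_le_iff)

lemma minus_le [simp]: "\<lbrakk>x \<in> carrier A; y \<in> carrier A\<rbrakk> \<Longrightarrow> x \<odot> y \<sqsubseteq> x"
  using minus_le_iff[of x "\<sim> y" x] by simp

lemma minus_plus:
  "\<lbrakk>x \<in> carrier A; y \<in> carrier A; z \<in> carrier A\<rbrakk> \<Longrightarrow> x \<odot> \<sim> (y \<oplus> z) = (x \<odot> \<sim> y) \<odot> \<sim> z"
  by (simp add: mv_odot_def plus_assoc)

text \<open>Residuation reduces each inequality between truncated differences to monotonicity of \<open>\<oplus>\<close>.\<close>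

lemma minus_triangle:
  assumes "x \<in> carrier A" "y \<in> carrier A" "z \<in> carrier A"
  shows "x \<odot> \<sim> z \<sqsubseteq> (x \<odot> \<sim> y) \<oplus> (y \<odot> \<sim> z)"
proof -
  have "y \<oplus> (x \<odot> \<sim> y) \<sqsubseteq> (z \<oplus> (y \<odot> \<sim> z)) \<oplus> (x \<odot> \<sim> y)"
    using assms by (intro plus_mono le_plus_minus) auto
  then have "x \<sqsubseteq> (z \<oplus> (y \<odot> \<sim> z)) \<oplus> (x \<odot> \<sim> y)"
    using le_trans[OF le_plus_minus[of x y]] assms by simp
  then have "x \<sqsubseteq> z \<oplus> ((x \<odot> \<sim> y) \<oplus> (y \<odot> \<sim> z))"
    using assms by (simp add: plus_ac)
  then show ?thesis using assms by (simp add: minus_le_iff)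
qed

lemma minus_plus_plus:
  assumes "x \<in> carrier A" "y \<in> carrier A" "x' \<in> carrier A" "y' \<in> carrier A"
  shows "(x \<oplus> y) \<odot> \<sim> (x' \<oplus> y') \<sqsubseteq> (x \<odot> \<sim> x') \<oplus> (y \<odot> \<sim> y')"
proof -
  have "x \<oplus> y \<sqsubseteq> (x' \<oplus> (x \<odot> \<sim> x')) \<oplus> (y' \<oplus> (y \<odot> \<sim> y'))"
    using assms by (intro plus_mono le_plus_minus) auto
  then have "x \<oplus> y \<sqsubseteq> (x' \<oplus> y') \<oplus> ((x \<odot> \<sim> x') \<oplus> (y \<odot> \<sim> y'))"
    using assms by (simp add: plus_ac)
  then show ?thesis using assms by (simp add: minus_le_iff)
qed

lemma odot_mono:
  assumes "x \<sqsubseteq> y" "x' \<sqsubseteq> y'"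
    "x \<in> carrier A" "y \<in> carrier A" "x' \<in> carrier A" "y' \<in> carrier A"
  shows "x \<odot> x' \<sqsubseteq> y \<odot> y'"
  using plus_mono[of "\<sim> y" "\<sim> x" "\<sim> y'" "\<sim> x'"] assms
  by (simp add: le_neg_iff mv_odot_def)

text \<open>As \<open>w\<close> lies below \<open>x\<close>, it is itself the meet of
  \<open>x\<close> and \<open>w\<close>, and this meet grows with its second argument.\<close>

lemma meet_greatest:
  assumes "w \<sqsubseteq> x" "w \<sqsubseteq> y" "w \<in> carrier A" "x \<in> carrier A" "y \<in> carrier A"
  shows "w \<sqsubseteq> x \<odot> (\<sim> x \<oplus> y)"
proof -
  have "w = x \<odot> (\<sim> x \<oplus> w)"
    using meet_commute[of x w] assms by (simp add: mv_le_def)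
  also have "\<dots> \<sqsubseteq> x \<odot> (\<sim> x \<oplus> y)"
    using assms by (intro odot_mono plus_mono) auto
  finally show ?thesis .
qed

text \<open>This is where linear quotients come from: the two truncated differences have meet zero.
  Three exchanges by \<open>meet_commute\<close> turn that meet into a product containing both
  \<open>x\<close> and \<open>\<sim> x\<close>.\<close>

lemma prelinear:
  assumes x: "x \<in> carrier A" and y: "y \<in> carrier A" and w: "w \<in> carrier A"
    and "w \<sqsubseteq> x \<odot> \<sim> y" "w \<sqsubseteq> y \<odot> \<sim> x"
  shows "w = \<zero>"
proof -
  define a where "a = x \<odot> \<sim> y"
  define b where "b = y \<odot> \<sim> x"
  define p where "p = \<sim> y \<oplus> x"
  define Q where "Q = \<sim> x \<oplus> b"
  define Z where "Z = x \<odot> p"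
  define R where "R = \<sim> b \<oplus> x"
  define T where "T = \<sim> Z \<oplus> y"
  note defs = a_def b_def p_def Q_def Z_def R_def T_def
  have c: "a \<in> carrier A" "b \<in> carrier A" "p \<in> carrier A" "Q \<in> carrier A" "Z \<in> carrier A"
     "R \<in> carrier A" "T \<in> carrier A"
    using x y by (simp_all add: defs)
  have Q: "\<sim> Q = Z" using x y by (simp add: defs neg_plus neg_odot)
  have "\<sim> a \<oplus> b = y \<oplus> Q" using x y by (simp add: a_def Q_def neg_odot c plus_ac)
  then have "a \<odot> (\<sim> a \<oplus> b) = x \<odot> (\<sim> y \<odot> (\<sim> (\<sim> y) \<oplus> Q))"
    using x y c by (simp add: a_def odot_assoc)
  also have "\<dots> = x \<odot> (Q \<odot> (Z \<oplus> \<sim> y))"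
    using meet_commute[of "\<sim> y" Q] x y c Q by simp
  also have "\<dots> = (x \<odot> Q) \<odot> (Z \<oplus> \<sim> y)"
    using x y c by (simp add: odot_assoc)
  also have "x \<odot> Q = b \<odot> R"
    unfolding Q_def R_def using meet_commute[of x b] x y c by simp
  also have "(b \<odot> R) \<odot> (Z \<oplus> \<sim> y) = (R \<odot> \<sim> x) \<odot> (y \<odot> (\<sim> y \<oplus> Z))"
    unfolding b_def using x y c by (simp add: odot_ac plus_comm)
  also have "y \<odot> (\<sim> y \<oplus> Z) = Z \<odot> T"
    unfolding T_def using meet_commute[of y Z] x y c by simp
  \<comment> \<open>The factor \<open>x\<close> comes out of \<open>Z\<close>; its partner
    \<open>\<sim> x\<close> was split off from \<open>b\<close> above.\<close>
  also have "(R \<odot> \<sim> x) \<odot> (Z \<odot> T) = (x \<odot> \<sim> x) \<odot> (R \<odot> (p \<odot> T))"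
    unfolding Z_def using x y c by (simp only: odot_ac odot_in plus_in neg_in)
  also have "\<dots> = \<zero>" using x y c by simp
  finally have "a \<odot> (\<sim> a \<oplus> b) = \<zero>" .
  then show ?thesis using meet_greatest[OF assms(4,5) w] x y w by (simp add: a_def b_def le_zero_iff)
qed

end

section \<open>Ideals\<close>

definition mv_nfold :: "('a, 'm) mv_alg_scheme \<Rightarrow> nat \<Rightarrow> 'a \<Rightarrow> 'a"
  where "mv_nfold A n a = (mv_plus A a ^^ n) (mv_zero A)"

lemma mv_nfold_0 [simp]: "mv_nfold A 0 a = mv_zero A"
  by (simp add: mv_nfold_def)

lemma mv_nfold_Suc [simp]: "mv_nfold A (Suc n) a = mv_plus A a (mv_nfold A n a)"
  by (simp add: mv_nfold_def)

context mv_algebra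
begin

lemma nfold_in [simp]: "a \<in> carrier A \<Longrightarrow> mv_nfold A n a \<in> carrier A"
  by (induction n) auto

lemma nfold_add:
  "a \<in> carrier A \<Longrightarrow> mv_nfold A (m + n) a = mv_nfold A m a \<oplus> mv_nfold A n a"
  by (induction m) (simp_all add: plus_assoc)

lemma ideal_in: "\<lbrakk>mv_ideal A I; x \<in> I\<rbrakk> \<Longrightarrow> x \<in> carrier A"
  by (auto simp: mv_ideal_def)

lemma ideal_down: "\<lbrakk>mv_ideal A I; y \<in> I; x \<sqsubseteq> y; x \<in> carrier A\<rbrakk> \<Longrightarrow> x \<in> I"
  by (auto simp: mv_ideal_def)

lemma ideal_plus: "\<lbrakk>mv_ideal A I; x \<in> I; y \<in> I\<rbrakk> \<Longrightarrow> x \<oplus> y \<in> I"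
  by (auto simp: mv_ideal_def)

lemma ideal_zero: "mv_ideal A I \<Longrightarrow> \<zero> \<in> I"
  using ideal_in zero_le zero_in unfolding mv_ideal_def by blast

lemma ideal_nfold: "\<lbrakk>mv_ideal A I; x \<in> I\<rbrakk> \<Longrightarrow> mv_nfold A n x \<in> I"
  by (induction n) (auto intro: ideal_zero ideal_plus)

lemma ideal_plus_iff:
  "\<lbrakk>mv_ideal A I; x \<in> carrier A; y \<in> carrier A\<rbrakk> \<Longrightarrow> x \<oplus> y \<in> I \<longleftrightarrow> x \<in> I \<and> y \<in> I"
  by (meson ideal_down ideal_plus le_plusI le_plusI2)

lemma ideal_singleton_zero: "mv_ideal A {\<zero>}"
  by (auto simp: mv_ideal_def le_zero_iff)

text \<open>Used twice: over the zero ideal it describes principal ideals, and over a maximal ideal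
  it turns maximality into an upper bound for the omitted element.\<close>

lemma ideal_adjoin:
  assumes I: "mv_ideal A I" and a: "a \<in> carrier A"
  shows "mv_ideal A {x \<in> carrier A. \<exists>p\<in>I. \<exists>n. x \<sqsubseteq> p \<oplus> mv_nfold A n a}" (is "mv_ideal A ?J")
    and "I \<subseteq> {x \<in> carrier A. \<exists>p\<in>I. \<exists>n. x \<sqsubseteq> p \<oplus> mv_nfold A n a}"
    and "a \<in> {x \<in> carrier A. \<exists>p\<in>I. \<exists>n. x \<sqsubseteq> p \<oplus> mv_nfold A n a}"
proof -
  show sub: "I \<subseteq> ?J"
  proof
    fix p assume p: "p \<in> I"
    then have "p \<sqsubseteq> p \<oplus> mv_nfold A 0 a" using ideal_in[OF I] by simp
    with p show "p \<in> ?J" using ideal_in[OF I] by blast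
  qed
  have "a \<sqsubseteq> \<zero> \<oplus> mv_nfold A 1 a" using a by simp
  then show "a \<in> ?J" using a ideal_zero[OF I] by blast
  show "mv_ideal A ?J"
    unfolding mv_ideal_def
  proof (intro conjI ballI impI)
    show "?J \<subseteq> carrier A" by blast
    show "?J \<noteq> {}" using sub ideal_zero[OF I] by blast
  next
    fix x y assume x: "x \<in> carrier A" and y: "y \<in> ?J" and le: "x \<sqsubseteq> y"
    then obtain p n where "p \<in> I" "y \<sqsubseteq> p \<oplus> mv_nfold A n a" by blast
    moreover have "x \<sqsubseteq> p \<oplus> mv_nfold A n a"
      using le_trans[OF le calculation(2)] x y a ideal_in[OF I calculation(1)] by simp
    ultimately show "x \<in> ?J" using x by blast
  next
    fix x y assume "x \<in> ?J" "y \<in> ?J"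
    then obtain p n q m where pq: "p \<in> I" "q \<in> I" and xy: "x \<in> carrier A" "y \<in> carrier A"
      and le: "x \<sqsubseteq> p \<oplus> mv_nfold A n a" "y \<sqsubseteq> q \<oplus> mv_nfold A m a" by blast
    have c: "p \<in> carrier A" "q \<in> carrier A" using pq ideal_in[OF I] by auto
    have "x \<oplus> y \<sqsubseteq> (p \<oplus> mv_nfold A n a) \<oplus> (q \<oplus> mv_nfold A m a)"
      using le xy c a by (intro plus_mono) auto
    also have "\<dots> = (p \<oplus> q) \<oplus> mv_nfold A (n + m) a"
      using c a by (simp add: nfold_add plus_ac)
    finally show "x \<oplus> y \<in> ?J" using xy ideal_plus[OF I pq]
      by (intro CollectI conjI bexI[of _ "p \<oplus> q"] exI[of _ "n + m"]) auto
  qed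
qed

lemma ideal_gen_singleton:
  assumes a: "a \<in> carrier A"
  shows "mv_ideal_gen A {a} = {x \<in> carrier A. \<exists>n. x \<sqsubseteq> mv_nfold A n a}" (is "_ = ?J")
proof
  have "?J = {x \<in> carrier A. \<exists>p\<in>{\<zero>}. \<exists>n. x \<sqsubseteq> p \<oplus> mv_nfold A n a}" using a by simp
  then have "mv_ideal A ?J" "a \<in> ?J"
    using ideal_adjoin[OF ideal_singleton_zero a] by auto
  then show "mv_ideal_gen A {a} \<subseteq> ?J" unfolding mv_ideal_gen_def by blast
  show "?J \<subseteq> mv_ideal_gen A {a}"
    unfolding mv_ideal_gen_def using ideal_nfold ideal_down by blast
qed

lemma ideal_gen_is_ideal:
  assumes "G \<subseteq> carrier A"
  shows "mv_ideal A (mv_ideal_gen A G)" "G \<subseteq> mv_ideal_gen A G"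
proof -
  have "mv_ideal A (carrier A)" using zero_in by (auto simp: mv_ideal_def simp del: zero_in)
  then show "mv_ideal A (mv_ideal_gen A G)"
    using assms unfolding mv_ideal_gen_def mv_ideal_def[of A "\<Inter>_"]
    by (auto intro: ideal_down ideal_plus dest: ideal_in ideal_zero)
  show "G \<subseteq> mv_ideal_gen A G" unfolding mv_ideal_gen_def by blast
qed

text \<open>Finitely many generators can be replaced by their sum, because an ideal contains a sum
  exactly when it contains both summands.\<close>

lemma fin_gen_ideal_principal:
  assumes "fin_gen_ideal A I"
  shows "\<exists>a\<in>carrier A. I = mv_ideal_gen A {a}"
proof -
  have "\<exists>a\<in>carrier A. \<forall>J. mv_ideal A J \<longrightarrow> G \<subseteq> J \<longleftrightarrow> a \<in> J"
    if "finite G" "G \<subseteq> carrier A" for G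
    using that
  proof induction
    case empty
    then show ?case using ideal_zero zero_in by blast
  next
    case (insert b G)
    then obtain a where "a \<in> carrier A" "\<forall>J. mv_ideal A J \<longrightarrow> G \<subseteq> J \<longleftrightarrow> a \<in> J" by auto
    then show ?case using insert.prems
      by (intro bexI[of _ "b \<oplus> a"]) (auto simp: ideal_plus_iff)
  qed
  moreover obtain G where "finite G" "G \<subseteq> carrier A" and I: "I = mv_ideal_gen A G"
    using assms unfolding fin_gen_ideal_def by blast
  ultimately obtain a where a: "a \<in> carrier A" "\<And>J. mv_ideal A J \<Longrightarrow> G \<subseteq> J \<longleftrightarrow> a \<in> J" by metis
  then have "{J. mv_ideal A J \<and> G \<subseteq> J} = {J. mv_ideal A J \<and> {a} \<subseteq> J}" by auto
  then show ?thesis using a(1) unfolding I mv_ideal_gen_def by metis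
qed

text \<open>Removing one copy of \<open>a\<close> from \<open>w\<close> leaves an element below the
  shorter multiple and still below \<open>b\<close>. By induction it is zero, so \<open>w\<close>
  was below \<open>a\<close> already.\<close>

lemma disjoint_nfold:
  assumes ab: "a \<in> carrier A" "b \<in> carrier A"
    and disj: "\<And>w. \<lbrakk>w \<in> carrier A; w \<sqsubseteq> a; w \<sqsubseteq> b\<rbrakk> \<Longrightarrow> w = \<zero>"
  shows "\<lbrakk>w \<in> carrier A; w \<sqsubseteq> mv_nfold A n a; w \<sqsubseteq> b\<rbrakk> \<Longrightarrow> w = \<zero>"
proof (induction n arbitrary: w)
  case 0
  then show ?case by (simp add: le_zero_iff)
next
  case (Suc n)
  have "w \<odot> \<sim> a \<sqsubseteq> mv_nfold A n a" using Suc.prems ab by (simp add: minus_le_iff)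
  moreover have "w \<odot> \<sim> a \<sqsubseteq> b"
    using le_trans[OF minus_le Suc.prems(3)] Suc.prems ab by simp
  ultimately have "w \<odot> \<sim> a = \<zero>" using Suc ab by simp
  then show ?case using disj Suc.prems ab by (simp flip: le_iff_minus)
qed

text \<open>The second condition expresses that the quotient by \<open>P\<close> is linearly
  ordered.\<close>

definition prime_ideal :: "'a set \<Rightarrow> bool"
  where "prime_ideal P \<longleftrightarrow> mv_ideal A P \<and>
    (\<forall>x\<in>carrier A. \<forall>y\<in>carrier A. x \<odot> \<sim> y \<in> P \<or> y \<odot> \<sim> x \<in> P)"

text \<open>An ideal maximal among those omitting \<open>e\<close> is prime. If it contained neither
  difference of \<open>x\<close> and \<open>y\<close>, maximality would put \<open>e\<close> below
  \<open>r\<close> plus a multiple of each difference, for one \<open>r\<close> in the ideal. Then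
  \<open>e\<close> minus \<open>r\<close> lies below multiples of two disjoint elements, so it is
  zero, and \<open>e\<close> would belong to the ideal.\<close>

lemma prime_ideal_exists:
  assumes e: "e \<in> carrier A" "e \<noteq> \<zero>"
  shows "\<exists>P. prime_ideal P \<and> e \<notin> P"
proof -
  let ?F = "{I. mv_ideal A I \<and> e \<notin> I}"
  have "\<exists>P\<in>?F. \<forall>I\<in>?F. P \<subseteq> I \<longrightarrow> I = P"
  proof (rule subset_Zorn_nonempty)
    show "?F \<noteq> {}" using ideal_singleton_zero e by blast
  next
    fix \<C> assume ne: "\<C> \<noteq> {}" and chain: "subset.chain ?F \<C>"
    have id: "mv_ideal A I" "e \<notin> I" if "I \<in> \<C>" for I
      using chain that by (auto simp: subset.chain_def)
    have "mv_ideal A (\<Union>\<C>)"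
      unfolding mv_ideal_def
    proof (intro conjI ballI impI)
      show "\<Union>\<C> \<subseteq> carrier A" using id ideal_in by blast
      show "\<Union>\<C> \<noteq> {}" using id ne ideal_zero by blast
      show "x \<in> \<Union>\<C>" if "x \<in> carrier A" "y \<in> \<Union>\<C>" "x \<sqsubseteq> y" for x y
        using that id ideal_down by blast
    next
      fix x y assume "x \<in> \<Union>\<C>" "y \<in> \<Union>\<C>"
      then obtain I J where IJ: "x \<in> I" "y \<in> J" "I \<in> \<C>" "J \<in> \<C>" by blast
      then have "I \<subseteq> J \<or> J \<subseteq> I" using chain by (auto simp: subset.chain_def)
      then show "x \<oplus> y \<in> \<Union>\<C>" using IJ id ideal_plus by blast
    qed
    then show "\<Union>\<C> \<in> ?F" using id by blast
  qed
  then obtain P where P: "mv_ideal A P" "e \<notin> P"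
    and max: "\<And>I. \<lbrakk>mv_ideal A I; e \<notin> I; P \<subseteq> I\<rbrakk> \<Longrightarrow> I = P" by blast
  have adj: "\<exists>p\<in>P. \<exists>n. e \<sqsubseteq> p \<oplus> mv_nfold A n a" if a: "a \<in> carrier A" "a \<notin> P" for a
    using max[OF ideal_adjoin(1)[OF P(1) a(1)] _ ideal_adjoin(2)[OF P(1) a(1)]]
      ideal_adjoin(3)[OF P(1) a(1)] a by blast
  have "x \<odot> \<sim> y \<in> P \<or> y \<odot> \<sim> x \<in> P" if xy: "x \<in> carrier A" "y \<in> carrier A" for x y
  proof (rule ccontr)
    define a b where "a = x \<odot> \<sim> y" and "b = y \<odot> \<sim> x"
    have c: "a \<in> carrier A" "b \<in> carrier A" using xy by (auto simp: a_def b_def)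
    assume "\<not> ?thesis"
    then obtain p q m n where pq: "p \<in> P" "q \<in> P"
      and le: "e \<sqsubseteq> p \<oplus> mv_nfold A n a" "e \<sqsubseteq> q \<oplus> mv_nfold A m b"
      using adj c unfolding a_def b_def by blast
    define r where "r = p \<oplus> q"
    have cpq: "p \<in> carrier A" "q \<in> carrier A" "r \<in> carrier A"
      using pq ideal_in[OF P(1)] by (auto simp: r_def)
    have "p \<oplus> mv_nfold A n a \<sqsubseteq> r \<oplus> mv_nfold A n a" "q \<oplus> mv_nfold A m b \<sqsubseteq> r \<oplus> mv_nfold A m b"
      using cpq c by (auto intro!: plus_mono simp: r_def)
    then have "e \<sqsubseteq> r \<oplus> mv_nfold A n a" "e \<sqsubseteq> r \<oplus> mv_nfold A m b"
      using le le_trans e c cpq plus_in nfold_in by blast+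
    then have w: "e \<odot> \<sim> r \<sqsubseteq> mv_nfold A n a" "e \<odot> \<sim> r \<sqsubseteq> mv_nfold A m b"
      using e c cpq by (simp_all add: minus_le_iff)
    have 0: "w = \<zero>" if "w \<in> carrier A" "w \<sqsubseteq> a" "w \<sqsubseteq> b" for w
      using prelinear[of x y w] xy that by (simp add: a_def b_def)
    \<comment> \<open>\<open>disjoint_nfold\<close> passes to a multiple of one element only. It is
      applied here to \<open>a\<close> and below, with the roles exchanged, to
      \<open>b\<close>.\<close>
    have 1: "w = \<zero>" if "w \<in> carrier A" "w \<sqsubseteq> b" "w \<sqsubseteq> mv_nfold A n a" for w
      using disjoint_nfold[OF c 0] that by blast
    have "e \<odot> \<sim> r = \<zero>"
      using disjoint_nfold[OF c(2) _ 1, of "mv_nfold A n a"] w e cpq c by simp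
    then have "e \<sqsubseteq> r" using e cpq by (simp add: le_iff_minus)
    then show False using P pq ideal_plus ideal_down e unfolding r_def by blast
  qed
  then show ?thesis using P unfolding prime_ideal_def by blast
qed

end

section \<open>Quotients and representation in chains\<close>

definition mv_chain :: "('a, 'm) mv_alg_scheme \<Rightarrow> bool"
  where "mv_chain A \<longleftrightarrow> (\<forall>x\<in>carrier A. \<forall>y\<in>carrier A. x \<sqsubseteq>\<^bsub>A\<^esub> y \<or> y \<sqsubseteq>\<^bsub>A\<^esub> x)"

definition mv_cong :: "('a, 'm) mv_alg_scheme \<Rightarrow> 'a set \<Rightarrow> 'a \<Rightarrow> 'a \<Rightarrow> bool"
  where "mv_cong A P x y \<longleftrightarrow> x \<odot>\<^bsub>A\<^esub> \<sim>\<^bsub>A\<^esub> y \<in> P \<and> y \<odot>\<^bsub>A\<^esub> \<sim>\<^bsub>A\<^esub> x \<in> P"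

definition mv_rep :: "('a, 'm) mv_alg_scheme \<Rightarrow> 'a set \<Rightarrow> 'a \<Rightarrow> 'a"
  where "mv_rep A P x = (SOME y. y \<in> carrier A \<and> mv_cong A P x y)"

text \<open>The quotient by an ideal lives on chosen representatives, so it keeps the carrier type.\<close>

definition mv_quot :: "('a, 'm) mv_alg_scheme \<Rightarrow> 'a set \<Rightarrow> 'a mv_alg"
  where "mv_quot A P = \<lparr>carrier = mv_rep A P ` carrier A,
    mv_plus = (\<lambda>x y. mv_rep A P (x \<oplus>\<^bsub>A\<^esub> y)),
    mv_neg = (\<lambda>x. mv_rep A P (\<sim>\<^bsub>A\<^esub> x)),
    mv_zero = mv_rep A P \<zero>\<^bsub>A\<^esub>,
    mv_scal = (\<lambda>r x. mv_rep A P (r \<cdot>\<^bsub>A\<^esub> x))\<rparr>"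

locale mv_ideal_quotient = mv_algebra A for A :: "('a, 'm) mv_alg_scheme" (structure) +
  fixes P :: "'a set"
  assumes ideal: "mv_ideal A P"
begin

abbreviation rep :: "'a \<Rightarrow> 'a" where "rep \<equiv> mv_rep A P"
abbreviation cong :: "'a \<Rightarrow> 'a \<Rightarrow> bool" where "cong \<equiv> mv_cong A P"

lemma cong_refl: "x \<in> carrier A \<Longrightarrow> cong x x"
  using ideal_zero[OF ideal] by (simp add: mv_cong_def)

lemma cong_sym: "cong x y \<Longrightarrow> cong y x"
  by (auto simp: mv_cong_def)

lemma cong_trans:
  assumes "cong x y" "cong y z" "x \<in> carrier A" "y \<in> carrier A" "z \<in> carrier A"
  shows "cong x z"
proof -
  have "u \<odot> \<sim> w \<in> P"
    if "u \<odot> \<sim> v \<in> P" "v \<odot> \<sim> w \<in> P" "u \<in> carrier A" "v \<in> carrier A" "w \<in> carrier A" for u v w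
    using ideal_down[OF ideal ideal_plus[OF ideal that(1,2)]] minus_triangle[of u v w] that by simp
  then show ?thesis using assms unfolding mv_cong_def by blast
qed

lemma cong_plus:
  assumes "cong x x'" "cong y y'"
    "x \<in> carrier A" "y \<in> carrier A" "x' \<in> carrier A" "y' \<in> carrier A"
  shows "cong (x \<oplus> y) (x' \<oplus> y')"
proof -
  have "(u \<oplus> v) \<odot> \<sim> (u' \<oplus> v') \<in> P"
    if "u \<odot> \<sim> u' \<in> P" "v \<odot> \<sim> v' \<in> P"
      "u \<in> carrier A" "v \<in> carrier A" "u' \<in> carrier A" "v' \<in> carrier A" for u v u' v'
    using ideal_down[OF ideal ideal_plus[OF ideal that(1,2)]] minus_plus_plus[of u v u' v'] that
    by simp
  then show ?thesis using assms unfolding mv_cong_def by blast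
qed

lemma cong_neg:
  assumes "cong x y" "x \<in> carrier A" "y \<in> carrier A"
  shows "cong (\<sim> x) (\<sim> y)"
  using assms by (simp add: mv_cong_def odot_comm)

lemma rep: assumes "x \<in> carrier A"
  shows rep_in [simp]: "rep x \<in> carrier A" and cong_rep: "cong x (rep x)"
  using someI[of "\<lambda>y. y \<in> carrier A \<and> cong x y" x] cong_refl[OF assms] assms
  unfolding mv_rep_def by auto

lemma rep_eq_iff:
  assumes "x \<in> carrier A" "y \<in> carrier A"
  shows "rep x = rep y \<longleftrightarrow> cong x y"
proof
  assume "rep x = rep y"
  then show "cong x y"
    using cong_rep[of x] cong_rep[of y] cong_trans[of x "rep x" y] cong_sym assms by simp
next
  assume "cong x y"
  then have "cong x z \<longleftrightarrow> cong y z" if "z \<in> carrier A" for z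
    using cong_trans cong_sym assms that by blast
  then show "rep x = rep y" unfolding mv_rep_def by metis
qed

lemma rep_rep [simp]: "x \<in> carrier A \<Longrightarrow> rep (rep x) = rep x"
  by (simp add: rep_eq_iff cong_rep cong_sym)

lemma rep_plus [simp]:
  assumes "x \<in> carrier A" "y \<in> carrier A"
  shows "rep (rep x \<oplus> y) = rep (x \<oplus> y)" "rep (x \<oplus> rep y) = rep (x \<oplus> y)"
  using assms by (simp_all add: rep_eq_iff cong_plus cong_rep cong_sym cong_refl)

lemma rep_neg [simp]: "x \<in> carrier A \<Longrightarrow> rep (\<sim> (rep x)) = rep (\<sim> x)"
  by (simp add: rep_eq_iff cong_neg cong_rep cong_sym)

lemma quot_simps:
  "carrier (mv_quot A P) = rep ` carrier A"
  "x \<oplus>\<^bsub>mv_quot A P\<^esub> y = rep (x \<oplus> y)"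
  "\<sim>\<^bsub>mv_quot A P\<^esub> x = rep (\<sim> x)"
  "\<zero>\<^bsub>mv_quot A P\<^esub> = rep \<zero>"
  "r \<cdot>\<^bsub>mv_quot A P\<^esub> x = rep (r \<cdot> x)"
  by (simp_all add: mv_quot_def)

lemma quot_algebra: "mv_algebra (mv_quot A P)"
proof
  fix x y assume "x \<in> carrier (mv_quot A P)" "y \<in> carrier (mv_quot A P)"
  then obtain u v where [simp]: "x = rep u" "y = rep v" "u \<in> carrier A" "v \<in> carrier A"
    by (auto simp: quot_simps)
  show "\<sim>\<^bsub>mv_quot A P\<^esub> (\<sim>\<^bsub>mv_quot A P\<^esub> x \<oplus>\<^bsub>mv_quot A P\<^esub> y) \<oplus>\<^bsub>mv_quot A P\<^esub> y
      = \<sim>\<^bsub>mv_quot A P\<^esub> (\<sim>\<^bsub>mv_quot A P\<^esub> y \<oplus>\<^bsub>mv_quot A P\<^esub> x) \<oplus>\<^bsub>mv_quot A P\<^esub> x"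
    by (simp add: quot_simps lukasiewicz[of u v])
qed (auto simp: quot_simps plus_assoc, simp add: plus_comm)

lemma quot_le_iff:
  assumes "x \<in> carrier A" "y \<in> carrier A"
  shows "rep x \<sqsubseteq>\<^bsub>mv_quot A P\<^esub> rep y \<longleftrightarrow> x \<odot> \<sim> y \<in> P"
proof -
  have "rep x \<sqsubseteq>\<^bsub>mv_quot A P\<^esub> rep y \<longleftrightarrow> cong (\<sim> x \<oplus> y) (mv_one A)"
    using assms by (simp add: mv_le_def mv_one_def[of "mv_quot A P"] quot_simps flip: rep_eq_iff)
  also have "\<dots> \<longleftrightarrow> x \<odot> \<sim> y \<in> P"
    using assms ideal_zero[OF ideal] by (simp add: mv_cong_def neg_plus)
  finally show ?thesis .
qed

end

locale scalar_ideal_quotient = scalar_mv_algebra S A + mv_ideal_quotient A P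
  for S and A :: "('a, 'm) mv_alg_scheme" (structure) and P +
  assumes scalars: "S = {} \<or> 1 \<in> S \<and> S \<subseteq> {0..1}" and set: "scalar_set S"
begin

lemmas scal_in [simp] = scal_closed

text \<open>As \<open>max 0 (r - 1)\<close> is 0, the difference axiom evaluates
  \<open>r \<cdot> x\<close> minus \<open>1 \<cdot> x\<close> to \<open>0 \<cdot> x\<close>, which
  is zero. It follows that ideals of the MV-reduct absorb scalars, so the quotient inherits
  them.\<close>

lemma scal_le:
  assumes "r \<in> S" "x \<in> carrier A"
  shows "r \<cdot> x \<sqsubseteq> x"
proof -
  have 1: "1 \<in> S" "r \<le> 1" using assms scalars by auto
  have "0 \<cdot> x = \<zero>" using scal_diff[of r r x] assms by simp
  moreover have "0 \<cdot> x = (r \<cdot> x) \<odot> \<sim> (1 \<cdot> x)"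
    using scal_diff[of r 1 x] assms 1 by simp
  ultimately show ?thesis using assms 1 by (simp add: le_iff_minus scal_one)
qed

lemma cong_scal:
  assumes "r \<in> S" "cong x y" "x \<in> carrier A" "y \<in> carrier A"
  shows "cong (r \<cdot> x) (r \<cdot> y)"
proof -
  have "(r \<cdot> u) \<odot> \<sim> (r \<cdot> v) \<in> P" if "u \<odot> \<sim> v \<in> P" "u \<in> carrier A" "v \<in> carrier A" for u v
    using ideal_down[OF ideal that(1) scal_le[of r "u \<odot> \<sim> v"]] scal_odot[of r u v] that assms
    by simp
  then show ?thesis using assms unfolding mv_cong_def by blast
qed

lemma rep_scal [simp]: "\<lbrakk>r \<in> S; x \<in> carrier A\<rbrakk> \<Longrightarrow> rep (r \<cdot> rep x) = rep (r \<cdot> x)"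
  by (simp add: rep_eq_iff cong_scal cong_rep cong_sym)

lemma quot_scalar_algebra: "scalar_mv_algebra S (mv_quot A P)"
proof -
  interpret Q: mv_algebra "mv_quot A P" by (rule quot_algebra)
  interpret S: scalar_set S by (rule set)
  have odot: "rep u \<odot>\<^bsub>mv_quot A P\<^esub> rep v = rep (u \<odot> v)" if "u \<in> carrier A" "v \<in> carrier A" for u v
    using that by (simp add: quot_simps mv_odot_def)
  show ?thesis
  proof
    fix r x y assume r: "r \<in> S" and "x \<in> carrier (mv_quot A P)" "y \<in> carrier (mv_quot A P)"
    then obtain u v where [simp]: "x = rep u" "y = rep v" "u \<in> carrier A" "v \<in> carrier A"
      by (auto simp: quot_simps)
    have "rep (r \<cdot> (u \<odot> \<sim> v)) = rep ((r \<cdot> u) \<odot> \<sim> (r \<cdot> v))"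
      using scal_odot[of r u v] r by simp
    then show "r \<cdot>\<^bsub>mv_quot A P\<^esub> (x \<odot>\<^bsub>mv_quot A P\<^esub> \<sim>\<^bsub>mv_quot A P\<^esub> y)
        = (r \<cdot>\<^bsub>mv_quot A P\<^esub> x) \<odot>\<^bsub>mv_quot A P\<^esub> \<sim>\<^bsub>mv_quot A P\<^esub> (r \<cdot>\<^bsub>mv_quot A P\<^esub> y)"
      using r by (simp add: quot_simps odot)
  next
    fix r q x assume r: "r \<in> S" "q \<in> S" and "x \<in> carrier (mv_quot A P)"
    then obtain u where [simp]: "x = rep u" "u \<in> carrier A" by (auto simp: quot_simps)
    have "rep (max 0 (r - q) \<cdot> u) = rep ((r \<cdot> u) \<odot> \<sim> (q \<cdot> u))"
      using scal_diff[of r q u] r by simp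
    then show "max 0 (r - q) \<cdot>\<^bsub>mv_quot A P\<^esub> x
        = (r \<cdot>\<^bsub>mv_quot A P\<^esub> x) \<odot>\<^bsub>mv_quot A P\<^esub> \<sim>\<^bsub>mv_quot A P\<^esub> (q \<cdot>\<^bsub>mv_quot A P\<^esub> x)"
      using r S.diff_in[of r q] by (simp add: quot_simps odot)
  qed (auto simp: quot_simps scal_scal scal_one S.mult_in)
qed

end

text \<open>One of the two differences of \<open>a\<close> and \<open>b\<close> is non-zero, and a
  prime ideal omitting it keeps the two elements apart. The existential over \<open>C\<close> can
  only range over algebras on a fixed type, which is why quotients live on representatives.\<close>

lemma (in scalar_mv_algebra) chain_quotient:
  assumes S: "S = {} \<or> 1 \<in> S \<and> S \<subseteq> {0..1}" "scalar_set S"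
    and ab: "a \<in> carrier A" "b \<in> carrier A" "a \<noteq> b"
  shows "\<exists>(C :: 'a mv_alg) h. scalar_mv_algebra S C \<and> mv_chain C \<and> h \<in> mv_hom S A C \<and> h a \<noteq> h b"
proof -
  have "\<exists>e\<in>{a \<odot> \<sim> b, b \<odot> \<sim> a}. e \<noteq> \<zero>"
    using ab le_antisym[of a b] by (auto simp: le_iff_minus)
  then obtain e where e: "e = a \<odot> \<sim> b \<or> e = b \<odot> \<sim> a" "e \<noteq> \<zero>" by blast
  moreover have "e \<in> carrier A" using e ab by auto
  ultimately obtain P where P: "prime_ideal P" "e \<notin> P" using prime_ideal_exists by blast
  interpret S: scalar_set S by (rule S(2))
  interpret Q: scalar_ideal_quotient S A P
    by unfold_locales (use S P in \<open>auto simp: prime_ideal_def\<close>)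
  let ?h = "restrict (mv_rep A P) (carrier A)"
  have "mv_chain (mv_quot A P)"
    using P unfolding mv_chain_def prime_ideal_def by (auto simp: Q.quot_simps Q.quot_le_iff)
  moreover have "?h \<in> mv_hom S A (mv_quot A P)"
    unfolding mv_hom_def by (auto simp: Q.quot_simps)
  moreover have "?h a \<noteq> ?h b"
    using e P ab by (auto simp: Q.rep_eq_iff mv_cong_def)
  ultimately show ?thesis using Q.quot_scalar_algebra by blast
qed

section \<open>Real models of integer cones\<close>

text \<open>The midpoint of the largest lower and the smallest upper bound works. If these coincide,
  separation excludes strict flags at the common value; otherwise the midpoint lies strictly between
  them.\<close>

lemma between_bounds:
  fixes L U :: "(real \<times> bool) set"
  assumes fin: "finite L" "finite U"
    and sep: "\<And>l s u t. \<lbrakk>(l, s) \<in> L; (u, t) \<in> U\<rbrakk> \<Longrightarrow> if s \<or> t then l < u else l \<le> u"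
  shows "\<exists>x. (\<forall>(l, s)\<in>L. if s then l < x else l \<le> x) \<and> (\<forall>(u, t)\<in>U. if t then x < u else x \<le> u)"
proof -
  have LM: "l \<le> Max (fst ` L)" if "(l, s) \<in> L" for l s
    using that fin by (intro Max_ge) force+
  have UM: "Min (fst ` U) \<le> u" if "(u, t) \<in> U" for u t
    using that fin by (intro Min_le) force+
  show ?thesis
  proof (cases "L = {} \<or> U = {}")
    case True
    then show ?thesis
    proof
      assume "L = {}"
      then show ?thesis using UM by (intro exI[of _ "Min (fst ` U) - 1"]) force
    next
      assume "U = {}"
      then show ?thesis using LM by (intro exI[of _ "Max (fst ` L) + 1"]) force
    qed
  next
    case False
    then have "Max (fst ` L) \<in> fst ` L" "Min (fst ` U) \<in> fst ` U" using fin by auto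
    then obtain s t where st: "(Max (fst ` L), s) \<in> L" "(Min (fst ` U), t) \<in> U" by force
    let ?x = "(Max (fst ` L) + Min (fst ` U)) / 2"
    have le: "Max (fst ` L) \<le> Min (fst ` U)" using sep[OF st] by (auto split: if_splits)
    have "if s' then l < ?x else l \<le> ?x" if l: "(l, s') \<in> L" for l s'
      using LM[OF l] le sep[OF l st(2)] by (auto split: if_splits)
    moreover have "if t' then ?x < u else ?x \<le> u" if u: "(u, t') \<in> U" for u t'
      using UM[OF u] le sep[OF st(1) u] by (auto split: if_splits)
    ultimately show ?thesis by (intro exI[of _ ?x]) blast
  qed
qed

definition dot :: "'v set \<Rightarrow> ('v \<Rightarrow> int) \<Rightarrow> ('v \<Rightarrow> real) \<Rightarrow> real"
  where "dot V v q = (\<Sum>i\<in>V. of_int (v i) * q i)"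

lemma dot_lincomb: "dot V (\<lambda>i. a * v i + b * w i) q = of_int a * dot V v q + of_int b * dot V w q"
  by (simp add: dot_def sum_distrib_left algebra_simps sum.distrib)

lemma dot_uminus: "dot V (\<lambda>i. - v i) q = - dot V v q"
  by (simp add: dot_def sum_negf)

text \<open>The non-negative vectors of a translation-invariant total preorder. A vector and its
  negative may both belong to \<open>K\<close>: a non-zero formal combination can have trivial value
  in the group.\<close>

locale total_cone =
  fixes K :: "('v \<Rightarrow> int) set"
  assumes add: "\<lbrakk>v \<in> K; w \<in> K\<rbrakk> \<Longrightarrow> (\<lambda>i. v i + w i) \<in> K"
    and total: "v \<in> K \<or> (\<lambda>i. - v i) \<in> K"
begin

lemma zero: "(\<lambda>i. 0) \<in> K"
  using total[of "\<lambda>i. 0"] by simp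

lemma scale_nat: "v \<in> K \<Longrightarrow> (\<lambda>i. int n * v i) \<in> K"
proof (induction n)
  case (Suc n)
  then show ?case using add[of v "\<lambda>i. int n * v i"] by (simp add: algebra_simps)
qed (simp add: zero)

lemma scale: "\<lbrakk>v \<in> K; 0 \<le> a\<rbrakk> \<Longrightarrow> (\<lambda>i. a * v i) \<in> K"
  using scale_nat[of v "nat a"] by simp

lemma lincomb: "\<lbrakk>v \<in> K; w \<in> K; 0 \<le> a; 0 \<le> b\<rbrakk> \<Longrightarrow> (\<lambda>i. a * v i + b * w i) \<in> K"
  using add scale by blast

text \<open>Adding \<open>b\<close> times \<open>w\<close> and \<open>a - 1\<close> times
  \<open>v\<close> to the negated combination leaves the negated \<open>v\<close>; the integer
  \<open>a\<close> is at least 1. Read contrapositively, a strict constraint stays strict in every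
  combination that gives it positive weight.\<close>

lemma strict_lincomb:
  assumes "v \<in> K" "w \<in> K" "0 < a" "0 \<le> b" "(\<lambda>i. - (a * v i + b * w i)) \<in> K"
  shows "(\<lambda>i. - v i) \<in> K"
proof -
  have "(\<lambda>i. (- (a * v i + b * w i) + b * w i) + (a - 1) * v i) \<in> K"
    using assms by (intro add scale) auto
  moreover have "(- (a * v i + b * w i) + b * w i) + (a - 1) * v i = - v i" for i
    by (simp add: algebra_simps)
  ultimately show ?thesis by simp
qed

text \<open>
  Fourier--Motzkin elimination. The Boolean marks strict constraints; nothing beyond the cone
  property of \<open>K\<close> is needed to keep the eliminated system inside \<open>K\<close>.
\<close>

lemma fourier_motzkin:
  assumes "finite V" "finite Cs"
    and "\<And>v s. (v, s) \<in> Cs \<Longrightarrow> v \<in> K \<and> (s \<longrightarrow> (\<lambda>i. - v i) \<notin> K) \<and> (\<forall>i. i \<notin> V \<longrightarrow> v i = 0)"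
  shows "\<exists>q. \<forall>(v, s)\<in>Cs. if s then 0 < dot V v q else 0 \<le> dot V v q"
  using assms
proof (induction V arbitrary: Cs)
  case empty
  have "\<not> s" if "(v, s) \<in> Cs" for v s
  proof -
    have "v = (\<lambda>i. 0)" using empty.prems(2)[OF that] by auto
    then show ?thesis using empty.prems(2)[OF that] zero by auto
  qed
  then show ?case by (auto simp: dot_def)
next
  case (insert x V)
  define Pos where "Pos = {(v, s) \<in> Cs. 0 < v x}"
  define Neg where "Neg = {(v, s) \<in> Cs. v x < 0}"
  define Nul where "Nul = {(v, s) \<in> Cs. v x = 0}"
  \<comment> \<open>The weights \<open>- w x\<close> and \<open>v x\<close> are positive on
    \<open>Pos \<times> Neg\<close> and cancel the coefficient at \<open>x\<close>; the result is
    strict as soon as one parent is.\<close>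
  define comb where "comb = (\<lambda>((v :: 'v \<Rightarrow> int, s), (w, t)).
    ((\<lambda>i. (- w x) * v i + v x * w i), s \<or> t))"
  define Cs' where "Cs' = Nul \<union> comb ` (Pos \<times> Neg)"
  have "Pos \<subseteq> Cs" "Neg \<subseteq> Cs" "Nul \<subseteq> Cs" by (auto simp: Pos_def Neg_def Nul_def)
  then have fin: "finite Pos" "finite Neg" "finite Nul" using insert.prems finite_subset by auto
  have "\<exists>q. \<forall>(v, s)\<in>Cs'. if s then 0 < dot V v q else 0 \<le> dot V v q"
  proof (rule insert.IH)
    show "finite Cs'" using fin by (simp add: Cs'_def)
  next
    fix u r assume "(u, r) \<in> Cs'"
    then consider (nul) "(u, r) \<in> Nul"
      | (comb) v s w t where "(v, s) \<in> Cs" "(w, t) \<in> Cs" "0 < v x" "w x < 0"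
        "u = (\<lambda>i. (- w x) * v i + v x * w i)" "r = (s \<or> t)"
      by (auto simp: Cs'_def comb_def Pos_def Neg_def)
    then show "u \<in> K \<and> (r \<longrightarrow> (\<lambda>i. - u i) \<notin> K) \<and> (\<forall>i. i \<notin> V \<longrightarrow> u i = 0)"
    proof cases
      case nul
      then have u: "(u, r) \<in> Cs" "u x = 0" by (auto simp: Nul_def)
      then show ?thesis using insert.prems(2)[OF u(1)] by (metis insertE)
    next
      case comb
      note v = insert.prems(2)[OF comb(1)] and w = insert.prems(2)[OF comb(2)]
      have "u \<in> K" unfolding comb(5) using v w comb(3,4) by (intro lincomb) auto
      moreover have "(\<lambda>i. - u i) \<notin> K" if r
      proof
        assume u: "(\<lambda>i. - u i) \<in> K"
        then have "(\<lambda>i. - v i) \<in> K" using v w comb(3-5) strict_lincomb[of v w "- w x" "v x"] by auto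
        moreover have "(\<lambda>i. - w i) \<in> K"
          using u v w comb(3-5) strict_lincomb[of w v "v x" "- w x"] by (auto simp: add.commute)
        ultimately show False using v w that comb(6) by auto
      qed
      moreover have "u i = 0" if "i \<notin> V" for i
        using that v w comb(5) by (cases "i = x") auto
      ultimately show ?thesis by blast
    qed
  qed
  then obtain q where q: "\<And>v s. (v, s) \<in> Cs' \<Longrightarrow> if s then 0 < dot V v q else 0 \<le> dot V v q"
    by blast
  \<comment> \<open>The root in \<open>y\<close> of \<open>of_int (v x) * y + dot V v q\<close>: a
    lower bound for the value at \<open>x\<close> if \<open>v x\<close> is positive, an upper bound
    if it is negative.\<close>
  define bound where "bound = (\<lambda>(v :: 'v \<Rightarrow> int, s :: bool). (- dot V v q / of_int (v x), s))"
  have sep: "if s \<or> t then l < u else l \<le> u" if lu: "(l, s) \<in> bound ` Pos" "(u, t) \<in> bound ` Neg" for l s u t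
  proof -
    obtain v w where v: "(v, s) \<in> Pos" "l = - dot V v q / of_int (v x)"
      and w: "(w, t) \<in> Neg" "u = - dot V w q / of_int (w x)"
      using lu by (auto simp: bound_def)
    have sg: "0 < v x" "w x < 0" using v w by (auto simp: Pos_def Neg_def)
    have "comb ((v, s), (w, t)) \<in> Cs'" using v w by (auto simp: Cs'_def)
    then have c: "((\<lambda>i. (- w x) * v i + v x * w i), s \<or> t) \<in> Cs'" by (simp add: comb_def)
    have "if s \<or> t then 0 < - of_int (w x) * dot V v q + of_int (v x) * dot V w q
        else 0 \<le> - of_int (w x) * dot V v q + of_int (v x) * dot V w q"
      using q[OF c] unfolding dot_lincomb by (auto split: if_splits)
    then show ?thesis unfolding v w using sg by (auto simp: field_simps split: if_splits)
  qed
  have "\<exists>y. (\<forall>(l, s)\<in>bound ` Pos. if s then l < y else l \<le> y) \<and>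
      (\<forall>(u, t)\<in>bound ` Neg. if t then y < u else y \<le> u)"
    using fin sep by (intro between_bounds) auto
  then obtain y where
      Pos: "\<forall>(l, s)\<in>bound ` Pos. if s then l < y else l \<le> y" and
      Neg: "\<forall>(u, t)\<in>bound ` Neg. if t then y < u else y \<le> u" by (elim exE conjE)
  have y: "(l, s) \<in> bound ` Pos \<Longrightarrow> if s then l < y else l \<le> y"
      "(u, t) \<in> bound ` Neg \<Longrightarrow> if t then y < u else y \<le> u" for l s u t
    using bspec[OF Pos, of "(l, s)"] bspec[OF Neg, of "(u, t)"] by simp_all
  have dot: "dot (insert x V) v (q(x := y)) = of_int (v x) * y + dot V v q" for v
    using insert.hyps unfolding dot_def by (auto intro!: sum.cong)
  have "if s then 0 < dot (insert x V) v (q(x := y)) else 0 \<le> dot (insert x V) v (q(x := y))"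
    if vs: "(v, s) \<in> Cs" for v s
  proof -
    consider "0 < v x" | "v x < 0" | "v x = 0" by linarith
    then show ?thesis
    proof cases
      case 1
      then have "(- dot V v q / of_int (v x), s) \<in> bound ` Pos" using vs by (force simp: Pos_def bound_def)
      from y(1)[OF this] 1 show ?thesis by (auto simp: dot field_simps split: if_splits)
    next
      case 2
      then have "(- dot V v q / of_int (v x), s) \<in> bound ` Neg" using vs by (force simp: Neg_def bound_def)
      from y(2)[OF this] 2 show ?thesis by (auto simp: dot field_simps split: if_splits)
    next
      case 3
      then have "(v, s) \<in> Cs'" using vs by (simp add: Cs'_def Nul_def)
      from q[OF this] 3 show ?thesis by (simp add: dot)
    qed
  qed
  then show ?case by blast
qed

text \<open>A vector in \<open>K\<close> becomes a weak constraint. For a vector outside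
  \<open>K\<close> the negative lies in \<open>K\<close> by totality and becomes a strict one, which
  enforces the converse direction.\<close>

lemma sign_realization:
  assumes "finite V" "finite P" and supp: "\<And>v i. \<lbrakk>v \<in> P; i \<notin> V\<rbrakk> \<Longrightarrow> v i = 0"
  shows "\<exists>q. \<forall>v\<in>P. v \<in> K \<longleftrightarrow> 0 \<le> dot V v q"
proof -
  let ?Cs = "(\<lambda>v. (v, False)) ` (P \<inter> K) \<union> (\<lambda>v. ((\<lambda>i. - v i), True)) ` (P - K)"
  have "\<exists>q. \<forall>(v, s)\<in>?Cs. if s then 0 < dot V v q else 0 \<le> dot V v q"
    using assms total by (intro fourier_motzkin) auto
  then obtain q where "\<And>v s. (v, s) \<in> ?Cs \<Longrightarrow> if s then 0 < dot V v q else 0 \<le> dot V v q" by blast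
  from this[of _ False] this[of _ True] show ?thesis
    by (intro exI[of _ q]) (force simp: dot_uminus)
qed

end

section \<open>The ordered group of an MV-chain\<close>

text \<open>Chang's construction: (m, a) stands for m + a with integer part m and fractional part a.
  The top is left out of the second components to make this representation unique, and
  \<open>chain_emb\<close> sends it to integer part 1. When \<open>a \<oplus> b\<close> reaches the
  top, \<open>a \<odot> b\<close> plays the role of a + b - 1.\<close>

definition chain_group :: "('a, 'm) mv_alg_scheme \<Rightarrow> (int \<times> 'a) monoid"
  where "chain_group A = \<lparr>carrier = UNIV \<times> (carrier A - {mv_one A}),
    mult = (\<lambda>(m, a) (n, b). if a \<oplus>\<^bsub>A\<^esub> b = mv_one A then (m + n + 1, a \<odot>\<^bsub>A\<^esub> b) else (m + n, a \<oplus>\<^bsub>A\<^esub> b)),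
    one = (0, \<zero>\<^bsub>A\<^esub>)\<rparr>"

definition chain_emb :: "('a, 'm) mv_alg_scheme \<Rightarrow> 'a \<Rightarrow> int \<times> 'a"
  where "chain_emb A a = (if a = mv_one A then (1, \<zero>\<^bsub>A\<^esub>) else (0, a))"

locale nontrivial_chain = mv_algebra A for A :: "('a, 'm) mv_alg_scheme" (structure) +
  assumes chain: "mv_chain A" and nontrivial: "\<zero> \<noteq> mv_one A"
begin

lemma le_total: "\<lbrakk>x \<in> carrier A; y \<in> carrier A\<rbrakk> \<Longrightarrow> x \<sqsubseteq> y \<or> y \<sqsubseteq> x"
  using chain by (auto simp: mv_chain_def)

lemma no_carry: "\<lbrakk>x \<in> carrier A; y \<in> carrier A; x \<oplus> y \<noteq> mv_one A\<rbrakk> \<Longrightarrow> x \<odot> y = \<zero>"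
  using le_total[of x "\<sim> y"] by (simp add: odot_zero_iff plus_one_iff)

text \<open>The left-hand side is the meet of \<open>\<sim> b\<close> and \<open>c\<close>;
  exchanging its arguments gives \<open>c \<odot> \<sim> (c \<odot> b)\<close>, and orthogonality
  reduces this to \<open>c\<close>.\<close>

lemma plus_minus_cancel:
  assumes "b \<odot> c = \<zero>" "b \<in> carrier A" "c \<in> carrier A"
  shows "(b \<oplus> c) \<odot> \<sim> b = c"
proof -
  have "\<sim> b \<odot> (\<sim> (\<sim> b) \<oplus> c) = c \<odot> \<sim> (c \<odot> b)"
    using meet_commute[of "\<sim> b" c] assms by (simp add: neg_odot)
  then show ?thesis using assms by (simp add: odot_comm)
qed

text \<open>Both sides are \<open>c\<close> minus the gap \<open>f\<close> between a + b and 1.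
  Orthogonality of \<open>a\<close> and \<open>b\<close> gives
  \<open>\<sim> a = b \<oplus> f\<close>, and orthogonality of \<open>b\<close> and \<open>c\<close>
  allows \<open>b\<close> to be cancelled.\<close>

lemma odot_plus_assoc:
  assumes "a \<odot> b = \<zero>" "b \<odot> c = \<zero>" "a \<in> carrier A" "b \<in> carrier A" "c \<in> carrier A"
  shows "(a \<oplus> b) \<odot> c = a \<odot> (b \<oplus> c)"
proof -
  define f where "f = \<sim> a \<odot> \<sim> b"
  have f: "f \<in> carrier A" "\<sim> f = a \<oplus> b" using assms by (auto simp: f_def neg_odot)
  have "b \<sqsubseteq> \<sim> a" using assms odot_zero_iff[of b a] by (simp add: odot_comm)
  then have "b \<oplus> f = \<sim> a" using join_eq assms by (simp add: f_def)
  then have "a \<odot> (b \<oplus> c) = (b \<oplus> c) \<odot> \<sim> (b \<oplus> f)" using assms by (simp add: odot_comm)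
  also have "\<dots> = c \<odot> \<sim> f" using assms f by (simp add: minus_plus plus_minus_cancel)
  finally show ?thesis using assms f by (simp add: odot_comm)
qed

text \<open>The preceding identity for the negations: a sum reaching the top means that the
  negations are orthogonal.\<close>

lemma plus_odot_assoc:
  assumes "a \<oplus> b = mv_one A" "b \<oplus> c = mv_one A" "a \<in> carrier A" "b \<in> carrier A" "c \<in> carrier A"
  shows "(a \<odot> b) \<oplus> c = a \<oplus> (b \<odot> c)"
proof -
  have "\<sim> ((a \<odot> b) \<oplus> c) = \<sim> (a \<oplus> (b \<odot> c))"
    using odot_plus_assoc[of "\<sim> a" "\<sim> b" "\<sim> c"] assms
    by (simp add: neg_plus neg_odot) (metis neg_one neg_plus)
  then show ?thesis using assms by (simp add: neg_inject)
qed

text \<open>Here \<open>f\<close> is a + b - 1, so \<open>b\<close> is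
  \<open>\<sim> a \<oplus> f\<close>; as \<open>b \<oplus> c\<close> stays below the top,
  \<open>\<sim> a\<close> can be cancelled from it. The second claim says that no further carry
  arises.\<close>

lemma plus_odot_assoc2:
  assumes ab: "a \<oplus> b = mv_one A" and bc: "b \<oplus> c \<noteq> mv_one A"
    and c: "a \<in> carrier A" "b \<in> carrier A" "c \<in> carrier A"
  shows "(a \<odot> b) \<oplus> c = a \<odot> (b \<oplus> c)" "(a \<odot> b) \<oplus> c \<noteq> mv_one A"
proof -
  define f where "f = a \<odot> b"
  have f: "f \<in> carrier A" using c by (simp add: f_def)
  have "\<sim> a \<sqsubseteq> b" using ab c by (simp add: mv_le_def)
  then have b: "\<sim> a \<oplus> f = b" using join_eq[of "\<sim> a" b] c by (simp add: f_def odot_comm)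
  then have bc': "b \<oplus> c = \<sim> a \<oplus> (f \<oplus> c)" using c f by (simp flip: plus_assoc)
  then have "(\<sim> a \<oplus> (f \<oplus> c)) \<odot> \<sim> (\<sim> a) = f \<oplus> c"
    using bc c f no_carry[of "\<sim> a" "f \<oplus> c"] by (intro plus_minus_cancel) auto
  then show "(a \<odot> b) \<oplus> c = a \<odot> (b \<oplus> c)" using bc' c f by (simp add: f_def odot_comm)
  show "(a \<odot> b) \<oplus> c \<noteq> mv_one A"
  proof
    assume "(a \<odot> b) \<oplus> c = mv_one A"
    then have "b \<oplus> c = mv_one A" using bc' c f by (simp add: f_def)
    then show False using bc by simp
  qed
qed

abbreviation G :: "(int \<times> 'a) monoid" where "G \<equiv> chain_group A"
abbreviation emb :: "'a \<Rightarrow> int \<times> 'a" where "emb \<equiv> chain_emb A"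

lemma group_simps:
  "x \<in> carrier G \<longleftrightarrow> snd x \<in> carrier A \<and> snd x \<noteq> mv_one A"
  "one G = (0, \<zero>)"
  "mult G (m, a) (n, b) = (if a \<oplus> b = mv_one A then (m + n + 1, a \<odot> b) else (m + n, a \<oplus> b))"
  by (cases x; simp add: chain_group_def)+

lemma odot_ne_one:
  assumes "a \<in> carrier A" "b \<in> carrier A" "a \<noteq> mv_one A"
  shows "a \<odot> b \<noteq> mv_one A"
proof
  assume "a \<odot> b = mv_one A"
  then have "mv_one A \<sqsubseteq> a" using minus_le[of a b] assms by simp
  then show False using assms le_antisym[of a "mv_one A"] by simp
qed

lemma mult_comm: "\<lbrakk>x \<in> carrier G; y \<in> carrier G\<rbrakk> \<Longrightarrow> x \<otimes>\<^bsub>G\<^esub> y = y \<otimes>\<^bsub>G\<^esub> x"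
  by (cases x; cases y) (simp add: group_simps plus_comm odot_comm)

lemma mult_in: "\<lbrakk>x \<in> carrier G; y \<in> carrier G\<rbrakk> \<Longrightarrow> x \<otimes>\<^bsub>G\<^esub> y \<in> carrier G"
  by (cases x; cases y) (simp add: group_simps odot_ne_one)

lemma mult_assoc_carry:
  assumes "a \<oplus> b = mv_one A" "a \<in> carrier A" "b \<in> carrier A" "c \<in> carrier A"
  shows "(m, a) \<otimes>\<^bsub>G\<^esub> (n, b) \<otimes>\<^bsub>G\<^esub> (k, c) = (m, a) \<otimes>\<^bsub>G\<^esub> ((n, b) \<otimes>\<^bsub>G\<^esub> (k, c))"
proof (cases "b \<oplus> c = mv_one A")
  case True
  then show ?thesis using assms plus_odot_assoc[of a b c] by (simp add: group_simps odot_assoc)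
next
  case False
  then have "a \<oplus> (b \<oplus> c) = mv_one A" using assms by (simp flip: plus_assoc)
  then show ?thesis using assms False plus_odot_assoc2[of a b c] by (simp add: group_simps)
qed

lemma mult_assoc:
  assumes "x \<in> carrier G" "y \<in> carrier G" "z \<in> carrier G"
  shows "x \<otimes>\<^bsub>G\<^esub> y \<otimes>\<^bsub>G\<^esub> z = x \<otimes>\<^bsub>G\<^esub> (y \<otimes>\<^bsub>G\<^esub> z)"
proof -
  obtain m a n b k c where [simp]: "x = (m, a)" "y = (n, b)" "z = (k, c)"
    by (cases x; cases y; cases z)
  have c: "a \<in> carrier A" "b \<in> carrier A" "c \<in> carrier A" using assms by (auto simp: group_simps)
  consider "a \<oplus> b = mv_one A" | "c \<oplus> b = mv_one A" | "a \<oplus> b \<noteq> mv_one A" "b \<oplus> c \<noteq> mv_one A"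
    using plus_comm c by metis
  then show ?thesis
  proof cases
    case 1
    then show ?thesis using mult_assoc_carry c by simp
  next
    case 2
    \<comment> \<open>A carry in the right-hand pair is the first case read backwards, by
      commutativity.\<close>
    then have "z \<otimes>\<^bsub>G\<^esub> y \<otimes>\<^bsub>G\<^esub> x = z \<otimes>\<^bsub>G\<^esub> (y \<otimes>\<^bsub>G\<^esub> x)" using mult_assoc_carry c by simp
    then show ?thesis using assms mult_comm mult_in by metis
  next
    case 3
    then show ?thesis using c no_carry odot_plus_assoc[of a b c] by (simp add: group_simps plus_assoc)
  qed
qed

lemma comm_group: "comm_group G"
proof (rule comm_groupI)
  fix x assume x: "x \<in> carrier G"
  obtain m a where [simp]: "x = (m, a)" by (cases x)
  have a: "a \<in> carrier A" "a \<noteq> mv_one A" using x by (auto simp: group_simps)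
  show "\<exists>y\<in>carrier G. y \<otimes>\<^bsub>G\<^esub> x = \<one>\<^bsub>G\<^esub>"
  proof (cases "a = \<zero>")
    case True
    then show ?thesis using nontrivial by (intro bexI[of _ "(- m, \<zero>)"]) (simp_all add: group_simps)
  next
    case False
    then have "\<sim> a \<noteq> mv_one A" using a by (metis neg_neg neg_one)
    \<comment> \<open>The fractional parts \<open>a\<close> and \<open>\<sim> a\<close> add up to 1,
      and this carry must be compensated by the extra -1.\<close>
    then show ?thesis using a
      by (intro bexI[of _ "(- m - 1, \<sim> a)"]) (simp_all add: group_simps odot_comm)
  qed
next
  show "\<one>\<^bsub>G\<^esub> \<in> carrier G" using nontrivial by (simp add: group_simps)
  show "\<one>\<^bsub>G\<^esub> \<otimes>\<^bsub>G\<^esub> x = x" if "x \<in> carrier G" for x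
    using that by (cases x) (simp add: group_simps)
qed (rule mult_in mult_comm mult_assoc; assumption)+

sublocale comm_group G by (rule comm_group)

lemma emb_in [simp]: "a \<in> carrier A \<Longrightarrow> emb a \<in> carrier G"
  using nontrivial by (simp add: chain_emb_def group_simps)

lemma emb_one: "emb (mv_one A) = (1, \<zero>)"
  by (simp add: chain_emb_def)

lemma emb_zero: "emb \<zero> = \<one>\<^bsub>G\<^esub>"
  using nontrivial by (simp add: chain_emb_def group_simps)

text \<open>Integer parts add up to a carry, as floors do. Hence non-negative integer part is
  preserved by products, and one of an element and its inverse always has it.\<close>

lemma fst_mult:
  "fst (x \<otimes>\<^bsub>G\<^esub> y) \<in> {fst x + fst y, fst x + fst y + 1}"
  by (cases x; cases y) (simp add: group_simps)

lemma fst_emb: "0 \<le> fst (emb a)"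
  by (simp add: chain_emb_def)

lemma emb_plus_carry:
  assumes "a \<in> carrier A" "b \<in> carrier A" "a \<oplus> b = mv_one A"
  shows "1 \<le> fst (emb a \<otimes>\<^bsub>G\<^esub> emb b)"
  using assms nontrivial by (auto simp: chain_emb_def group_simps)

lemma emb_plus:
  assumes "a \<in> carrier A" "b \<in> carrier A" "a \<oplus> b \<noteq> mv_one A"
  shows "emb (a \<oplus> b) = emb a \<otimes>\<^bsub>G\<^esub> emb b"
  using assms by (auto simp: chain_emb_def group_simps)

lemma emb_neg:
  assumes "a \<in> carrier A"
  shows "emb a \<otimes>\<^bsub>G\<^esub> emb (\<sim> a) = emb (mv_one A)"
proof (cases "a = mv_one A \<or> a = \<zero>")
  case True
  then show ?thesis using nontrivial by (auto simp: chain_emb_def group_simps)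
next
  case False
  then have "\<sim> a \<noteq> mv_one A" using assms by (metis neg_neg neg_one)
  then show ?thesis using False assms by (simp add: chain_emb_def group_simps)
qed

end

section \<open>Real values with the same signs as finitely many group elements\<close>

lemma finite_bounded_vectors:
  assumes "finite V"
  shows "finite {v :: 'v \<Rightarrow> int. (\<forall>i. i \<in> V \<longrightarrow> v i \<in> {-N..N}) \<and> (\<forall>i. i \<notin> V \<longrightarrow> v i = 0)}"
  using finite_set_of_finite_funs[OF assms, of "{-N..N}" 0]
  by (rule finite_subset[rotated]) auto

definition unit_vec :: "'v \<Rightarrow> 'v \<Rightarrow> int"
  where "unit_vec a = (\<lambda>i. if i = a then 1 else 0)"

lemma dot_unit_vec: "\<lbrakk>finite V; a \<in> V\<rbrakk> \<Longrightarrow> dot V (unit_vec a) q = q a"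
proof -
  assume "finite V" "a \<in> V"
  moreover have "dot V (unit_vec a) q = (\<Sum>i\<in>V. if i = a then q i else 0)"
    unfolding dot_def unit_vec_def by (intro sum.cong) auto
  ultimately show ?thesis by simp
qed

context nontrivial_chain
begin

text \<open>An integer vector on \<open>V\<close> is a formal combination of elements of the chain,
  evaluated here in the multiplicatively written \<open>G\<close>.\<close>

definition eval_vec :: "'a set \<Rightarrow> ('a \<Rightarrow> int) \<Rightarrow> int \<times> 'a"
  where "eval_vec V v = (\<Otimes>\<^bsub>G\<^esub>a\<in>V. emb a [^]\<^bsub>G\<^esub> v a)"

lemma fst_inv: "x \<in> carrier G \<Longrightarrow> fst (inv\<^bsub>G\<^esub> x) \<in> {- fst x, - fst x - 1}"
  using fst_mult[of x "inv\<^bsub>G\<^esub> x"] by (auto simp: group_simps)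

lemma fst_one: "fst \<one>\<^bsub>G\<^esub> = 0"
  by (simp add: group_simps)

lemma inv_emb_one: "inv\<^bsub>G\<^esub> (emb (mv_one A)) = (-1, \<zero>)"
  using nontrivial by (intro inv_equality) (simp_all add: emb_one group_simps)

text \<open>The product of the two elements has integer part 0. A carry would make it at least 1, so
  both integer parts vanish, and the fractional parts have sum zero.\<close>

lemma cone_antisym:
  assumes x: "x \<in> carrier G" and "0 \<le> fst x" "0 \<le> fst (inv\<^bsub>G\<^esub> x)"
  shows "x = \<one>\<^bsub>G\<^esub>"
proof -
  obtain m a n b where xy: "x = (m, a)" "inv\<^bsub>G\<^esub> x = (n, b)" by (cases x; cases "inv\<^bsub>G\<^esub> x")
  have c: "a \<in> carrier A" "b \<in> carrier A"
    using x inv_closed[OF x] xy by (simp_all add: group_simps)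
  have mn: "0 \<le> m" "0 \<le> n" using assms(2,3) unfolding xy(2) unfolding xy(1) by simp_all
  have "(m, a) \<otimes>\<^bsub>G\<^esub> (n, b) = (0, \<zero>)" using r_inv[OF x] unfolding xy(2) unfolding xy(1)
    by (simp add: group_simps(2))
  then have "m = 0" "a \<oplus> b = \<zero>" using mn nontrivial
    by (auto simp: group_simps split: if_splits)
  moreover from this have "a = \<zero>" using c le_plusI[of a b] by (simp add: le_zero_iff)
  ultimately show ?thesis by (simp add: xy group_simps)
qed

lemma emb_inject:
  assumes "a \<in> carrier A" "b \<in> carrier A" "emb a = emb b"
  shows "a = b"
  using assms by (auto simp: chain_emb_def split: if_splits)

text \<open>If the sum is the top, a carry does occur, but orthogonality makes the remaining
  fractional part zero, as in the image of the top.\<close>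

lemma emb_plus_orthogonal:
  assumes "a \<in> carrier A" "b \<in> carrier A" "a \<odot> b = \<zero>"
  shows "emb (a \<oplus> b) = emb a \<otimes>\<^bsub>G\<^esub> emb b"
proof (cases "a \<oplus> b = mv_one A")
  case True
  then show ?thesis using assms nontrivial by (auto simp: chain_emb_def group_simps)
qed (simp add: emb_plus assms)

context
  fixes V assumes V: "finite V" "V \<subseteq> carrier A"
begin

lemma eval_vec_in [simp]: "eval_vec V v \<in> carrier G"
  unfolding eval_vec_def using V by (intro finprod_closed) auto

lemma eval_vec_add: "eval_vec V (\<lambda>i. v i + w i) = eval_vec V v \<otimes>\<^bsub>G\<^esub> eval_vec V w"
proof -
  have "eval_vec V (\<lambda>i. v i + w i) = (\<Otimes>\<^bsub>G\<^esub>a\<in>V. emb a [^]\<^bsub>G\<^esub> v a \<otimes>\<^bsub>G\<^esub> emb a [^]\<^bsub>G\<^esub> w a)"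
    unfolding eval_vec_def using V by (intro finprod_cong) (auto simp: int_pow_mult simp_implies_def)
  also have "\<dots> = eval_vec V v \<otimes>\<^bsub>G\<^esub> eval_vec V w"
    unfolding eval_vec_def using V by (intro finprod_multf) auto
  finally show ?thesis .
qed

lemma eval_vec_zero: "eval_vec V (\<lambda>i. 0) = \<one>\<^bsub>G\<^esub>"
  unfolding eval_vec_def by simp

lemma eval_vec_uminus: "eval_vec V (\<lambda>i. - v i) = inv\<^bsub>G\<^esub> (eval_vec V v)"
  using eval_vec_add[of "\<lambda>i. - v i" v] by (intro inv_equality[symmetric]) (simp_all add: eval_vec_zero)

lemma eval_vec_diff: "eval_vec V (\<lambda>i. v i - w i) = eval_vec V v \<otimes>\<^bsub>G\<^esub> inv\<^bsub>G\<^esub> (eval_vec V w)"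
  using eval_vec_add[of v "\<lambda>i. - w i"] by (simp add: eval_vec_uminus)

lemma eval_vec_scale: "eval_vec V (\<lambda>i. int n * v i) = eval_vec V v [^]\<^bsub>G\<^esub> n"
proof (induction n)
  case (Suc n)
  then show ?case using eval_vec_add[of "\<lambda>i. int n * v i" v] by (simp add: algebra_simps)
qed (simp add: eval_vec_zero)

lemma eval_vec_unit: "a \<in> V \<Longrightarrow> eval_vec V (unit_vec a) = emb a"
proof -
  assume a: "a \<in> V"
  have "eval_vec V (unit_vec a) = (\<Otimes>\<^bsub>G\<^esub>i\<in>V. if a = i then emb i else \<one>\<^bsub>G\<^esub>)"
    unfolding eval_vec_def unit_vec_def using V by (intro finprod_cong) (auto simp: simp_implies_def)
  also have "\<dots> = emb a" using V a by (intro finprod_singleton) auto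
  finally show ?thesis .
qed

lemma total_cone: "total_cone {v. 0 \<le> fst (eval_vec V v)}"
proof
  fix v w assume "v \<in> {v. 0 \<le> fst (eval_vec V v)}" "w \<in> {v. 0 \<le> fst (eval_vec V v)}"
  then show "(\<lambda>i. v i + w i) \<in> {v. 0 \<le> fst (eval_vec V v)}"
    using fst_mult[of "eval_vec V v" "eval_vec V w"] by (auto simp: eval_vec_add)
next
  fix v show "v \<in> {v. 0 \<le> fst (eval_vec V v)} \<or> (\<lambda>i. - v i) \<in> {v. 0 \<le> fst (eval_vec V v)}"
    using fst_inv[of "eval_vec V v"] by (auto simp: eval_vec_uminus)
qed

text \<open>The signs of all vectors with entries bounded by \<open>N\<close> are realised at once.
  The negated top has integer part -1 and lies outside the cone, so the value of the top is
  positive; dividing by it normalises without changing signs.\<close>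

lemma real_valuation:
  assumes one: "mv_one A \<in> V" and N: "1 \<le> N"
  shows "\<exists>q. q (mv_one A) = 1 \<and> (\<forall>v. (\<forall>i\<in>V. \<bar>v i\<bar> \<le> N) \<longrightarrow> (\<forall>i. i \<notin> V \<longrightarrow> v i = 0) \<longrightarrow>
    (0 \<le> fst (eval_vec V v) \<longleftrightarrow> 0 \<le> dot V v q))"
proof -
  let ?P = "{v. (\<forall>i. i \<in> V \<longrightarrow> v i \<in> {-N..N}) \<and> (\<forall>i. i \<notin> V \<longrightarrow> v i = 0)}"
  have "\<exists>q. \<forall>v\<in>?P. v \<in> {v. 0 \<le> fst (eval_vec V v)} \<longleftrightarrow> 0 \<le> dot V v q"
    by (rule total_cone.sign_realization[OF total_cone V(1) finite_bounded_vectors[OF V(1)]]) auto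
  then obtain q where q: "\<And>v. v \<in> ?P \<Longrightarrow> 0 \<le> fst (eval_vec V v) \<longleftrightarrow> 0 \<le> dot V v q" by blast
  let ?e = "unit_vec (mv_one A)"
  have "fst (eval_vec V (\<lambda>i. - ?e i)) < 0"
    by (simp add: eval_vec_uminus eval_vec_unit one inv_emb_one)
  moreover have "0 \<le> fst (eval_vec V (\<lambda>i. - ?e i)) \<longleftrightarrow> 0 \<le> dot V (\<lambda>i. - ?e i) q"
    using one N by (intro q) (auto simp: unit_vec_def)
  ultimately have "dot V (\<lambda>i. - ?e i) q < 0" by simp
  then have pos: "0 < q (mv_one A)" using V one by (simp add: dot_uminus dot_unit_vec)
  let ?q = "\<lambda>a. q a / q (mv_one A)"
  have "dot V v ?q = dot V v q / q (mv_one A)" for v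
    by (simp add: dot_def sum_divide_distrib)
  then have "0 \<le> dot V v ?q \<longleftrightarrow> 0 \<le> dot V v q" for v
    using pos by (simp add: zero_le_divide_iff)
  moreover have "0 \<le> fst (eval_vec V v) \<longleftrightarrow> 0 \<le> dot V v q"
    if "\<forall>i\<in>V. \<bar>v i\<bar> \<le> N" "\<forall>i. i \<notin> V \<longrightarrow> v i = 0" for v
    using that by (intro q) (auto simp: abs_le_iff minus_le_iff)
  ultimately show ?thesis using pos by (intro exI[of _ ?q]) simp
qed

end

text \<open>The valuation is built on \<open>W\<close>, which adds zero and the top to
  \<open>V\<close> so that it can be normalised there. \<open>R\<close> encodes scalar multiples:
  \<open>G\<close> carries no scalars, but that \<open>b\<close> is k/n times \<open>a\<close> can
  be stated as an equation between powers.\<close>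

lemma partial_embedding:
  assumes fin: "finite V" "V \<subseteq> carrier A" "finite R"
    and R: "\<And>n k a b. (n, k, a, b) \<in> R \<Longrightarrow> a \<in> V \<and> b \<in> V \<and> emb b [^]\<^bsub>G\<^esub> n = emb a [^]\<^bsub>G\<^esub> (k :: nat)"
  shows "\<exists>p :: 'a \<Rightarrow> real. p \<zero> = 0 \<and> inj_on p V \<and> (\<forall>a\<in>V. 0 \<le> p a \<and> p a \<le> 1) \<and>
    (\<forall>a\<in>V. \<sim> a \<in> V \<longrightarrow> p (\<sim> a) = 1 - p a) \<and>
    (\<forall>a\<in>V. \<forall>b\<in>V. a \<oplus> b \<in> V \<longrightarrow> p (a \<oplus> b) = min 1 (p a + p b)) \<and>
    (\<forall>(n, k, a, b)\<in>R. real n * p b = real k * p a)"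
proof -
  define W where "W = insert \<zero> (insert (mv_one A) V)"
  have W: "finite W" "W \<subseteq> carrier A" and W01: "mv_one A \<in> W" "\<zero> \<in> W" and VW: "V \<subseteq> W"
    using fin by (auto simp: W_def)
  \<comment> \<open>The conditions for \<oplus> and \<sim> combine three unit vectors, whence 3;
    those from \<open>R\<close> have coefficients \<open>n\<close> and \<open>- k\<close>.\<close>
  define N where "N = Max (insert 3 ((\<lambda>(n, k, _, _). int n + int k) ` R))"
  have N3: "3 \<le> N" unfolding N_def using fin by (intro Max_ge) auto
  have NR: "int n + int k \<le> N" if "(n, k, a, b) \<in> R" for n k a b
    unfolding N_def using fin that by (intro Max_ge) force+
  note ev = eval_vec_add[OF W] eval_vec_uminus[OF W] eval_vec_diff[OF W] eval_vec_scale[OF W]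
    eval_vec_unit[OF W]
  obtain p where p1: "p (mv_one A) = 1" and p: "\<And>v. \<lbrakk>\<And>i. i \<in> W \<Longrightarrow> \<bar>v i\<bar> \<le> N; \<And>i. i \<notin> W \<Longrightarrow> v i = 0\<rbrakk>
      \<Longrightarrow> 0 \<le> fst (eval_vec W v) \<longleftrightarrow> 0 \<le> dot W v p"
    using real_valuation[OF W W01(1), of N] N3 by auto
  \<comment> \<open>A vector of trivial value lies in the cone together with its negative, so both
    signs hold for the real value.\<close>
  have eq: "dot W v p = 0"
    if "eval_vec W v = \<one>\<^bsub>G\<^esub>" "\<And>i. i \<in> W \<Longrightarrow> \<bar>v i\<bar> \<le> N" "\<And>i. i \<notin> W \<Longrightarrow> v i = 0" for v
    using p[of v] p[of "\<lambda>i. - v i"] that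
    by (simp add: ev dot_uminus fst_one)
  note dots = dot_unit_vec[OF W(1)]
  have dot2: "dot W (\<lambda>i. unit_vec a i - unit_vec b i) p = p a - p b" if "a \<in> W" "b \<in> W" for a b
    using dot_lincomb[of W 1 "unit_vec a" "-1" "unit_vec b" p] that by (simp add: dots)
  have dot3: "dot W (\<lambda>i. unit_vec a i + unit_vec b i - unit_vec c i) p = p a + p b - p c"
    if "a \<in> W" "b \<in> W" "c \<in> W" for a b c
    using dot_lincomb[of W 1 "\<lambda>i. unit_vec a i + unit_vec b i" "-1" "unit_vec c" p]
      dot_lincomb[of W 1 "unit_vec a" 1 "unit_vec b" p] that by (simp add: dots)
  have C: "a \<in> carrier A" if "a \<in> W" for a using W that by blast
  have p0: "p \<zero> = 0"
  proof -
    have "dot W (unit_vec \<zero>) p = 0"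
      using W01 N3 by (intro eq) (simp add: ev emb_zero, auto simp: unit_vec_def)
    then show ?thesis using W01 by (simp add: dots)
  qed
  have ge0: "0 \<le> p a" if "a \<in> W" for a
  proof -
    have "0 \<le> fst (eval_vec W (unit_vec a)) \<longleftrightarrow> 0 \<le> dot W (unit_vec a) p"
      using that N3 by (intro p) (auto simp: unit_vec_def)
    then show ?thesis using that fst_emb[of a] by (simp add: ev dots)
  qed
  have neg: "p (\<sim> a) = 1 - p a" if "a \<in> W" "\<sim> a \<in> W" for a
  proof -
    have "dot W (\<lambda>i. unit_vec a i + unit_vec (\<sim> a) i - unit_vec (mv_one A) i) p = 0"
      using that N3 W01 C emb_neg[of a] by (intro eq) (simp add: ev, auto simp: unit_vec_def)
    then show ?thesis using that W01 by (simp add: dot3 p1)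
  qed
  have le1: "p a \<le> 1" if "a \<in> W" for a
  proof -
    have "emb (mv_one A) \<otimes>\<^bsub>G\<^esub> inv\<^bsub>G\<^esub> (emb a) = emb (\<sim> a)"
      using emb_neg[of a] C[OF that] m_comm[of "emb a" "emb (\<sim> a)"]
      by (metis emb_in inv_solve_right' one_in neg_in)
    then have "0 \<le> fst (eval_vec W (\<lambda>i. unit_vec (mv_one A) i - unit_vec a i))"
      using that W01 fst_emb by (simp add: ev)
    moreover have "0 \<le> fst (eval_vec W (\<lambda>i. unit_vec (mv_one A) i - unit_vec a i))
        \<longleftrightarrow> 0 \<le> dot W (\<lambda>i. unit_vec (mv_one A) i - unit_vec a i) p"
      using that W01 N3 by (intro p) (auto simp: unit_vec_def)
    ultimately show ?thesis using that W01 by (simp add: dot2 p1)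
  qed
  have plus: "p (a \<oplus> b) = min 1 (p a + p b)" if ab: "a \<in> W" "b \<in> W" "a \<oplus> b \<in> W" for a b
  proof (cases "a \<oplus> b = mv_one A")
    case True
    \<comment> \<open>When the sum is the top, only \<open>p a + p b \<ge> 1\<close> is required, so
      an inequality is transferred instead of an equation.\<close>
    let ?v = "\<lambda>i. unit_vec a i + unit_vec b i - unit_vec (mv_one A) i"
    have "0 \<le> fst (eval_vec W ?v)"
      using ab W01 C emb_plus_carry[OF _ _ True] fst_mult[of "emb a \<otimes>\<^bsub>G\<^esub> emb b" "inv\<^bsub>G\<^esub> (emb (mv_one A))"]
      by (auto simp: ev inv_emb_one)
    moreover have "0 \<le> fst (eval_vec W ?v) \<longleftrightarrow> 0 \<le> dot W ?v p"
      using ab W01 N3 by (intro p) (auto simp: unit_vec_def)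
    ultimately have "0 \<le> dot W ?v p" by simp
    then show ?thesis using ab W01 by (simp add: dot3 p1 True)
  next
    case False
    have "dot W (\<lambda>i. unit_vec a i + unit_vec b i - unit_vec (a \<oplus> b) i) p = 0"
      using ab N3 C emb_plus[OF _ _ False] by (intro eq) (simp add: ev, auto simp: unit_vec_def)
    then show ?thesis using ab le1[OF ab(3)] by (simp add: dot3)
  qed
  \<comment> \<open>Equal real values put the difference vector and its negative into the cone, and
    only the unit of \<open>G\<close> is non-negative in both directions.\<close>
  have inj: "inj_on p V"
  proof
    fix a b assume ab: "a \<in> V" "b \<in> V" "p a = p b"
    then have abW: "a \<in> W" "b \<in> W" using VW by auto
    let ?x = "emb a \<otimes>\<^bsub>G\<^esub> inv\<^bsub>G\<^esub> (emb b)"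
    define v where "v = (\<lambda>i. unit_vec a i - unit_vec b i)"
    have "0 \<le> fst (eval_vec W v) \<longleftrightarrow> 0 \<le> dot W v p"
      "0 \<le> fst (eval_vec W (\<lambda>i. - v i)) \<longleftrightarrow> 0 \<le> dot W (\<lambda>i. - v i) p"
      using abW N3 by (auto intro!: p simp: v_def unit_vec_def)
    moreover have "dot W v p = 0" using ab abW by (simp add: v_def dot2)
    moreover have "eval_vec W v = ?x" using abW by (simp add: v_def ev)
    ultimately have "?x = \<one>\<^bsub>G\<^esub>"
      using abW C by (intro cone_antisym) (simp_all add: dot_uminus ev(2))
    then have "emb a = emb b" using abW C by (metis emb_in inv_equality inv_inv inv_closed)
    then show "a = b" using abW C emb_inject by blast
  qed
  have rel: "real n * p b = real k * p a" if r: "(n, k, a, b) \<in> R" for n k a b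
  proof -
    have ab: "a \<in> W" "b \<in> W" "emb b [^]\<^bsub>G\<^esub> n = emb a [^]\<^bsub>G\<^esub> k" using R[OF r] VW by auto
    have "dot W (\<lambda>i. int n * unit_vec b i - int k * unit_vec a i) p = 0"
      using ab NR[OF r] C by (intro eq) (simp add: ev, auto simp: unit_vec_def)
    then show ?thesis using dot_lincomb[of W "int n" "unit_vec b" "- int k" "unit_vec a" p] ab
      by (simp add: dots)
  qed
  show ?thesis
    by (rule exI[of _ p]) (use p0 inj ge0 le1 neg plus rel VW in \<open>simp add: subset_iff split_beta\<close>)
qed

end

section \<open>Completeness of the unit interval\<close>

locale rational_chain = nontrivial_chain A + scalar_mv_algebra "dmv_scalars" A
  for A :: "('a, 'm) mv_alg_scheme" (structure)
begin

lemmas scal_in [simp] = scal_closed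

lemma scal_zero: "x \<in> carrier A \<Longrightarrow> 0 \<cdot> x = \<zero>"
  using scal_diff[of 1 1 x] scal_one[of x] by simp

text \<open>The difference axiom exhibits \<open>r \<cdot> a\<close> as
  \<open>(r + q) \<cdot> a\<close> minus \<open>q \<cdot> a\<close>. The two parts are therefore
  orthogonal, and their sum passes to \<open>G\<close> without truncation.\<close>

lemma emb_scal_add:
  assumes r: "r \<in> dmv_scalars" "q \<in> dmv_scalars" "r + q \<le> 1" and a: "a \<in> carrier A"
  shows "emb ((r + q) \<cdot> a) = emb (r \<cdot> a) \<otimes>\<^bsub>G\<^esub> emb (q \<cdot> a)"
proof -
  have rq: "r + q \<in> dmv_scalars" using r by auto
  have c: "r \<cdot> a \<in> carrier A" "q \<cdot> a \<in> carrier A" "(r + q) \<cdot> a \<in> carrier A"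
    using r rq a by (auto intro!: scal_in)
  have x: "r \<cdot> a = ((r + q) \<cdot> a) \<odot> \<sim> (q \<cdot> a)"
    using scal_diff[OF rq r(2) a] r(1) by simp
  have "(q \<cdot> a) \<odot> \<sim> ((r + q) \<cdot> a) = \<zero>"
    using scal_diff[OF r(2) rq a] r(1) a by (simp add: scal_zero)
  then have "(q \<cdot> a) \<oplus> (r \<cdot> a) = (r + q) \<cdot> a"
    unfolding x using c by (intro join_eq) (simp_all add: le_iff_minus)
  moreover have "(r \<cdot> a) \<odot> (q \<cdot> a) = \<zero>"
    unfolding x using c odot_comm[of "\<sim> (q \<cdot> a)" "q \<cdot> a"] by (simp add: odot_assoc)
  ultimately show ?thesis using c emb_plus_orthogonal[of "r \<cdot> a" "q \<cdot> a"] by (simp add: plus_comm)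
qed

text \<open>With \<open>?y\<close> the image of a/n, the image of (j/n) a is the power
  \<open>j\<close> of \<open>?y\<close>. Both sides are then the same power, with exponent k
  n.\<close>

lemma emb_scal:
  assumes "k \<le> n" "0 < n" and a: "a \<in> carrier A"
  shows "emb ((real k / real n) \<cdot> a) [^]\<^bsub>G\<^esub> n = emb a [^]\<^bsub>G\<^esub> k"
proof -
  have frac: "real j / real n \<in> dmv_scalars" if "j \<le> n" for j
    using that \<open>0 < n\<close> by (auto intro: Rats_divide)
  have frac1: "1 / real n \<in> dmv_scalars" using frac[of 1] \<open>0 < n\<close> by simp
  let ?y = "emb ((1 / real n) \<cdot> a)"
  have y: "?y \<in> carrier G" using frac1 a by (intro emb_in scal_in)
  have mult: "emb ((real j / real n) \<cdot> a) = ?y [^]\<^bsub>G\<^esub> j" if "j \<le> n" for j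
    using that
  proof (induction j)
    case 0
    then show ?case using a by (simp add: scal_zero emb_zero)
  next
    case (Suc j)
    have "real j / real n + 1 / real n \<le> 1" using Suc \<open>0 < n\<close> by (simp add: field_simps)
    moreover have "real (Suc j) / real n = real j / real n + 1 / real n"
      by (simp add: add_divide_distrib)
    ultimately show ?case
      using emb_scal_add[OF frac[of j] frac1 _ a] Suc \<open>0 < n\<close> by (simp del: of_nat_Suc)
  qed
  have "emb a = ?y [^]\<^bsub>G\<^esub> n" using mult[of n] scal_one a \<open>0 < n\<close> by simp
  then show ?thesis using mult[OF \<open>k \<le> n\<close>] y by (simp add: nat_pow_pow mult.commute)
qed

text \<open>The fraction is chosen once for \<open>r\<close>, uniformly in \<open>a\<close>, so that
  one pair \<open>n\<close>, \<open>k\<close> serves all occurrences of the scalar in a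
  term.\<close>

lemma emb_scal_rational:
  assumes "r \<in> dmv_scalars"
  shows "\<exists>n k. 0 < n \<and> r = real k / real n \<and>
    (\<forall>a\<in>carrier A. emb (r \<cdot> a) [^]\<^bsub>G\<^esub> n = emb a [^]\<^bsub>G\<^esub> k)"
proof -
  have r: "0 \<le> r" "r \<le> 1" "r \<in> \<rat>" using assms by auto
  then obtain k n where kn: "n \<noteq> 0" "r = real k / real n"
    by (metis Rats_abs_nat_div_natE abs_of_nonneg)
  have "real k / real n \<le> 1" using r kn(2) by simp
  then have "k \<le> n" using kn(1) by (simp add: divide_le_eq)
  then show ?thesis using kn emb_scal[of k n] by blast
qed

end

section \<open>The standard algebra on the unit interval\<close>

definition unit_alg :: "real mv_alg"
  where "unit_alg = \<lparr>carrier = {0..1}, mv_plus = (\<lambda>x y. min 1 (x + y)), mv_neg = (\<lambda>x. 1 - x),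
    mv_zero = 0, mv_scal = (*)\<rparr>"

lemma unit_alg_simps [simp]:
  "carrier unit_alg = {0..1}"
  "x \<oplus>\<^bsub>unit_alg\<^esub> y = min 1 (x + y)"
  "\<sim>\<^bsub>unit_alg\<^esub> x = 1 - x"
  "\<zero>\<^bsub>unit_alg\<^esub> = 0"
  "r \<cdot>\<^bsub>unit_alg\<^esub> x = r * x"
  "mv_one unit_alg = 1"
  by (simp_all add: unit_alg_def mv_one_def)

lemma unit_alg_odot [simp]: "x \<odot>\<^bsub>unit_alg\<^esub> y = max 0 (x + y - 1)"
  by (simp add: mv_odot_def)

lemma unit_alg_algebra:
  assumes "S \<subseteq> {0..1}"
  shows "scalar_mv_algebra S unit_alg"
proof
  fix r x y assume r: "r \<in> S" and xy: "x \<in> carrier unit_alg" "y \<in> carrier unit_alg"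
  have "0 \<le> r" using r assms by auto
  then have "r * max 0 (x - y) = max 0 (r * x - r * y)"
    by (simp add: max_mult_distrib_left right_diff_distrib)
  then show "r \<cdot>\<^bsub>unit_alg\<^esub> (x \<odot>\<^bsub>unit_alg\<^esub> \<sim>\<^bsub>unit_alg\<^esub> y) =
      (r \<cdot>\<^bsub>unit_alg\<^esub> x) \<odot>\<^bsub>unit_alg\<^esub> \<sim>\<^bsub>unit_alg\<^esub> (r \<cdot>\<^bsub>unit_alg\<^esub> y)"
    by simp
next
  fix r q x assume "r \<in> S" "q \<in> S" and x: "x \<in> carrier unit_alg"
  then have "max 0 (r - q) * x = max 0 (r * x - q * x)"
    by (simp add: max_mult_distrib_right left_diff_distrib)
  then show "max 0 (r - q) \<cdot>\<^bsub>unit_alg\<^esub> x =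
      (r \<cdot>\<^bsub>unit_alg\<^esub> x) \<odot>\<^bsub>unit_alg\<^esub> \<sim>\<^bsub>unit_alg\<^esub> (q \<cdot>\<^bsub>unit_alg\<^esub> x)"
    by simp
next
  fix r x assume "r \<in> S" "x \<in> carrier unit_alg"
  then have "0 \<le> r" "r \<le> 1" "0 \<le> x" "x \<le> 1" using assms by auto
  then show "r \<cdot>\<^bsub>unit_alg\<^esub> x \<in> carrier unit_alg"
    by (simp add: mult_le_one)
qed auto

section \<open>Separating two terms through the values of their subterms\<close>

primrec subs :: "'x mv_term \<Rightarrow> 'x mv_term set"
  where
    "subs (Var x) = {Var x}"
  | "subs Zero = {Zero}"
  | "subs (Neg t) = insert (Neg t) (subs t)"
  | "subs (Plus t u) = insert (Plus t u) (subs t \<union> subs u)"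
  | "subs (Scal r t) = insert (Scal r t) (subs t)"

lemma finite_subs [simp]: "finite (subs t)"
  by (induction t) auto

lemma subs_self [simp]: "t \<in> subs t"
  by (cases t) auto

lemma subs_closed:
  "Neg s \<in> subs t \<Longrightarrow> s \<in> subs t"
  "Plus s s' \<in> subs t \<Longrightarrow> s \<in> subs t \<and> s' \<in> subs t"
  "Scal r s \<in> subs t \<Longrightarrow> s \<in> subs t"
  by (induction t) auto

lemma subs_terms: "t \<in> terms S X \<Longrightarrow> s \<in> subs t \<Longrightarrow> s \<in> terms S X"
  by (induction t rule: terms.induct) (auto intro: terms.intros)

lemma terms_iff [simp]:
  "Var x \<in> terms S X \<longleftrightarrow> x \<in> X"
  "Zero \<in> terms S X"
  "Neg t \<in> terms S X \<longleftrightarrow> t \<in> terms S X"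
  "Plus t u \<in> terms S X \<longleftrightarrow> t \<in> terms S X \<and> u \<in> terms S X"
  "Scal r t \<in> terms S X \<longleftrightarrow> r \<in> S \<and> t \<in> terms S X"
  by (auto intro: terms.intros elim: terms.cases)

lemma (in scalar_set) hom_class:
  assumes h: "h \<in> mv_hom S (free_alg S X) A"
  shows "t \<in> terms S X \<Longrightarrow> h (term_class S X t) = eval_term A (\<lambda>x. h (free_gen S X x)) t"
proof (induction rule: terms.induct)
  case (Neg t)
  then have "h (mv_neg (free_alg S X) (term_class S X t)) = mv_neg A (h (term_class S X t))"
    using h class_in[of _ X] unfolding mv_hom_def by blast
  with Neg show ?case by (simp add: free_ops)
next
  case (Plus t u)
  then have "h (mv_plus (free_alg S X) (term_class S X t) (term_class S X u))
      = mv_plus A (h (term_class S X t)) (h (term_class S X u))"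
    using h class_in[of _ X] unfolding mv_hom_def by blast
  with Plus show ?case by (simp add: free_ops)
next
  case (Scal r t)
  then have "h (mv_scal (free_alg S X) r (term_class S X t)) = mv_scal A r (h (term_class S X t))"
    using h class_in[of _ X] unfolding mv_hom_def by blast
  with Scal show ?case by (simp add: free_ops)
qed (use h in \<open>auto simp: mv_hom_def free_ops free_gen_def\<close>)

text \<open>The partial embedding is applied to the values of all subterms. Since these are closed
  under taking arguments, evaluation in [0,1] at the transported variables agrees with the embedding
  on every subterm, and injectivity keeps the two terms apart.\<close>

lemma chain_terms_separated:
  assumes S: "S = {} \<or> S = dmv_scalars" and C: "scalar_mv_algebra S C" "nontrivial_chain C"
    and tu: "t \<in> terms S X" "u \<in> terms S X" and g: "g ` X \<subseteq> carrier C"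
    and ne: "eval_term C g t \<noteq> eval_term C g u"
  shows "\<exists>f. f ` X \<subseteq> {0..1} \<and> eval_term unit_alg f t \<noteq> eval_term unit_alg f u"
proof -
  interpret C: nontrivial_chain C by fact
  let ?ev = "eval_term C g" and ?T = "subs t \<union> subs u"
  have T: "s \<in> terms S X" if "s \<in> ?T" for s using that tu subs_terms by blast
  have evC: "?ev s \<in> carrier C" if "s \<in> ?T" for s
    using scalar_mv_algebra.eval_closed[OF C(1) g T[OF that]] .
  have "\<exists>n k. 0 < n \<and> r = real k / real n \<and>
      (\<forall>a\<in>carrier C. chain_emb C (r \<cdot>\<^bsub>C\<^esub> a) [^]\<^bsub>C.G\<^esub> n = chain_emb C a [^]\<^bsub>C.G\<^esub> (k :: nat))"
    if "r \<in> S" for r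
  proof -
    have S: "S = dmv_scalars" using S that by auto
    interpret D: scalar_mv_algebra dmv_scalars C using C(1) unfolding S .
    interpret rational_chain C by unfold_locales
    show ?thesis using emb_scal_rational that S by blast
  qed
  then obtain n k where nk: "\<And>r. r \<in> S \<Longrightarrow> 0 < n r \<and> r = real (k r) / real (n r) \<and>
      (\<forall>a\<in>carrier C. chain_emb C (r \<cdot>\<^bsub>C\<^esub> a) [^]\<^bsub>C.G\<^esub> n r = chain_emb C a [^]\<^bsub>C.G\<^esub> (k r :: nat))"
    by metis
  \<comment> \<open>A scalar subterm contributes the equation that its value taken
    \<open>n r\<close> times is its argument taken \<open>k r\<close> times; any other subterm gets
    a trivial entry with both multiplicities zero.\<close>
  define rel where "rel = (\<lambda>s. case s of Scal r w \<Rightarrow> (n r, k r, ?ev w, ?ev s) | _ \<Rightarrow> (0, 0, ?ev s, ?ev s))"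
  have "(\<exists>p :: 'a \<Rightarrow> real. p \<zero>\<^bsub>C\<^esub> = 0 \<and> inj_on p (?ev ` ?T) \<and> (\<forall>a\<in>?ev ` ?T. 0 \<le> p a \<and> p a \<le> 1) \<and>
    (\<forall>a\<in>?ev ` ?T. \<sim>\<^bsub>C\<^esub> a \<in> ?ev ` ?T \<longrightarrow> p (\<sim>\<^bsub>C\<^esub> a) = 1 - p a) \<and>
    (\<forall>a\<in>?ev ` ?T. \<forall>b\<in>?ev ` ?T. a \<oplus>\<^bsub>C\<^esub> b \<in> ?ev ` ?T \<longrightarrow> p (a \<oplus>\<^bsub>C\<^esub> b) = min 1 (p a + p b)) \<and>
    (\<forall>(n, k, a, b)\<in>rel ` ?T. real n * p b = real k * p a))"
  proof (rule C.partial_embedding)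
    fix n' k' a b assume "(n', k', a, b) \<in> rel ` ?T"
    then obtain s where s: "s \<in> ?T" "(n', k', a, b) = rel s" by blast
    then show "a \<in> ?ev ` ?T \<and> b \<in> ?ev ` ?T \<and>
        chain_emb C b [^]\<^bsub>C.G\<^esub> n' = chain_emb C a [^]\<^bsub>C.G\<^esub> k'"
    proof (cases s)
      case (Scal r w)
      then have "w \<in> ?T" using s subs_closed(3) by blast
      then have "?ev w \<in> ?ev ` ?T" "?ev s \<in> ?ev ` ?T" "?ev w \<in> carrier C" using s(1) evC by blast+
      then show ?thesis using s(2) Scal T[OF s(1)] nk[of r] by (simp add: rel_def)
    qed (use s(2) imageI[OF s(1), of ?ev] in \<open>simp_all add: rel_def\<close>)
  qed (use evC in auto)
  then obtain p :: "'a \<Rightarrow> real" where p0: "p \<zero>\<^bsub>C\<^esub> = 0" and inj: "inj_on p (?ev ` ?T)"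
    and p01': "\<forall>a\<in>?ev ` ?T. 0 \<le> p a \<and> p a \<le> 1"
    and pneg': "\<forall>a\<in>?ev ` ?T. \<sim>\<^bsub>C\<^esub> a \<in> ?ev ` ?T \<longrightarrow> p (\<sim>\<^bsub>C\<^esub> a) = 1 - p a"
    and pplus': "\<forall>a\<in>?ev ` ?T. \<forall>b\<in>?ev ` ?T. a \<oplus>\<^bsub>C\<^esub> b \<in> ?ev ` ?T \<longrightarrow> p (a \<oplus>\<^bsub>C\<^esub> b) = min 1 (p a + p b)"
    and prel': "\<forall>(n, k, a, b)\<in>rel ` ?T. real n * p b = real k * p a"
    by (elim exE conjE)
  note mem = imageI[of _ ?T ?ev]
  have p01: "0 \<le> p (?ev s) \<and> p (?ev s) \<le> 1" if "s \<in> ?T" for s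
    using bspec[OF p01' mem[OF that]] .
  have pneg: "p (?ev (Neg s)) = 1 - p (?ev s)" if "s \<in> ?T" "Neg s \<in> ?T" for s
    using bspec[OF pneg' mem[OF that(1)]] mem[OF that(2)] by simp
  have pplus: "p (?ev (Plus s s')) = min 1 (p (?ev s) + p (?ev s'))"
    if "s \<in> ?T" "s' \<in> ?T" "Plus s s' \<in> ?T" for s s'
    using bspec[OF bspec[OF pplus' mem[OF that(1)]] mem[OF that(2)]] mem[OF that(3)] by simp
  have prel: "real n * p b = real k * p a" if "(n, k, a, b) \<in> rel ` ?T" for n k a b
    using bspec[OF prel' that] by simp
  \<comment> \<open>The bounds on \<open>p\<close> concern values of subterms only, so a variable
    occurring in neither term gets the value 0.\<close>
  define f where "f = (\<lambda>x. if Var x \<in> ?T then p (g x) else 0)"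
  have eval: "eval_term unit_alg f s = p (?ev s)" if "s \<in> ?T" for s
    using that
  proof (induction s)
    case (Var x)
    then show ?case by (simp add: f_def)
  next
    case Zero
    then show ?case by (simp add: p0)
  next
    case (Neg s)
    then have "s \<in> ?T" using subs_closed(1) by blast
    then show ?case using Neg pneg[of s] by simp
  next
    case (Plus s s')
    then have "s \<in> ?T" "s' \<in> ?T" using subs_closed(2) by blast+
    then show ?case using Plus pplus[of s s'] by simp
  next
    case (Scal r s)
    then have s: "s \<in> ?T" using subs_closed(3) by blast
    have "rel (Scal r s) \<in> rel ` ?T" using Scal.prems by blast
    then have "real (n r) * p (?ev (Scal r s)) = real (k r) * p (?ev s)"
      by (intro prel) (simp add: rel_def)
    moreover have "r \<in> S" using T[OF Scal.prems] by simp
    then have n: "0 < n r" "r = real (k r) / real (n r)" using nk by blast+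
    then have "real (k r) = r * real (n r)" using nonzero_eq_divide_eq[of "real (n r)"] by simp
    ultimately have "real (n r) * p (?ev (Scal r s)) = real (n r) * (r * p (?ev s))"
      by (simp only: ac_simps)
    then have "p (?ev (Scal r s)) = r * p (?ev s)" using n(1) by simp
    then show ?case using Scal.IH[OF s] by simp
  qed
  have "f ` X \<subseteq> {0..1}" using p01[of "Var _"] by (auto simp: f_def)
  moreover have "p (?ev t) \<noteq> p (?ev u)" using inj ne by (auto dest: inj_onD)
  ultimately show ?thesis using eval[of t] eval[of u] by (intro exI[of _ f]) auto
qed

theorem completeness:
  assumes S: "S = {} \<or> S = dmv_scalars"
    and tu: "t \<in> terms S X" "u \<in> terms S X"
    and val: "\<And>f. f ` X \<subseteq> {0..1} \<Longrightarrow> eval_term unit_alg f t = eval_term unit_alg f u"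
  shows "(t, u) \<in> term_eq S X"
proof (rule ccontr)
  assume neq: "(t, u) \<notin> term_eq S X"
  interpret S: scalar_set S using S scalar_sets by blast
  interpret F: scalar_mv_algebra S "free_alg S X" by (rule S.free_alg_is_algebra)
  have ne: "term_class S X t \<noteq> term_class S X u" using neq tu by (simp add: S.class_eq_iff)
  have "\<exists>(C :: 'a mv_term set mv_alg) h. scalar_mv_algebra S C \<and> mv_chain C \<and>
      h \<in> mv_hom S (free_alg S X) C \<and> h (term_class S X t) \<noteq> h (term_class S X u)"
    using S ne S.class_in[OF tu(1)] S.class_in[OF tu(2)] S.scalar_set_axioms
    by (intro F.chain_quotient) auto
  then obtain C :: "'a mv_term set mv_alg" and h where C: "scalar_mv_algebra S C" "mv_chain C"
    and h: "h \<in> mv_hom S (free_alg S X) C" "h (term_class S X t) \<noteq> h (term_class S X u)" by blast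
  interpret C: scalar_mv_algebra S C by fact
  have hC: "h a \<in> carrier C" if "a \<in> carrier (free_alg S X)" for a
    using h that by (auto simp: mv_hom_def)
  have "\<zero>\<^bsub>C\<^esub> \<noteq> mv_one C"
  proof
    assume "\<zero>\<^bsub>C\<^esub> = mv_one C"
    then have "a = mv_one C" if "a \<in> carrier C" for a
      using C.zero_plus[OF that] C.one_plus[OF that] by simp
    then show False using h(2) hC S.class_in tu by metis
  qed
  then have "nontrivial_chain C" using C by unfold_locales
  moreover have "(\<lambda>x. h (free_gen S X x)) ` X \<subseteq> carrier C"
    by (auto simp: free_gen_def intro!: hC S.class_in)
  ultimately show False
    using chain_terms_separated[OF S C(1) _ tu] val h S.hom_class[OF h(1)] tu by metis
qed

section \<open>MV-terms generating the ideals of DMV-terms\<close>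

lemma eval_unit_bounds:
  assumes "S \<subseteq> {0..1}" "f ` X \<subseteq> {0..1}" "t \<in> terms S X"
  shows "0 \<le> eval_term unit_alg f t" "eval_term unit_alg f t \<le> 1"
  using scalar_mv_algebra.eval_closed[OF unit_alg_algebra[OF assms(1)], of f X t] assms by auto

lemma term_eq_eval_unit:
  assumes "scalar_set S" "S \<subseteq> {0..1}" "(t, u) \<in> term_eq S X" "f ` X \<subseteq> {0..1}"
  shows "eval_term unit_alg f t = eval_term unit_alg f u"
  using scalar_mv_algebra.eval_sound[OF unit_alg_algebra[OF assms(2)] assms(1) _ assms(3)] assms(4)
  by simp

text \<open>Soundness takes a derivation with scalars in \<open>S'\<close> to validity in [0,1], and
  completeness for \<open>S\<close> takes it back. The larger set enters only through soundness, so
  it may consist of all reals in [0,1].\<close>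

lemma term_eq_conservative:
  assumes S: "S = {} \<or> S = dmv_scalars" and S': "scalar_set S'" "S \<subseteq> S'" "S' \<subseteq> {0..1}"
    and tu: "t \<in> terms S X" "u \<in> terms S X"
  shows "(t, u) \<in> term_eq S' X \<longleftrightarrow> (t, u) \<in> term_eq S X"
proof
  assume "(t, u) \<in> term_eq S' X"
  then show "(t, u) \<in> term_eq S X"
    by (intro completeness[OF S tu]) (rule term_eq_eval_unit[OF S'(1,3)])
next
  assume "(t, u) \<in> term_eq S X"
  then show "(t, u) \<in> term_eq S' X" by (rule term_eq_mono[OF S'(2)])
qed

definition clamp :: "real \<Rightarrow> real" where "clamp y = max 0 (min 1 y)"

text \<open>The summands are the unit slices of the segment from 0 to \<open>y\<close>; the first
  \<open>M\<close> of them recover \<open>y\<close> up to height \<open>M\<close>.\<close>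

lemma sum_clamp: "0 \<le> y \<Longrightarrow> (\<Sum>j<M. clamp (y - real j)) = min y (real M)"
  by (induction M) (auto simp: clamp_def)

text \<open>
  A weak form of McNaughton's theorem: all truncations of the function at integer levels, rather
  than the function itself, are values of MV-terms, which makes the property stable under sums.
\<close>

definition definable :: "'x set \<Rightarrow> (('x \<Rightarrow> real) \<Rightarrow> real) \<Rightarrow> bool"
  where "definable X \<phi> \<longleftrightarrow> (\<forall>k::int. \<exists>g\<in>terms mv_scalars X. \<forall>f. f ` X \<subseteq> {0..1} \<longrightarrow>
    eval_term unit_alg f g = clamp (\<phi> f - of_int k))"

lemma definable_cong:
  assumes "definable X \<phi>" "\<And>f. f ` X \<subseteq> {0..1} \<Longrightarrow> \<phi> f = \<psi> f"
  shows "definable X \<psi>"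
  using assms unfolding definable_def by metis

lemma definable_var:
  assumes "x \<in> X"
  shows "definable X (\<lambda>f. f x)"
  unfolding definable_def
proof
  fix k :: int
  have 01: "0 \<le> f x \<and> f x \<le> 1" if "f ` X \<subseteq> {0..1}" for f :: "'a \<Rightarrow> real"
    using that assms by (auto simp: image_subset_iff)
  consider "k = 0" | "1 \<le> k" | "k \<le> -1" by linarith
  then show "\<exists>g\<in>terms mv_scalars X. \<forall>f. f ` X \<subseteq> {0..1} \<longrightarrow>
    eval_term unit_alg f g = clamp (f x - of_int k)"
  proof cases
    case 1
    then show ?thesis using assms 01 by (intro bexI[of _ "Var x"]) (auto simp: clamp_def)
  next
    case 2
    then have "1 \<le> real_of_int k" by simp
    then have "clamp (f x - of_int k) = 0" if "f ` X \<subseteq> {0..1}" for f :: "'a \<Rightarrow> real"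
      using 01[OF that] by (simp add: clamp_def)
    then show ?thesis by (intro bexI[of _ Zero]) auto
  next
    case 3
    then have "1 \<le> f x - of_int k" if "f ` X \<subseteq> {0..1}" for f :: "'a \<Rightarrow> real"
      using 01[OF that] by linarith
    then show ?thesis by (intro bexI[of _ "Neg Zero"]) (auto simp: clamp_def)
  qed
qed

lemma definable_const: "definable X (\<lambda>f. of_int c)"
  unfolding definable_def
proof
  fix k :: int
  show "\<exists>g\<in>terms mv_scalars X. \<forall>f. f ` X \<subseteq> {0..1} \<longrightarrow>
    eval_term unit_alg f g = clamp (of_int c - of_int k)"
    by (rule bexI[of _ "if c \<le> k then Zero else Neg Zero"]) (auto simp: clamp_def)
qed

lemma definable_uminus:
  assumes "definable X \<phi>"
  shows "definable X (\<lambda>f. - \<phi> f)"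
  unfolding definable_def
proof
  fix k :: int
  \<comment> \<open>\<open>1 - clamp z\<close> is \<open>clamp (1 - z)\<close>; for
    \<open>z = \<phi> f + k + 1\<close> this is the wanted truncation, hence the level
    \<open>- k - 1\<close>.\<close>
  obtain g where "g \<in> terms mv_scalars X"
    "\<And>f. f ` X \<subseteq> {0..1} \<Longrightarrow> eval_term unit_alg f g = clamp (\<phi> f - of_int (- k - 1))"
    using assms unfolding definable_def by blast
  then show "\<exists>g\<in>terms mv_scalars X. \<forall>f. f ` X \<subseteq> {0..1} \<longrightarrow>
    eval_term unit_alg f g = clamp (- \<phi> f - of_int k)"
    by (intro bexI[of _ "Neg g"]) (auto simp: clamp_def)
qed

lemma definable_shift:
  assumes "definable X \<phi>"
  shows "definable X (\<lambda>f. of_int c + \<phi> f)"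
  unfolding definable_def
proof
  fix k :: int
  obtain g where "g \<in> terms mv_scalars X"
    "\<And>f. f ` X \<subseteq> {0..1} \<Longrightarrow> eval_term unit_alg f g = clamp (\<phi> f - of_int (k - c))"
    using assms unfolding definable_def by blast
  then show "\<exists>g\<in>terms mv_scalars X. \<forall>f. f ` X \<subseteq> {0..1} \<longrightarrow>
    eval_term unit_alg f g = clamp (of_int c + \<phi> f - of_int k)"
    by (intro bexI[of _ g]) (auto simp: algebra_simps)
qed

text \<open>At levels below \<open>c\<close> the truncation is saturated wherever the minimum takes
  effect, so it does not change; from level \<open>c\<close> on it vanishes.\<close>

lemma definable_min:
  assumes "definable X \<phi>"
  shows "definable X (\<lambda>f. min (of_int c) (\<phi> f))"
  unfolding definable_def
proof
  fix k :: int
  obtain g where g: "g \<in> terms mv_scalars X"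
    "\<And>f. f ` X \<subseteq> {0..1} \<Longrightarrow> eval_term unit_alg f g = clamp (\<phi> f - of_int k)"
    using assms unfolding definable_def by blast
  show "\<exists>g\<in>terms mv_scalars X. \<forall>f. f ` X \<subseteq> {0..1} \<longrightarrow>
    eval_term unit_alg f g = clamp (min (of_int c) (\<phi> f) - of_int k)"
  proof (cases "c \<le> k")
    case True
    then show ?thesis by (intro bexI[of _ Zero]) (auto simp: clamp_def)
  next
    case False
    then have "(1::real) \<le> of_int c - of_int k" by linarith
    then show ?thesis using g by (intro bexI[of _ g]) (auto simp: clamp_def min_def max_def)
  qed
qed

text \<open>For \<open>c\<close> in [0,1] and \<open>z = \<phi> f - k\<close>, the truncation of z +
  c is \<open>clamp z\<close> plus \<open>clamp (z + 1) \<odot> c\<close>. If z \<ge> 0, the second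
  summand is \<open>c\<close>; if z \<le> 0, the first vanishes and the second is the positive part
  of z + c. The use of two neighbouring levels is why definability asks for all of them.\<close>

lemma definable_plus_term:
  assumes \<phi>: "definable X \<phi>" and c: "c \<in> terms mv_scalars X"
  shows "definable X (\<lambda>f. \<phi> f + eval_term unit_alg f c)"
  unfolding definable_def
proof
  fix k :: int
  obtain g h where g: "g \<in> terms mv_scalars X" "h \<in> terms mv_scalars X"
    "\<And>f. f ` X \<subseteq> {0..1} \<Longrightarrow> eval_term unit_alg f g = clamp (\<phi> f - of_int k)"
    "\<And>f. f ` X \<subseteq> {0..1} \<Longrightarrow> eval_term unit_alg f h = clamp (\<phi> f - of_int (k - 1))"
    using \<phi> unfolding definable_def by meson
  have "eval_term unit_alg f (Plus g (Odot h c)) = clamp (\<phi> f + eval_term unit_alg f c - of_int k)"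
    if f: "f ` X \<subseteq> {0..1}" for f
    using eval_unit_bounds[OF _ f c] g(3)[OF f] g(4)[OF f] by (auto simp: clamp_def min_def max_def)
  then show "\<exists>g\<in>terms mv_scalars X. \<forall>f. f ` X \<subseteq> {0..1} \<longrightarrow>
    eval_term unit_alg f g = clamp (\<phi> f + eval_term unit_alg f c - of_int k)"
    using g c by (intro bexI[of _ "Plus g (Odot h c)"]) auto
qed

text \<open>Being bounded by \<open>M\<close>, the function \<open>\<psi>\<close> is the sum of its
  first \<open>M\<close> unit slices. Each slice is an MV-term, and they are added one at a
  time.\<close>

lemma definable_plus:
  assumes \<phi>: "definable X \<phi>" and \<psi>: "definable X \<psi>"
    and bounds: "\<And>f. f ` X \<subseteq> {0..1} \<Longrightarrow> 0 \<le> \<psi> f \<and> \<psi> f \<le> real M"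
  shows "definable X (\<lambda>f. \<phi> f + \<psi> f)"
proof -
  have "definable X (\<lambda>f. \<phi> f + (\<Sum>j<m. clamp (\<psi> f - real j)))" for m
  proof (induction m)
    case 0
    then show ?case using \<phi> by simp
  next
    case (Suc m)
    obtain g where g: "g \<in> terms mv_scalars X"
      "\<And>f. f ` X \<subseteq> {0..1} \<Longrightarrow> eval_term unit_alg f g = clamp (\<psi> f - of_int (int m))"
      using \<psi> unfolding definable_def by blast
    show ?case
      by (rule definable_cong[OF definable_plus_term[OF Suc g(1)]]) (simp add: g(2))
  qed
  from this[of M] show ?thesis
    by (rule definable_cong) (use bounds in \<open>auto simp: sum_clamp min_def\<close>)
qed

lemma definable_times:
  assumes "definable X \<phi>" "\<And>f. f ` X \<subseteq> {0..1} \<Longrightarrow> 0 \<le> \<phi> f \<and> \<phi> f \<le> real M"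
  shows "definable X (\<lambda>f. real n * \<phi> f)"
proof (induction n)
  case 0
  show ?case using definable_const[of X 0] by simp
next
  case (Suc n)
  show ?case
    by (rule definable_cong[OF definable_plus[OF Suc assms]]) (auto simp: algebra_simps)
qed

text \<open>Denominators are cleared along the term: N(1 - a) is N - Na, NM min(1, a + b) is the
  minimum of NM and M(Na) + N(Mb), and nN times (k/n)a is k(Na). The truncation at 1 thus becomes a
  truncation at the integer NM.\<close>

lemma definable_multiple:
  assumes "t \<in> terms dmv_scalars X"
  shows "\<exists>N\<ge>1. definable X (\<lambda>f. real N * eval_term unit_alg f t)"
  using assms
proof (induction rule: terms.induct)
  case (Var x)
  then show ?case using definable_var[of x X] by (intro exI[of _ 1]) simp
next
  case Zero
  show ?case using definable_const[of X 0] by (intro exI[of _ 1]) simp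
next
  case (Neg t)
  then obtain N where N: "1 \<le> N" "definable X (\<lambda>f. real N * eval_term unit_alg f t)" by blast
  have "definable X (\<lambda>f. real N * eval_term unit_alg f (Neg t))"
    by (rule definable_cong[OF definable_shift[OF definable_uminus[OF N(2)], of "int N"]])
      (simp add: algebra_simps)
  then show ?case using N(1) by blast
next
  case (Plus t u)
  then obtain N M where N: "1 \<le> N" "definable X (\<lambda>f. real N * eval_term unit_alg f t)"
    and M: "1 \<le> M" "definable X (\<lambda>f. real M * eval_term unit_alg f u)" by blast
  have b: "0 \<le> real n * eval_term unit_alg f s \<and> real n * eval_term unit_alg f s \<le> real n"
    if "f ` X \<subseteq> {0..1}" "s \<in> terms dmv_scalars X" for f s n
    using eval_unit_bounds[OF _ that] by (auto intro: mult_left_le)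
  have D: "definable X (\<lambda>f. real M * (real N * eval_term unit_alg f t))"
    "definable X (\<lambda>f. real N * (real M * eval_term unit_alg f u))"
    by (rule definable_times[OF N(2) b[OF _ Plus.hyps(1)]] definable_times[OF M(2) b[OF _ Plus.hyps(2)]];
      assumption)+
  have "0 \<le> real N * (real M * eval_term unit_alg f u) \<and>
      real N * (real M * eval_term unit_alg f u) \<le> real (N * M)" if "f ` X \<subseteq> {0..1}" for f
    using b[OF that Plus.hyps(2), of "N * M"] by (simp add: mult.assoc)
  note S = definable_min[OF definable_plus[OF D this], of "int (N * M)"]
  have "definable X (\<lambda>f. real (N * M) * eval_term unit_alg f (Plus t u))"
  proof (rule definable_cong[OF S])
    fix f :: "'a \<Rightarrow> real"
    show "min (of_int (int (N * M))) (real M * (real N * eval_term unit_alg f t) + real N * (real M * eval_term unit_alg f u))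
        = real (N * M) * eval_term unit_alg f (Plus t u)"
      using N(1) M(1) by (simp add: min_mult_distrib_left algebra_simps)
  qed
  then show ?case using N(1) M(1) by (intro exI[of _ "N * M"]) auto
next
  case (Scal r t)
  then obtain N where N: "1 \<le> N" "definable X (\<lambda>f. real N * eval_term unit_alg f t)" by blast
  have r: "0 \<le> r" "r \<in> \<rat>" using Scal by auto
  then obtain k n where kn: "n \<noteq> 0" "r = real k / real n"
    by (metis Rats_abs_nat_div_natE abs_of_nonneg)
  have b: "0 \<le> real N * eval_term unit_alg f t \<and> real N * eval_term unit_alg f t \<le> real N"
    if "f ` X \<subseteq> {0..1}" for f
    using eval_unit_bounds[OF _ that Scal.hyps(2)] by (auto intro: mult_left_le)
  have "definable X (\<lambda>f. real (n * N) * eval_term unit_alg f (Scal r t))"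
    by (rule definable_cong[OF definable_times[OF N(2) b, of k]])
      (use kn in \<open>simp_all add: field_simps\<close>)
  then show ?case using N(1) kn(1) by (intro exI[of _ "n * N"]) auto
qed

section \<open>Membership in principal ideals as derivability\<close>

primrec nfold_term :: "nat \<Rightarrow> 'x mv_term \<Rightarrow> 'x mv_term"
  where
    "nfold_term 0 t = Zero"
  | "nfold_term (Suc n) t = Plus t (nfold_term n t)"

lemma nfold_term_in [simp]: "t \<in> terms S X \<Longrightarrow> nfold_term n t \<in> terms S X"
  by (induction n) auto

lemma eval_nfold_term:
  "0 \<le> eval_term unit_alg f t \<Longrightarrow>
    eval_term unit_alg f (nfold_term n t) = min 1 (real n * eval_term unit_alg f t)"
  by (induction n) (auto simp: algebra_simps min_def)

text \<open>The equation states that \<open>t\<close> lies below the n-fold sum of \<open>u\<close>,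
  hence in the ideal generated by it. For each \<open>n\<close> it is a single equation whose terms
  involve only the scalars of \<open>t\<close> and \<open>u\<close>, so conservativity applies to
  it.\<close>

definition dominated :: "real set \<Rightarrow> 'x set \<Rightarrow> 'x mv_term \<Rightarrow> 'x mv_term \<Rightarrow> bool"
  where "dominated S X t u \<longleftrightarrow> (\<exists>n. (Plus (Neg t) (nfold_term n u), Neg Zero) \<in> term_eq S X)"

lemma dominated_mono: "\<lbrakk>dominated S X t u; S \<subseteq> S'\<rbrakk> \<Longrightarrow> dominated S' X t u"
  using term_eq_mono unfolding dominated_def by blast

lemma dominated_conservative:
  assumes "S = {} \<or> S = dmv_scalars" "scalar_set S'" "S \<subseteq> S'" "S' \<subseteq> {0..1}"
    and "t \<in> terms S X" "u \<in> terms S X"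
  shows "dominated S' X t u \<longleftrightarrow> dominated S X t u"
proof -
  have "(Plus (Neg t) (nfold_term n u), Neg Zero) \<in> term_eq S' X \<longleftrightarrow>
      (Plus (Neg t) (nfold_term n u), Neg Zero) \<in> term_eq S X" for n
    using assms(5,6) by (intro term_eq_conservative[OF assms(1-4)]) simp_all
  then show ?thesis unfolding dominated_def by simp
qed

lemma (in scalar_set) nfold_class:
  "t \<in> terms S X \<Longrightarrow> mv_nfold (free_alg S X) n (term_class S X t) = term_class S X (nfold_term n t)"
  by (induction n) (simp_all add: free_ops)

lemma (in scalar_set) class_in_ideal_gen_iff:
  assumes "t \<in> terms S X" "u \<in> terms S X"
  shows "term_class S X t \<in> mv_ideal_gen (free_alg S X) {term_class S X u} \<longleftrightarrow> dominated S X t u"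
proof -
  interpret F: scalar_mv_algebra S "free_alg S X" by (rule free_alg_is_algebra)
  have "mv_le (free_alg S X) (term_class S X t) (mv_nfold (free_alg S X) n (term_class S X u)) \<longleftrightarrow>
      (Plus (Neg t) (nfold_term n u), Neg Zero) \<in> term_eq S X" for n
    using assms by (simp add: nfold_class mv_le_def mv_one_def free_ops class_eq_iff)
  then show ?thesis using assms unfolding dominated_def
    by (simp add: F.ideal_gen_singleton class_in)
qed

lemma mv_term_same_ideal:
  assumes t: "t \<in> terms dmv_scalars X"
  shows "\<exists>g\<in>terms mv_scalars X. dominated dmv_scalars X t g \<and> dominated dmv_scalars X g t"
proof -
  obtain N where N: "1 \<le> N" "definable X (\<lambda>f. real N * eval_term unit_alg f t)"
    using definable_multiple[OF t] by blast
  then obtain g where g: "g \<in> terms mv_scalars X"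
    "\<And>f. f ` X \<subseteq> {0..1} \<Longrightarrow>
      eval_term unit_alg f g = clamp (real N * eval_term unit_alg f t - of_int 0)"
    unfolding definable_def by blast
  have g': "g \<in> terms dmv_scalars X" using terms_mono[OF _ g(1)] by blast
  have ev: "eval_term unit_alg f g = min 1 (real N * eval_term unit_alg f t)"
    and bounds: "0 \<le> eval_term unit_alg f t" "eval_term unit_alg f t \<le> real N * eval_term unit_alg f t"
    "eval_term unit_alg f t \<le> 1"
    if f: "f ` X \<subseteq> {0..1}" for f
  proof -
    show 0: "0 \<le> eval_term unit_alg f t" "eval_term unit_alg f t \<le> 1"
      using eval_unit_bounds[OF _ f t] by auto
    then show "eval_term unit_alg f t \<le> real N * eval_term unit_alg f t"
      using mult_right_mono[of 1 "real N" "eval_term unit_alg f t"] N(1) by simp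
    show "eval_term unit_alg f g = min 1 (real N * eval_term unit_alg f t)"
      using 0 g(2)[OF f] by (simp add: clamp_def)
  qed
  \<comment> \<open>A single copy of \<open>g\<close> suffices because \<open>N\<close> is at least
    1; in the other direction \<open>N\<close> copies of \<open>t\<close> have the same value as
    \<open>g\<close>.\<close>
  have "(Plus (Neg t) (nfold_term 1 g), Neg Zero) \<in> term_eq dmv_scalars X"
    using t g' by (intro completeness) (simp_all add: ev bounds)
  moreover have "(Plus (Neg g) (nfold_term N t), Neg Zero) \<in> term_eq dmv_scalars X"
    using t g' by (intro completeness) (simp_all add: ev bounds eval_nfold_term)
  ultimately show ?thesis using g(1) unfolding dominated_def by blast
qed

section \<open>Equivalences from correspondences\<close>

text \<open>A functor presented by relations, because translating an ideal or an arrow requires a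
  choice of terms that none of them determines. The converse functor is an instance of the same
  locale with the arguments exchanged.\<close>

locale category_correspondence = C: category C + D: category D
  for C :: "('o, 'm) category" and D :: "('p, 'n) category" +
  fixes R :: "'o \<Rightarrow> 'p \<Rightarrow> bool" and T :: "'o \<Rightarrow> 'o \<Rightarrow> 'p \<Rightarrow> 'p \<Rightarrow> 'm \<Rightarrow> 'n \<Rightarrow> bool"
  assumes R_total: "A \<in> Obj C \<Longrightarrow> \<exists>A'\<in>Obj D. R A A'"
    and R_unique: "\<lbrakk>A \<in> Obj C; A' \<in> Obj D; B' \<in> Obj D; R A A'; R A B'\<rbrakk> \<Longrightarrow> A' = B'"
    and T_total: "\<lbrakk>A \<in> Obj C; B \<in> Obj C; A' \<in> Obj D; B' \<in> Obj D; R A A'; R B B'; f \<in> Hom C A B\<rbrakk>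
      \<Longrightarrow> \<exists>f'\<in>Hom D A' B'. T A B A' B' f f'"
    and T_unique: "\<lbrakk>A \<in> Obj C; B \<in> Obj C; A' \<in> Obj D; B' \<in> Obj D; R A A'; R B B';
        f \<in> Hom C A B; f' \<in> Hom D A' B'; g' \<in> Hom D A' B'; T A B A' B' f f'; T A B A' B' f g'\<rbrakk>
      \<Longrightarrow> f' = g'"
    and T_Idt: "\<lbrakk>A \<in> Obj C; A' \<in> Obj D; R A A'\<rbrakk> \<Longrightarrow> T A A A' A' (Idt C A) (Idt D A')"
    and T_Comp: "\<lbrakk>A \<in> Obj C; B \<in> Obj C; E \<in> Obj C; A' \<in> Obj D; B' \<in> Obj D; E' \<in> Obj D;
        R A A'; R B B'; R E E'; f \<in> Hom C A B; g \<in> Hom C B E; f' \<in> Hom D A' B'; g' \<in> Hom D B' E';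
        T A B A' B' f f'; T B E B' E' g g'\<rbrakk>
      \<Longrightarrow> T A E A' E' (Comp C A B E g f) (Comp D A' B' E' g' f')"
begin

text \<open>Images are chosen by totality. The functor laws follow from uniqueness: both sides of
  each law correspond to the same arrow of \<open>C\<close>.\<close>

lemma functor_exists:
  "\<exists>F. is_functor C D F \<and> (\<forall>A\<in>Obj C. R A (on_obj F A)) \<and>
    (\<forall>A\<in>Obj C. \<forall>B\<in>Obj C. \<forall>f\<in>Hom C A B. T A B (on_obj F A) (on_obj F B) f (on_arr F A B f))"
proof -
  obtain F where F: "\<And>A. A \<in> Obj C \<Longrightarrow> F A \<in> Obj D \<and> R A (F A)" using R_total by metis
  have "\<exists>f'. f' \<in> Hom D (F A) (F B) \<and> T A B (F A) (F B) f f'"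
    if "A \<in> Obj C" "B \<in> Obj C" "f \<in> Hom C A B" for A B f
    using T_total[OF that(1,2) _ _ _ _ that(3)] F that by blast
  then obtain \<phi> where \<phi>: "\<And>A B f. \<lbrakk>A \<in> Obj C; B \<in> Obj C; f \<in> Hom C A B\<rbrakk>
      \<Longrightarrow> \<phi> A B f \<in> Hom D (F A) (F B) \<and> T A B (F A) (F B) f (\<phi> A B f)" by metis
  have Idt: "\<phi> A A (Idt C A) = Idt D (F A)" if A: "A \<in> Obj C" for A
    using T_unique[of A A "F A" "F A" "Idt C A"] T_Idt[of A "F A"] F[OF A] A \<phi>[of A A "Idt C A"]
      C.Idt_in D.Idt_in by blast
  have Comp: "\<phi> A E (Comp C A B E g f) = Comp D (F A) (F B) (F E) (\<phi> B E g) (\<phi> A B f)"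
    if o: "A \<in> Obj C" "B \<in> Obj C" "E \<in> Obj C" and fg: "f \<in> Hom C A B" "g \<in> Hom C B E" for A B E f g
  proof -
    have c: "Comp C A B E g f \<in> Hom C A E" using C.Comp_in o fg by blast
    have d: "Comp D (F A) (F B) (F E) (\<phi> B E g) (\<phi> A B f) \<in> Hom D (F A) (F E)"
      using D.Comp_in F \<phi> o fg by blast
    have "T A E (F A) (F E) (Comp C A B E g f) (Comp D (F A) (F B) (F E) (\<phi> B E g) (\<phi> A B f))"
      using T_Comp F \<phi> o fg by blast
    then show ?thesis using T_unique[of A E "F A" "F E" "Comp C A B E g f"] F \<phi>[OF o(1,3) c] o c d
      by blast
  qed
  show ?thesis
    by (rule exI[of _ "\<lparr>on_obj = F, on_arr = \<phi>\<rparr>"]) (use F \<phi> Idt Comp in \<open>simp add: is_functor_def\<close>)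
qed

end

lemma (in category) is_iso_Idt: "A \<in> Obj C \<Longrightarrow> is_iso C A A (Idt C A)"
  unfolding is_iso_def using Idt_in Comp_Idt by blast

text \<open>Uniqueness in both directions makes the two functors inverse to each other on objects
  and on arrows, so identities serve as natural isomorphisms.\<close>

theorem equivalent_by_correspondence:
  assumes "category_correspondence C D R T"
    and "category_correspondence D C (\<lambda>A' A. R A A') (\<lambda>A' B' A B f' f. T A B A' B' f f')"
  shows "equivalent_categories C D"
proof -
  interpret CD: category_correspondence C D R T by fact
  interpret DC: category_correspondence D C "\<lambda>A' A. R A A'" "\<lambda>A' B' A B f' f. T A B A' B' f f'" by fact
  obtain F where F: "is_functor C D F" "\<And>A. A \<in> Obj C \<Longrightarrow> R A (on_obj F A)"
    "\<And>A B f. \<lbrakk>A \<in> Obj C; B \<in> Obj C; f \<in> Hom C A B\<rbrakk> \<Longrightarrow> T A B (on_obj F A) (on_obj F B) f (on_arr F A B f)"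
    using CD.functor_exists by blast
  obtain H where H: "is_functor D C H" "\<And>A. A \<in> Obj D \<Longrightarrow> R (on_obj H A) A"
    "\<And>A B f. \<lbrakk>A \<in> Obj D; B \<in> Obj D; f \<in> Hom D A B\<rbrakk> \<Longrightarrow> T (on_obj H A) (on_obj H B) A B (on_arr H A B f) f"
    using DC.functor_exists by blast
  have Fo: "on_obj F A \<in> Obj D" if "A \<in> Obj C" for A
    using F(1) that by (simp add: is_functor_def)
  have Ho: "on_obj H A \<in> Obj C" if "A \<in> Obj D" for A
    using H(1) that by (simp add: is_functor_def)
  have Fa: "on_arr F A B f \<in> Hom D (on_obj F A) (on_obj F B)"
    if "A \<in> Obj C" "B \<in> Obj C" "f \<in> Hom C A B" for A B f
    using F(1) that by (simp add: is_functor_def)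
  have Ha: "on_arr H A B f \<in> Hom C (on_obj H A) (on_obj H B)"
    if "A \<in> Obj D" "B \<in> Obj D" "f \<in> Hom D A B" for A B f
    using H(1) that by (simp add: is_functor_def)
  have HF: "on_obj H (on_obj F A) = A" if A: "A \<in> Obj C" for A
    using DC.R_unique[of "on_obj F A" "on_obj H (on_obj F A)" A] F(2) H(2) Fo Ho A by blast
  have FH: "on_obj F (on_obj H A) = A" if A: "A \<in> Obj D" for A
    using CD.R_unique[of "on_obj H A" "on_obj F (on_obj H A)" A] F(2) H(2) Fo Ho A by blast
  have HFa: "on_arr H (on_obj F A) (on_obj F B) (on_arr F A B f) = f"
    if o: "A \<in> Obj C" "B \<in> Obj C" and f: "f \<in> Hom C A B" for A B f
    using DC.T_unique[of "on_obj F A" "on_obj F B" A B "on_arr F A B f" _ f]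
      Ha[of "on_obj F A" "on_obj F B" "on_arr F A B f"] H(3)[of "on_obj F A" "on_obj F B" "on_arr F A B f"]
      Fo F(2,3) Fa HF o f by simp
  have FHa: "on_arr F (on_obj H A) (on_obj H B) (on_arr H A B f) = f"
    if o: "A \<in> Obj D" "B \<in> Obj D" and f: "f \<in> Hom D A B" for A B f
    using CD.T_unique[of "on_obj H A" "on_obj H B" A B "on_arr H A B f" _ f]
      Fa[of "on_obj H A" "on_obj H B" "on_arr H A B f"] F(3)[of "on_obj H A" "on_obj H B" "on_arr H A B f"]
      Ho H(2,3) Ha FH o f by simp
  have "naturally_isomorphic C C id_func (comp_func H F)"
    unfolding naturally_isomorphic_def
    by (rule exI[of _ "Idt C"])
      (simp add: id_func_def comp_func_def HF HFa CD.C.is_iso_Idt CD.C.Comp_Idt CD.C.Idt_Comp)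
  moreover have "naturally_isomorphic D D (comp_func F H) id_func"
    unfolding naturally_isomorphic_def
    by (rule exI[of _ "Idt D"])
      (simp add: id_func_def comp_func_def FH FHa CD.D.is_iso_Idt CD.D.Comp_Idt CD.D.Idt_Comp)
  ultimately show ?thesis
    unfolding equivalent_categories_def using F(1) H(1) CD.C.category_axioms CD.D.category_axioms by blast
qed

section \<open>Homomorphisms between free algebras as substitutions\<close>

primrec subst :: "('x \<Rightarrow> 'y mv_term) \<Rightarrow> 'x mv_term \<Rightarrow> 'y mv_term"
  where
    "subst m (Var x) = m x"
  | "subst m Zero = Zero"
  | "subst m (Neg t) = Neg (subst m t)"
  | "subst m (Plus t u) = Plus (subst m t) (subst m u)"
  | "subst m (Scal r t) = Scal r (subst m t)"

lemma subst_in: "\<lbrakk>t \<in> terms S X; \<And>x. x \<in> X \<Longrightarrow> m x \<in> terms S Y\<rbrakk> \<Longrightarrow> subst m t \<in> terms S Y"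
  by (induction t rule: terms.induct) auto

lemma (in scalar_set) eval_free_subst:
  assumes "t \<in> terms S X" "\<And>x. x \<in> X \<Longrightarrow> m x \<in> terms S Y \<and> g x = term_class S Y (m x)"
  shows "eval_term (free_alg S Y) g t = term_class S Y (subst m t)"
  using assms
proof (induction t rule: terms.induct)
  case (Plus t u)
  then show ?case using subst_in[of t S X m Y] subst_in[of u S X m Y] by (simp add: free_ops)
next
  case (Neg t)
  then show ?case using subst_in[of t S X m Y] by (simp add: free_ops)
next
  case (Scal r t)
  then show ?case using subst_in[of t S X m Y] by (simp add: free_ops)
qed (auto simp: free_ops)

lemma mv_hom_compose:
  assumes "f \<in> mv_hom S A B" "g \<in> mv_hom S B D"
    and "mv_algebra A" and "\<And>r x. \<lbrakk>r \<in> S; x \<in> carrier A\<rbrakk> \<Longrightarrow> r \<cdot>\<^bsub>A\<^esub> x \<in> carrier A"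
  shows "compose (carrier A) g f \<in> mv_hom S A D"
proof -
  interpret A: mv_algebra A by fact
  have "f x \<in> carrier B" if "x \<in> carrier A" for x using assms(1) that by (auto simp: mv_hom_def)
  then show ?thesis using assms(1,2,4) unfolding mv_hom_def by (auto simp: compose_def)
qed

text \<open>Elements of a principal ideal lie below n-fold sums of the generator, and a homomorphism
  preserves these sums and the order; so the generator decides.\<close>

lemma hom_ideal_gen:
  assumes h: "h \<in> mv_hom S A B" and "mv_algebra A" "mv_algebra B"
    and a: "a \<in> carrier A" and J: "mv_ideal B J" "h a \<in> J"
  shows "h ` mv_ideal_gen A {a} \<subseteq> J"
proof
  interpret A: mv_algebra A by fact
  interpret B: mv_algebra B by fact
  have hB: "h x \<in> carrier B" if "x \<in> carrier A" for x using h that by (auto simp: mv_hom_def)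
  have plus: "h (x \<oplus>\<^bsub>A\<^esub> y) = h x \<oplus>\<^bsub>B\<^esub> h y" if "x \<in> carrier A" "y \<in> carrier A" for x y
    using h that by (auto simp: mv_hom_def)
  have neg: "h (\<sim>\<^bsub>A\<^esub> x) = \<sim>\<^bsub>B\<^esub> h x" if "x \<in> carrier A" for x
    using h that by (auto simp: mv_hom_def)
  have zero: "h \<zero>\<^bsub>A\<^esub> = \<zero>\<^bsub>B\<^esub>" using h by (auto simp: mv_hom_def)
  have nfold: "h (mv_nfold A n a) = mv_nfold B n (h a)" for n
    by (induction n) (use a plus zero in auto)
  have one: "h (mv_one A) = mv_one B"
    using neg[of "\<zero>\<^bsub>A\<^esub>"] zero by simp
  fix y assume "y \<in> h ` mv_ideal_gen A {a}"
  then obtain b n where b: "y = h b" "b \<in> carrier A" "b \<sqsubseteq>\<^bsub>A\<^esub> mv_nfold A n a"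
    unfolding A.ideal_gen_singleton[OF a] by blast
  then have "h b \<sqsubseteq>\<^bsub>B\<^esub> mv_nfold B n (h a)"
    using plus[of "\<sim>\<^bsub>A\<^esub> b" "mv_nfold A n a"] neg[of b] nfold[of n] one a by (simp add: mv_le_def)
  then show "y \<in> J" using B.ideal_down[OF J(1) B.ideal_nfold[OF J]] hB b by simp
qed

lemma (in mv_algebra) ideal_gen_singleton_eq_iff:
  assumes "a \<in> carrier A" "b \<in> carrier A"
  shows "mv_ideal_gen A {a} = mv_ideal_gen A {b} \<longleftrightarrow>
    a \<in> mv_ideal_gen A {b} \<and> b \<in> mv_ideal_gen A {a}"
proof -
  have "x \<in> mv_ideal_gen A {x}" if "x \<in> carrier A" for x
    using ideal_gen_is_ideal(2)[of "{x}"] that by simp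
  moreover have "mv_ideal_gen A {x} \<subseteq> mv_ideal_gen A {y}"
    if "x \<in> mv_ideal_gen A {y}" "y \<in> carrier A" for x y
    using that ideal_gen_is_ideal(1)[of "{y}"] unfolding mv_ideal_gen_def[of A "{x}"] by blast
  ultimately show ?thesis using assms by blast
qed

section \<open>The common category of theories over a set of scalars\<close>

definition term_ideal :: "real set \<Rightarrow> 'x set \<Rightarrow> 'x mv_term \<Rightarrow> 'x mv_term set set"
  where "term_ideal S X t = mv_ideal_gen (free_alg S X) {term_class S X t}"

definition theory_category :: "real set \<Rightarrow> 'x theory_cat"
  where "theory_category S = \<lparr>
    Obj = {(X, I). \<exists>t\<in>terms mv_scalars X. I = term_ideal S X t},
    Hom = (\<lambda>(X, I) (Y, J). {\<tau> \<in> mv_hom S (free_alg S X) (free_alg S Y). \<tau> ` I \<subseteq> J \<and>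
      (\<forall>x\<in>X. \<exists>s\<in>terms mv_scalars Y. \<tau> (free_gen S X x) = term_class S Y s)}),
    Idt = (\<lambda>(X, I). \<lambda>a\<in>carrier (free_alg S X). a),
    Comp = (\<lambda>(X, I) _ _ g f. compose (carrier (free_alg S X)) g f)\<rparr>"

context scalar_set
begin

lemma hom_subst:
  assumes h: "h \<in> mv_hom S (free_alg S X) (free_alg S Y)"
    and "\<And>x. x \<in> X \<Longrightarrow> m x \<in> terms S Y \<and> h (free_gen S X x) = term_class S Y (m x)"
    and t: "t \<in> terms S X"
  shows "h (term_class S X t) = term_class S Y (subst m t)"
  unfolding hom_class[OF h t] using assms by (intro eval_free_subst[OF t]) auto

lemma hom_eqI:
  assumes "h \<in> mv_hom S (free_alg S X) A" "k \<in> mv_hom S (free_alg S X) A"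
    and "scalar_mv_algebra S A"
    and "\<And>x. x \<in> X \<Longrightarrow> h (free_gen S X x) = k (free_gen S X x)"
  shows "h = k"
proof -
  have "free_gen S X x \<in> carrier (free_alg S X)" if "x \<in> X" for x
    using that by (simp add: free_gen_def class_in)
  then have "(\<lambda>x. k (free_gen S X x)) ` X \<subseteq> carrier A" using assms(2) by (auto simp: mv_hom_def)
  from scalar_mv_algebra.free_alg_universal[OF assms(3) scalar_set_axioms this]
  show ?thesis using assms by blast
qed

lemma mv_terms_in: "t \<in> terms mv_scalars X \<Longrightarrow> t \<in> terms S X"
  using terms_mono by blast

lemma free_sub_eq:
  assumes "scalar_set S'" "S \<subseteq> S'"
  shows "free_sub S S' X = term_class S' X ` terms S X"
proof -
  interpret S': scalar_set S' by fact
  have "free_incl S' X (term_class S X t) = term_class S' X t" if "t \<in> terms S X" for t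
    using that term_eq_mono[OF assms(2)] term_eq.refl[of t S X]
    by (auto simp: free_incl_def term_class_def intro: term_eq.trans)
  then show ?thesis by (simp add: free_sub_def carrier_free image_image)
qed

lemma term_ideal_eq_iff:
  assumes "t \<in> terms S X" "u \<in> terms S X"
  shows "term_ideal S X t = term_ideal S X u \<longleftrightarrow> dominated S X t u \<and> dominated S X u t"
proof -
  interpret F: scalar_mv_algebra S "free_alg S X" by (rule free_alg_is_algebra)
  show ?thesis using assms unfolding term_ideal_def
    by (simp add: F.ideal_gen_singleton_eq_iff class_in class_in_ideal_gen_iff)
qed

text \<open>The condition that an arrow respects the ideals becomes a domination between terms. For
  MV-terms this is the form that can be compared across different scalars.\<close>

lemma hom_term_ideal_iff:
  assumes h: "h \<in> mv_hom S (free_alg S X) (free_alg S Y)"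
    and m: "\<And>x. x \<in> X \<Longrightarrow> m x \<in> terms S Y \<and> h (free_gen S X x) = term_class S Y (m x)"
    and t: "t \<in> terms S X" and u: "u \<in> terms S Y"
  shows "h ` term_ideal S X t \<subseteq> term_ideal S Y u \<longleftrightarrow> dominated S Y (subst m t) u"
proof -
  interpret X: scalar_mv_algebra S "free_alg S X" by (rule free_alg_is_algebra)
  interpret Y: scalar_mv_algebra S "free_alg S Y" by (rule free_alg_is_algebra)
  have "subst m t \<in> terms S Y" using subst_in[OF t] m by blast
  then have iff: "h (term_class S X t) \<in> term_ideal S Y u \<longleftrightarrow> dominated S Y (subst m t) u"
    using hom_subst[OF h m t] u by (simp add: term_ideal_def class_in_ideal_gen_iff)
  show ?thesis
  proof
    assume "h ` term_ideal S X t \<subseteq> term_ideal S Y u"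
    moreover have "term_class S X t \<in> term_ideal S X t"
      using X.ideal_gen_is_ideal(2)[of "{term_class S X t}"] class_in[OF t] by (simp add: term_ideal_def)
    ultimately show "dominated S Y (subst m t) u" using iff by blast
  next
    assume "dominated S Y (subst m t) u"
    then have "h (term_class S X t) \<in> term_ideal S Y u" using iff by simp
    then show "h ` term_ideal S X t \<subseteq> term_ideal S Y u"
      unfolding term_ideal_def
      using h class_in[OF t] class_in[OF u] Y.ideal_gen_is_ideal(1)[of "{term_class S Y u}"]
      by (intro hom_ideal_gen) (auto intro: X.mv_algebra_axioms Y.mv_algebra_axioms)
  qed
qed

lemma theory_category: "category (theory_category S)"
proof -
  have alg: "mv_algebra (free_alg S X)" for X
    using free_alg_is_algebra scalar_mv_algebra.axioms(1) by blast
  have scal: "r \<cdot>\<^bsub>free_alg S X\<^esub> x \<in> carrier (free_alg S X)"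
    if "r \<in> S" "x \<in> carrier (free_alg S X)" for r x X
    using that scalar_mv_algebra.scal_closed[OF free_alg_is_algebra] by blast
  have id: "(\<lambda>a\<in>carrier (free_alg S X). a) \<in> mv_hom S (free_alg S X) (free_alg S X)" for X
  proof -
    interpret F: mv_algebra "free_alg S X" by (rule alg)
    show ?thesis by (auto simp: mv_hom_def scal)
  qed
  have sub: "term_ideal S X t \<subseteq> carrier (free_alg S X)" if "t \<in> terms mv_scalars X" for X t
    using mv_algebra.ideal_gen_is_ideal(1)[OF alg, of "{term_class S X t}"] class_in[OF mv_terms_in[OF that]]
    unfolding term_ideal_def mv_ideal_def by auto
  have gen: "free_gen S X x \<in> carrier (free_alg S X)" if "x \<in> X" for x X
    using that by (simp add: free_gen_def class_in)
  have ext: "f \<in> extensional (carrier (free_alg S X))" "f \<in> carrier (free_alg S X) \<rightarrow> carrier (free_alg S Y)"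
    if "f \<in> Hom (theory_category S) (X, I) (Y, J)" for f X Y I J
    using that by (auto simp: theory_category_def mv_hom_def PiE_def)
  show ?thesis
  proof (unfold_locales; clarify)
    fix X I assume "(X, I) \<in> Obj (theory_category S)"
    then have I: "I \<subseteq> carrier (free_alg S X)" using sub by (auto simp: theory_category_def)
    have "(\<lambda>a\<in>carrier (free_alg S X). a) ` I \<subseteq> I" using I by auto
    moreover have "\<exists>s\<in>terms mv_scalars X. (\<lambda>a\<in>carrier (free_alg S X). a) (free_gen S X x) = term_class S X s"
      if "x \<in> X" for x
      using gen[OF that] that by (intro bexI[of _ "Var x"]) (simp_all add: free_gen_def)
    ultimately show "Idt (theory_category S) (X, I) \<in> Hom (theory_category S) (X, I) (X, I)"
      using id by (simp add: theory_category_def)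
  next
    fix X I Y J Z K f g
    assume obj: "(X, I) \<in> Obj (theory_category S)"
      and f: "f \<in> Hom (theory_category S) (X, I) (Y, J)"
      and g: "g \<in> Hom (theory_category S) (Y, J) (Z, K)"
    have I: "I \<subseteq> carrier (free_alg S X)" using obj sub by (auto simp: theory_category_def)
    have "compose (carrier (free_alg S X)) g f \<in> mv_hom S (free_alg S X) (free_alg S Z)"
      using f g by (intro mv_hom_compose[OF _ _ alg scal]) (auto simp: theory_category_def)
    moreover have "compose (carrier (free_alg S X)) g f ` I \<subseteq> K"
    proof -
      have "f ` I \<subseteq> J" "g ` J \<subseteq> K" using f g by (auto simp: theory_category_def)
      then show ?thesis using I by (auto simp: compose_def)
    qed
    moreover have "\<exists>s\<in>terms mv_scalars Z. compose (carrier (free_alg S X)) g f (free_gen S X x) = term_class S Z s"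
      if x: "x \<in> X" for x
    proof -
      obtain s where s: "s \<in> terms mv_scalars Y" "f (free_gen S X x) = term_class S Y s"
        using f x by (auto simp: theory_category_def)
      have g': "g \<in> mv_hom S (free_alg S Y) (free_alg S Z)"
        "\<forall>y\<in>Y. \<exists>s\<in>terms mv_scalars Z. g (free_gen S Y y) = term_class S Z s"
        using g by (auto simp: theory_category_def)
      then obtain m where m: "\<And>y. y \<in> Y \<Longrightarrow> m y \<in> terms mv_scalars Z \<and> g (free_gen S Y y) = term_class S Z (m y)"
        by metis
      \<comment> \<open>Arrows compose because \<open>g\<close> acts on the class of an MV-term by
        substitution, and substituting MV-terms into an MV-term yields an MV-term.\<close>
      then have "g (term_class S Y s) = term_class S Z (subst m s)"
        using mv_terms_in s(1) by (intro hom_subst[OF g'(1)]) auto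
      moreover have "subst m s \<in> terms mv_scalars Z" using subst_in[OF s(1)] m by blast
      ultimately show ?thesis using s gen[OF x] by (auto simp: compose_def)
    qed
    ultimately show "Comp (theory_category S) (X, I) (Y, J) (Z, K) g f \<in> Hom (theory_category S) (X, I) (Z, K)"
      by (simp add: theory_category_def)
  next
    fix X I Y J f assume f: "f \<in> Hom (theory_category S) (X, I) (Y, J)"
    show "Comp (theory_category S) (X, I) (X, I) (Y, J) f (Idt (theory_category S) (X, I)) = f"
      using ext[OF f] by (auto simp: theory_category_def compose_def extensional_def fun_eq_iff)
    show "Comp (theory_category S) (X, I) (Y, J) (Y, J) (Idt (theory_category S) (Y, J)) f = f"
      using ext[OF f] by (auto simp: theory_category_def compose_def extensional_def fun_eq_iff)
  next
    fix X I Y J Z K W L f g k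
    assume "f \<in> Hom (theory_category S) (X, I) (Y, J)"
    from ext(2)[OF this]
    show "Comp (theory_category S) (X, I) (Z, K) (W, L) k (Comp (theory_category S) (X, I) (Y, J) (Z, K) g f)
        = Comp (theory_category S) (X, I) (Y, J) (W, L) (Comp (theory_category S) (Y, J) (Z, K) (W, L) k g) f"
      by (auto simp: theory_category_def compose_def fun_eq_iff)
  qed
qed

end

text \<open>Without scalars every element of a free algebra is the class of an MV-term, so every
  homomorphism fulfils the clause on generators.\<close>

lemma ThMV_eq: "(ThMV :: 'x theory_cat) = theory_category mv_scalars"
proof -
  interpret S: scalar_set mv_scalars by (rule scalar_sets)
  have alg: "mv_algebra (MV X)" for X
    using S.free_alg_is_algebra scalar_mv_algebra.axioms(1) by blast
  have "fin_gen_ideal (MV X) I \<longleftrightarrow> (\<exists>t\<in>terms mv_scalars X. I = term_ideal mv_scalars X t)"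
    for X and I :: "'x mv_term set set"
  proof
    assume "fin_gen_ideal (MV X) I"
    then show "\<exists>t\<in>terms mv_scalars X. I = term_ideal mv_scalars X t"
      using mv_algebra.fin_gen_ideal_principal[OF alg] unfolding term_ideal_def S.carrier_free by blast
  next
    assume "\<exists>t\<in>terms mv_scalars X. I = term_ideal mv_scalars X t"
    then obtain t where "t \<in> terms mv_scalars X" "I = mv_ideal_gen (MV X) {term_class mv_scalars X t}"
      unfolding term_ideal_def by blast
    then show "fin_gen_ideal (MV X) I"
      unfolding fin_gen_ideal_def by (intro exI[of _ "{term_class mv_scalars X t}"]) (simp add: S.class_in)
  qed
  moreover have "\<exists>s\<in>terms mv_scalars Y. \<tau> (free_gen mv_scalars X x) = term_class mv_scalars Y s"
    if "\<tau> \<in> mv_hom mv_scalars (MV X) (MV Y)" "x \<in> X" for \<tau> x and X Y :: "'x set"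
  proof -
    have "\<tau> (free_gen mv_scalars X x) \<in> carrier (MV Y)"
      using that S.class_in[of "Var x" X] by (auto simp: mv_hom_def free_gen_def)
    then show ?thesis unfolding S.carrier_free by blast
  qed
  ultimately show ?thesis
    unfolding ThMV_def theory_category_def by (auto intro!: ext Collect_cong)
qed

lemma free_gen_image_subset_iff:
  assumes "scalar_set S"
  shows "\<tau> ` free_gen S X ` X \<subseteq> free_sub mv_scalars S Y \<longleftrightarrow>
    (\<forall>x\<in>X. \<exists>s\<in>terms mv_scalars Y. \<tau> (free_gen S X x) = term_class S Y s)"
  unfolding scalar_set.free_sub_eq[OF scalar_sets(1) assms empty_subsetI] by blast

lemma ThDMV'_eq: "(ThDMV' :: 'x theory_cat) = theory_category dmv_scalars"
proof -
  interpret S: scalar_set dmv_scalars by (rule scalar_sets)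
  have alg: "mv_algebra (DMV X)" for X
    using S.free_alg_is_algebra scalar_mv_algebra.axioms(1) by blast
  have "fin_gen_ideal (DMV X) I \<longleftrightarrow> (\<exists>t\<in>terms mv_scalars X. I = term_ideal dmv_scalars X t)"
    for X and I :: "'x mv_term set set"
  proof
    assume "fin_gen_ideal (DMV X) I"
    then obtain t where t: "t \<in> terms dmv_scalars X" "I = term_ideal dmv_scalars X t"
      using mv_algebra.fin_gen_ideal_principal[OF alg] unfolding term_ideal_def S.carrier_free by blast
    obtain g where "g \<in> terms mv_scalars X" "dominated dmv_scalars X t g" "dominated dmv_scalars X g t"
      using mv_term_same_ideal[OF t(1)] by blast
    then show "\<exists>t\<in>terms mv_scalars X. I = term_ideal dmv_scalars X t"
      using t S.term_ideal_eq_iff S.mv_terms_in by blast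
  next
    assume "\<exists>t\<in>terms mv_scalars X. I = term_ideal dmv_scalars X t"
    then obtain t where "t \<in> terms mv_scalars X" "I = mv_ideal_gen (DMV X) {term_class dmv_scalars X t}"
      unfolding term_ideal_def by blast
    then show "fin_gen_ideal (DMV X) I"
      unfolding fin_gen_ideal_def
      by (intro exI[of _ "{term_class dmv_scalars X t}"]) (simp add: S.class_in S.mv_terms_in)
  qed
  then show ?thesis
    unfolding ThDMV'_def theory_category_def free_gen_image_subset_iff[OF S.scalar_set_axioms]
    by (auto intro!: Collect_cong)
qed

text \<open>The generator is the class of a term with rational scalars, which has an MV-term
  generating the same ideal over the rationals. The dominations in both directions persist over the
  reals, where more equations are derivable.\<close>

lemma ThRMV'_eq: "(ThRMV' :: 'x theory_cat) = theory_category rmv_scalars"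
proof -
  interpret S: scalar_set rmv_scalars by (rule scalar_sets)
  have sub: "dmv_scalars \<subseteq> rmv_scalars" by blast
  have "(\<exists>f\<in>free_sub dmv_scalars rmv_scalars X. I = mv_ideal_gen (RMV X) {f}) \<longleftrightarrow>
      (\<exists>t\<in>terms dmv_scalars X. I = term_ideal rmv_scalars X t)"
    for X and I :: "'x mv_term set set"
    unfolding scalar_set.free_sub_eq[OF scalar_sets(2) S.scalar_set_axioms sub] term_ideal_def by blast
  moreover have "(\<exists>t\<in>terms dmv_scalars X. I = term_ideal rmv_scalars X t) \<longleftrightarrow>
      (\<exists>t\<in>terms mv_scalars X. I = term_ideal rmv_scalars X t)"
    for X and I :: "'x mv_term set set"
  proof
    assume "\<exists>t\<in>terms dmv_scalars X. I = term_ideal rmv_scalars X t"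
    then obtain t where t: "t \<in> terms dmv_scalars X" "I = term_ideal rmv_scalars X t" by blast
    obtain g where g: "g \<in> terms mv_scalars X" "dominated dmv_scalars X t g" "dominated dmv_scalars X g t"
      using mv_term_same_ideal[OF t(1)] by blast
    then have "term_ideal rmv_scalars X t = term_ideal rmv_scalars X g"
      using dominated_mono[OF g(2) sub] dominated_mono[OF g(3) sub] terms_mono[OF sub t(1)]
        S.mv_terms_in by (subst S.term_ideal_eq_iff) auto
    then show "\<exists>t\<in>terms mv_scalars X. I = term_ideal rmv_scalars X t" using t g by blast
  next
    assume "\<exists>t\<in>terms mv_scalars X. I = term_ideal rmv_scalars X t"
    then show "\<exists>t\<in>terms dmv_scalars X. I = term_ideal rmv_scalars X t"
      using terms_mono[OF empty_subsetI] by blast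
  qed
  ultimately show ?thesis
    unfolding ThRMV'_def theory_category_def free_gen_image_subset_iff[OF S.scalar_set_axioms] by simp
qed

section \<open>Matching theories over two sets of scalars\<close>

definition obj_rel :: "real set \<Rightarrow> real set \<Rightarrow> 'x theory_obj \<Rightarrow> 'x theory_obj \<Rightarrow> bool"
  where "obj_rel S S' A A' \<longleftrightarrow> fst A' = fst A \<and>
    (\<exists>t\<in>terms mv_scalars (fst A). snd A = term_ideal S (fst A) t \<and> snd A' = term_ideal S' (fst A) t)"

text \<open>Two arrows correspond if one substitution \<open>m\<close> by MV-terms describes both.
  Many substitutions describe the same arrow, hence the existential.\<close>

definition arr_rel :: "real set \<Rightarrow> real set \<Rightarrow> 'x theory_obj \<Rightarrow> 'x theory_obj \<Rightarrow>
    'x theory_obj \<Rightarrow> 'x theory_obj \<Rightarrow> 'x theory_arr \<Rightarrow> 'x theory_arr \<Rightarrow> bool"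
  where "arr_rel S S' A B A' B' f f' \<longleftrightarrow> fst A' = fst A \<and> fst B' = fst B \<and>
    (\<exists>m. \<forall>x\<in>fst A. m x \<in> terms mv_scalars (fst B) \<and>
      f (free_gen S (fst A) x) = term_class S (fst B) (m x) \<and>
      f' (free_gen S' (fst A) x) = term_class S' (fst B) (m x))"

lemma obj_rel_swap: "(\<lambda>A' A. obj_rel S S' A A') = obj_rel S' S"
  by (intro ext) (auto simp: obj_rel_def)

lemma arr_rel_swap: "(\<lambda>A' B' A B f' f. arr_rel S S' A B A' B' f f') = arr_rel S' S"
  unfolding arr_rel_def by (intro ext iffI; elim conjE exE; simp; blast)

lemma theory_correspondence:
  assumes S: "scalar_set S" "S \<subseteq> {0..1}" and S': "scalar_set S'" "S' \<subseteq> {0..1}"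
  shows "category_correspondence (theory_category S) (theory_category S' :: 'x theory_cat)
    (obj_rel S S') (arr_rel S S')"
proof -
  interpret S: scalar_set S by fact
  interpret S': scalar_set S' by fact
  \<comment> \<open>Neither of \<open>S\<close> and \<open>S'\<close> is assumed to contain the
    other; both are compared with the empty set of scalars.\<close>
  have class_iff: "term_class S X t = term_class S X u \<longleftrightarrow> term_class S' X t = term_class S' X u"
    if "t \<in> terms mv_scalars X" "u \<in> terms mv_scalars X" for X and t u :: "'x mv_term"
    using that term_eq_conservative[of mv_scalars S t X u] term_eq_conservative[of mv_scalars S' t X u] S S'
    by (simp add: S.class_eq_iff S'.class_eq_iff S.mv_terms_in S'.mv_terms_in)
  have dom_iff: "dominated S X t u \<longleftrightarrow> dominated S' X t u"
    if "t \<in> terms mv_scalars X" "u \<in> terms mv_scalars X" for X and t u :: "'x mv_term"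
    using that dominated_conservative[of mv_scalars S t X u] dominated_conservative[of mv_scalars S' t X u] S S'
    by simp
  have subst_dom: "subst m t \<in> terms mv_scalars Y"
    if "\<forall>x\<in>X. m x \<in> terms mv_scalars Y \<and> P x" "t \<in> terms mv_scalars X"
    for m t P and X Y :: "'x set"
    using subst_in[OF that(2)] that(1) by blast
  interpret C: category "theory_category S" by (rule S.theory_category)
  interpret D: category "theory_category S'" by (rule S'.theory_category)
  show ?thesis
  proof
    fix A assume "A \<in> Obj (theory_category S :: 'x theory_cat)"
    then obtain X t where "A = (X, term_ideal S X t)" "t \<in> terms mv_scalars X"
      by (auto simp: theory_category_def)
    then show "\<exists>A'\<in>Obj (theory_category S'). obj_rel S S' A A'"
      by (intro bexI[of _ "(X, term_ideal S' X t)"]) (auto simp: theory_category_def obj_rel_def)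
  next
    fix A A' B' :: "'x theory_obj" assume "obj_rel S S' A A'" "obj_rel S S' A B'"
    then obtain X t u where "t \<in> terms mv_scalars X" "u \<in> terms mv_scalars X"
      "term_ideal S X t = term_ideal S X u" "A' = (X, term_ideal S' X t)" "B' = (X, term_ideal S' X u)"
      by (cases A'; cases B') (auto simp: obj_rel_def)
    then show "A' = B'"
      using dom_iff S.term_ideal_eq_iff[of t X u] S'.term_ideal_eq_iff[of t X u]
      by (simp add: S.mv_terms_in S'.mv_terms_in)
  next
    fix A B A' B' :: "'x theory_obj" and f
    assume R: "obj_rel S S' A A'" "obj_rel S S' B B'" and f: "f \<in> Hom (theory_category S) A B"
    obtain X t where A: "A = (X, term_ideal S X t)" "A' = (X, term_ideal S' X t)" "t \<in> terms mv_scalars X"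
      using R(1) by (cases A; cases A') (auto simp: obj_rel_def)
    obtain Y u where B: "B = (Y, term_ideal S Y u)" "B' = (Y, term_ideal S' Y u)" "u \<in> terms mv_scalars Y"
      using R(2) by (cases B; cases B') (auto simp: obj_rel_def)
    have f': "f \<in> mv_hom S (free_alg S X) (free_alg S Y)" "f ` term_ideal S X t \<subseteq> term_ideal S Y u"
      using f by (auto simp: A B theory_category_def)
    \<comment> \<open>The substitution read off from \<open>f\<close> is reused over
      \<open>S'\<close>: freeness extends it to \<open>h\<close>, and since domination agrees for
      both sets of scalars, \<open>h\<close> respects the ideals.\<close>
    obtain m where m: "\<forall>x\<in>X. m x \<in> terms mv_scalars Y \<and> f (free_gen S X x) = term_class S Y (m x)"
      using f unfolding A B theory_category_def by simp metis
    have "(\<lambda>x. term_class S' Y (m x)) ` X \<subseteq> carrier (free_alg S' Y)"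
      using m by (auto intro: S'.class_in S'.mv_terms_in)
    from scalar_mv_algebra.free_alg_universal[OF S'.free_alg_is_algebra S'(1) this, THEN ex1_implies_ex]
    obtain h where h: "h \<in> mv_hom S' (free_alg S' X) (free_alg S' Y)"
      "\<forall>x\<in>X. h (free_gen S' X x) = term_class S' Y (m x)"
      by (elim exE conjE)
    have "dominated S Y (subst m t) u"
      using S.hom_term_ideal_iff[OF f'(1), of m t u] f'(2) m A(3) B(3) by (simp add: S.mv_terms_in)
    then have "dominated S' Y (subst m t) u" using dom_iff[OF subst_dom[OF m A(3)] B(3)] by simp
    then have "h ` term_ideal S' X t \<subseteq> term_ideal S' Y u"
      using S'.hom_term_ideal_iff[OF h(1), of m t u] h(2) m A(3) B(3) by (simp add: S'.mv_terms_in)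
    then have "h \<in> Hom (theory_category S') A' B'"
      using h m by (simp add: A B theory_category_def) blast
    moreover have "arr_rel S S' A B A' B' f h" unfolding arr_rel_def A B using m h(2) by auto
    ultimately show "\<exists>f'\<in>Hom (theory_category S') A' B'. arr_rel S S' A B A' B' f f'" by blast
  next
    fix A B A' B' :: "'x theory_obj" and f f' g'
    assume R: "obj_rel S S' A A'" "obj_rel S S' B B'"
      and f': "f' \<in> Hom (theory_category S') A' B'"
        "g' \<in> Hom (theory_category S') A' B'"
      and T: "arr_rel S S' A B A' B' f f'" "arr_rel S S' A B A' B' f g'"
    obtain X I Y J where A: "A' = (X, I)" "fst A = X" and B: "B' = (Y, J)" "fst B = Y"
      using R by (cases A'; cases B') (auto simp: obj_rel_def)
    \<comment> \<open>The two relations may supply different substitutions, but both describe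
      \<open>f\<close>, so their terms have equal classes over \<open>S\<close> and hence over
      \<open>S'\<close>.\<close>
    have "f' (free_gen S' X x) = g' (free_gen S' X x)" if "x \<in> X" for x
      using T class_iff that unfolding arr_rel_def A B by metis
    then show "f' = g'"
      using f' by (intro S'.hom_eqI[OF _ _ S'.free_alg_is_algebra]) (auto simp: A B theory_category_def)
  next
    fix A A' :: "'x theory_obj" assume R: "obj_rel S S' A A'"
    obtain X I I' where A: "A = (X, I)" "A' = (X, I')"
      using R by (cases A; cases A') (auto simp: obj_rel_def)
    show "arr_rel S S' A A A' A' (Idt (theory_category S) A) (Idt (theory_category S') A')"
      unfolding arr_rel_def A
      by (intro conjI exI[of _ Var]) (simp_all add: theory_category_def free_gen_def S.class_in S'.class_in)
  next
    fix A B E A' B' E' :: "'x theory_obj" and f g f' g'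
    assume R: "obj_rel S S' A A'" "obj_rel S S' B B'" "obj_rel S S' E E'"
      and f: "f \<in> Hom (theory_category S) A B" "f' \<in> Hom (theory_category S') A' B'"
      and g: "g \<in> Hom (theory_category S) B E" "g' \<in> Hom (theory_category S') B' E'"
      and T: "arr_rel S S' A B A' B' f f'" "arr_rel S S' B E B' E' g g'"
    obtain X I I' where A: "A = (X, I)" "A' = (X, I')"
      using R by (cases A; cases A') (auto simp: obj_rel_def)
    obtain Y J J' where B: "B = (Y, J)" "B' = (Y, J')"
      using R by (cases B; cases B') (auto simp: obj_rel_def)
    obtain Z K K' where E: "E = (Z, K)" "E' = (Z, K')"
      using R by (cases E; cases E') (auto simp: obj_rel_def)
    obtain m where m: "\<forall>x\<in>X. m x \<in> terms mv_scalars Y \<and>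
        f (free_gen S X x) = term_class S Y (m x) \<and> f' (free_gen S' X x) = term_class S' Y (m x)"
      using T(1) unfolding arr_rel_def A B by auto
    obtain n where n: "\<forall>x\<in>Y. n x \<in> terms mv_scalars Z \<and>
        g (free_gen S Y x) = term_class S Z (n x) \<and> g' (free_gen S' Y x) = term_class S' Z (n x)"
      using T(2) unfolding arr_rel_def B E by auto
    have hom: "g \<in> mv_hom S (free_alg S Y) (free_alg S Z)" "g' \<in> mv_hom S' (free_alg S' Y) (free_alg S' Z)"
      using g by (auto simp: B E theory_category_def)
    have "g (term_class S Y s) = term_class S Z (subst n s)" "g' (term_class S' Y s) = term_class S' Z (subst n s)"
      if "s \<in> terms mv_scalars Y" for s
      using n that
      by (auto intro!: S.hom_subst[OF hom(1)] S'.hom_subst[OF hom(2)] S.mv_terms_in S'.mv_terms_in)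
    moreover have "free_gen S X x \<in> carrier (free_alg S X)" "free_gen S' X x \<in> carrier (free_alg S' X)"
      if "x \<in> X" for x
      using that by (simp_all add: free_gen_def S.class_in S'.class_in)
    ultimately show "arr_rel S S' A E A' E' (Comp (theory_category S) A B E g f) (Comp (theory_category S') A' B' E' g' f')"
      unfolding arr_rel_def A B E using m subst_dom[OF n]
      by (intro conjI exI[of _ "\<lambda>x. subst n (m x)"]) (simp_all add: theory_category_def compose_def)
  qed
qed

text \<open>The hypotheses are symmetric in \<open>S\<close> and \<open>S'\<close>, and exchanging
  the arguments of the relations exchanges the scalars; one correspondence result therefore serves
  both directions.\<close>

lemma theory_categories_equivalent:
  assumes "scalar_set S" "S \<subseteq> {0..1}" "scalar_set S'" "S' \<subseteq> {0..1}"
  shows "equivalent_categories (theory_category S :: 'x theory_cat) (theory_category S' :: 'x theory_cat)"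
proof (rule equivalent_by_correspondence)
  show "category_correspondence (theory_category S) (theory_category S' :: 'x theory_cat)
      (obj_rel S S') (arr_rel S S')"
    by (rule theory_correspondence[OF assms])
  show "category_correspondence (theory_category S' :: 'x theory_cat) (theory_category S)
      (\<lambda>A' A. obj_rel S S' A A') (\<lambda>A' B' A B f' f. arr_rel S S' A B A' B' f f')"
    unfolding obj_rel_swap arr_rel_swap by (rule theory_correspondence[OF assms(3,4,1,2)])
qed

theorem proposition3p16:
  shows "equivalent_categories (ThMV :: 'x theory_cat) (ThDMV' :: 'x theory_cat) \<and>
         equivalent_categories (ThDMV' :: 'x theory_cat) (ThRMV' :: 'x theory_cat) \<and>
         equivalent_categories (ThMV :: 'x theory_cat) (ThRMV' :: 'x theory_cat)"
  unfolding ThMV_eq ThDMV'_eq ThRMV'_eq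
  by (intro conjI theory_categories_equivalent scalar_sets) auto

end
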